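(* The seven-dimensional nilpotent Lie algebra \[ \mathfrak{n}_9=(0,0,e^{12},e^{13},e^{23},e^{15} + e^{24},e^{16} + e^{34} + e^{25}) \] does not admit any semi-algebraic soliton.
   Context: $d$ denotes the Chevalley-Eilenberg differential, with $d\alpha(x,y)=-\alpha([x,y])$ for 1-forms $\alpha$. The 7-tuple defining $\mathfrak{n}_9$ lists $(de^1,\ldots,de^7)$ with respect to a basis $(e^1,\ldots,e^7)$ of the dual space, and $e^{ij}=e^i\wedge e^j$. A 3-form $\varphi$ on a seven-dimensional vector space $W$ is definite if $\iota_w\varphi$ has rank six for each non-zero $w\in W$. A $\mathrm{G}_2$-structure on a seven-dimensional Lie algebra $\mathfrak{g}$ is a definite $\varphi\in\Lambda^3\mathfrak{g}^*$; it is closed if $d\varphi=0$. With $b_\varphi(v,w)=\frac16\,\iota_v\varphi\wedge\iota_w\varphi\wedge\varphi\in\Lambda^7\mathfrak{g}^*$, it induces the inner product $g_\varphi=\det(b_\varphi)^{-1/9}b_\varphi$ and the volume form $\det(b_\varphi)^{1/9}$; $*_\varphi$ is the corresponding Hodge operator. The intrinsic torsion form of a closed $\varphi$ is the unique $\tau\in\Lambda^2\mathfrak{g}^*$ with $\tau\wedge\varphi=-*_\varphi\tau$ and $d*_\varphi\varphi=\tau\wedge\varphi$; the Hodge Laplacian is $\Delta_\varphi\varphi=d\tau$. A closed $\mathrm{G}_2$-structure $\varphi$ on $\mathfrak{g}$ is a semi-algebraic soliton if $\Delta_\varphi\varphi=\lambda\varphi+D^*\varphi$ for some $\lambda\in\mathbb{R}$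 and some derivation $D\in\mathrm{Der}(\mathfrak{g})$, where $A^*\beta(x_1,\ldots,x_k)=\beta(Ax_1,\ldots,x_k)+\cdots+\beta(x_1,\ldots,Ax_k)$ for $A\in\mathrm{End}(\mathfrak{g})$ and $\beta\in\Lambda^k\mathfrak{g}^*$. *)

theory Defs
  imports "HOL-Analysis.Analysis"
begin

text \<open>
  Forms on \<open>real^7\<close> are functions on lists of vectors.  A k-form vanishes on every list whose
  length is not k; this convention makes the degree recoverable from the form, so that the
  operations below need no degree argument.
\<close>

type_synonym form = "(real^7) list \<Rightarrow> real"

definition alt_form :: "nat \<Rightarrow> form \<Rightarrow> bool" where
  "alt_form k \<alpha> \<longleftrightarrow>
     (\<forall>xs. length xs \<noteq> k \<longrightarrow> \<alpha> xs = 0) \<and>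
     (\<forall>xs i. length xs = k \<longrightarrow> i < k \<longrightarrow> linear (\<lambda>x. \<alpha> (xs[i := x]))) \<and>
     (\<forall>xs. length xs = k \<longrightarrow> \<not> distinct xs \<longrightarrow> \<alpha> xs = 0)"

text \<open>
  In the index type \<open>7\<close> the numeral 7 equals 0; thus \<open>E 1, \<dots>, E 7\<close> are the seven standard basis
  vectors, with \<open>E 7 = E 0\<close>.
\<close>

abbreviation E :: "7 \<Rightarrow> real^7" where
  "E i \<equiv> axis i 1"

definition contract :: "real^7 \<Rightarrow> form \<Rightarrow> form" where
  "contract v \<alpha> = (\<lambda>xs. \<alpha> (v # xs))"

text \<open>
  The sum over shuffles: the positions in S (in increasing order) feed \<open>\<alpha>\<close>, the remaining ones
  feed \<open>\<beta>\<close>, and the sign is that of the corresponding shuffle permutation.  If \<open>\<alpha>\<close> is a k-form,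
  only the S with k elements contribute.  The normalisation is that of
  \<open>(\<alpha> \<and> \<beta>)(x,y) = \<alpha>(x) \<beta>(y) - \<alpha>(y) \<beta>(x)\<close> for 1-forms.
\<close>

definition wedge :: "form \<Rightarrow> form \<Rightarrow> form" where
  "wedge \<alpha> \<beta> = (\<lambda>xs. \<Sum>S\<in>Pow {..<length xs}.
     (-1) ^ card {(i, j). i \<in> S \<and> j \<in> {..<length xs} - S \<and> j < i}
       * \<alpha> (nths xs S) * \<beta> (nths xs (- S)))"

definition coframe1 :: "7 \<Rightarrow> form" where
  "coframe1 i = (\<lambda>xs. if length xs = 1 then hd xs $ i else 0)"

text \<open>\<open>coframe [i, j, \<dots>]\<close> is the wedge product of the dual basis forms with these indices.\<close>

fun coframe :: "7 list \<Rightarrow> form" where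
  "coframe [] = (\<lambda>xs. if xs = [] then 1 else 0)"
| "coframe (i # is) = wedge (coframe1 i) (coframe is)"

definition lie_bracket :: "(real^7 \<Rightarrow> real^7 \<Rightarrow> real^7) \<Rightarrow> bool" where
  "lie_bracket br \<longleftrightarrow> bilinear br \<and> (\<forall>x. br x x = 0) \<and>
     (\<forall>x y z. br x (br y z) + br y (br z x) + br z (br x y) = 0)"

definition derivation :: "(real^7 \<Rightarrow> real^7 \<Rightarrow> real^7) \<Rightarrow> (real^7 \<Rightarrow> real^7) \<Rightarrow> bool" where
  "derivation br D \<longleftrightarrow> linear D \<and> (\<forall>x y. D (br x y) = br (D x) y + br x (D y))"

definition ce_diff :: "(real^7 \<Rightarrow> real^7 \<Rightarrow> real^7) \<Rightarrow> form \<Rightarrow> form" where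
  "ce_diff br \<alpha> = (\<lambda>xs. \<Sum>(i, j)\<in>{(i, j). i < j \<and> j < length xs}.
     (-1) ^ (i + j) * \<alpha> (br (xs ! i) (xs ! j) # nths xs (- {i, j})))"

definition endo_pull :: "(real^7 \<Rightarrow> real^7) \<Rightarrow> form \<Rightarrow> form" where
  "endo_pull A \<beta> = (\<lambda>xs. \<Sum>i<length xs. \<beta> (xs[i := A (xs ! i)]))"

definition definite :: "form \<Rightarrow> bool" where
  "definite \<phi> \<longleftrightarrow> alt_form 3 \<phi> \<and>
     (\<forall>w. w \<noteq> 0 \<longrightarrow> rank ((\<chi> i j. contract w \<phi> [E i, E j]) :: real^7^7) = 6)"

definition g2_bilinear :: "form \<Rightarrow> real^7 \<Rightarrow> real^7 \<Rightarrow> form" where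
  "g2_bilinear \<phi> v w =
     (\<lambda>xs. 1/6 * wedge (wedge (contract v \<phi>) (contract w \<phi>)) \<phi> xs)"

text \<open>
  We write \<open>b(v,w) = B(v,w) e\<^sup>1\<^sup>2\<^sup>3\<^sup>4\<^sup>5\<^sup>6\<^sup>7\<close>.  The determinant of b is then \<open>det B\<close> times the ninth
  power of \<open>e\<^sup>1\<^sup>2\<^sup>3\<^sup>4\<^sup>5\<^sup>6\<^sup>7\<close> (seven factors from the values of b, two from the change of volume
  element on the 7-dimensional space), so its ninth
  root is the 7-form \<open>root 9 (det B) e\<^sup>1\<^sup>2\<^sup>3\<^sup>4\<^sup>5\<^sup>6\<^sup>7\<close>.
  The real root is odd, so a negative \<open>det B\<close> is handled as well.
\<close>

definition g2_coeff :: "form \<Rightarrow> real^7 \<Rightarrow> real^7 \<Rightarrow> real" where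
  "g2_coeff \<phi> v w = g2_bilinear \<phi> v w [E 1, E 2, E 3, E 4, E 5, E 6, E 7]"

definition g2_root :: "form \<Rightarrow> real" where
  "g2_root \<phi> = root 9 (det (\<chi> i j. g2_coeff \<phi> (E i) (E j)))"

definition g2_metric :: "form \<Rightarrow> real^7 \<Rightarrow> real^7 \<Rightarrow> real" where
  "g2_metric \<phi> v w = g2_coeff \<phi> v w / g2_root \<phi>"

definition g2_volume :: "form \<Rightarrow> form" where
  "g2_volume \<phi> = (\<lambda>xs. g2_root \<phi> * coframe [1, 2, 3, 4, 5, 6, 7] xs)"

text \<open>
  The Hodge operator on k-forms, in index notation
  \<open>(*\<beta>)(ys) = 1/k! \<Sum> g\<^sup>i\<^sup>1\<^sup>j\<^sup>1 \<dots> g\<^sup>i\<^sup>k\<^sup>j\<^sup>k \<beta>(e\<^sub>i\<^sub>1, \<dots>, e\<^sub>i\<^sub>k) vol(e\<^sub>j\<^sub>1, \<dots>, e\<^sub>j\<^sub>k, ys)\<close>;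
  it satisfies \<open>\<alpha> \<and> *\<beta> = g(\<alpha>, \<beta>) vol\<close>.
\<close>

definition g2_star :: "form \<Rightarrow> nat \<Rightarrow> form \<Rightarrow> form" where
  "g2_star \<phi> k \<beta> =
     (let Ginv = matrix_inv (\<chi> i j. g2_metric \<phi> (E i) (E j)) :: real^7^7 in
      (\<lambda>ys. 1 / fact k *
         (\<Sum>I\<in>{I. length I = k}. \<Sum>J\<in>{J. length J = k}.
            (\<Prod>r<k. Ginv $ (I ! r) $ (J ! r)) * \<beta> (map E I) * g2_volume \<phi> (map E J @ ys))))"

definition closed_g2_structure :: "(real^7 \<Rightarrow> real^7 \<Rightarrow> real^7) \<Rightarrow> form \<Rightarrow> bool" where
  "closed_g2_structure br \<phi> \<longleftrightarrow> definite \<phi> \<and> (\<forall>xs. ce_diff br \<phi> xs = 0)"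

definition torsion_form :: "(real^7 \<Rightarrow> real^7 \<Rightarrow> real^7) \<Rightarrow> form \<Rightarrow> form \<Rightarrow> bool" where
  "torsion_form br \<phi> \<tau> \<longleftrightarrow> alt_form 2 \<tau> \<and>
     (\<forall>xs. wedge \<tau> \<phi> xs = - g2_star \<phi> 2 \<tau> xs) \<and>
     (\<forall>xs. ce_diff br (g2_star \<phi> 3 \<phi>) xs = wedge \<tau> \<phi> xs)"

text \<open>
  The Hodge Laplacian of a closed \<open>\<phi>\<close> is \<open>d\<tau>\<close>, where \<open>\<tau>\<close> is the (existing and unique) torsion form.
\<close>

definition semi_algebraic_soliton :: "(real^7 \<Rightarrow> real^7 \<Rightarrow> real^7) \<Rightarrow> form \<Rightarrow> bool" where
  "semi_algebraic_soliton br \<phi> \<longleftrightarrow> closed_g2_structure br \<phi> \<and>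
     (\<exists>\<tau> l D. torsion_form br \<phi> \<tau> \<and> derivation br D \<and>
        (\<forall>xs. ce_diff br \<tau> xs = l * \<phi> xs + endo_pull D \<phi> xs))"

text \<open>
  The differentials of the dual basis of \<open>\<nn>\<^sub>9\<close>; the bracket is determined by them through
  \<open>e\<^sup>k([x,y]) = - de\<^sup>k(x,y)\<close>.
\<close>

definition n9_structure :: "form list" where
  "n9_structure =
     [\<lambda>xs. 0,
      \<lambda>xs. 0,
      coframe [1, 2],
      coframe [1, 3],
      coframe [2, 3],
      \<lambda>xs. coframe [1, 5] xs + coframe [2, 4] xs,
      \<lambda>xs. coframe [1, 6] xs + coframe [3, 4] xs + coframe [2, 5] xs]"

definition n9_bracket :: "real^7 \<Rightarrow> real^7 \<Rightarrow> real^7" where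
  "n9_bracket x y = vector (map (\<lambda>\<omega>. - \<omega> [x, y]) n9_structure)"

text \<open>The bracket in coordinates, and the checks that it is a Lie bracket with these differentials.\<close>

lemma coframe_pair: "coframe [i, j] [x, y] = x $ i * y $ j - y $ i * x $ j"
proof -
  have P2: "Pow {..<Suc (Suc 0)} = {{}, {0}, {1}, {0, 1}}"
    by (auto simp: lessThan_Suc Pow_insert)
  have P1: "Pow {..<Suc 0} = {{}, {0}}"
    by (auto simp: lessThan_Suc Pow_insert)
  have c: "{(i, j). i = Suc 0 \<and> j < Suc (Suc 0) \<and> j \<noteq> Suc 0 \<and> j < i} = {(1, 0)}"
    by auto
  have c': "{(i, j). i = 0 \<and> j < Suc (Suc 0) \<and> 0 < j \<and> j < i} = ({} :: (nat \<times> nat) set)"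
    by auto
  have c0: "{(i, j). i = (0::nat) \<and> j = (0::nat) \<and> 0 < j \<and> j < i} = {}"
    by auto
  have e: "coframe [j] [z] = z $ j" for z :: "real^7"
    by (simp add: wedge_def P1 coframe1_def nths_Cons c0)
  have "coframe [i, j] [x, y] = wedge (coframe1 i) (coframe [j]) [x, y]"
    by simp
  also have "\<dots> = x $ i * y $ j - y $ i * x $ j"
    using e[of x] e[of y]
    unfolding wedge_def[of "coframe1 i" "coframe [j]"]
    by (simp add: P2 coframe1_def nths_Cons c c' del: coframe.simps)
  finally show ?thesis .
qed

lemma n9_bracket_nth:
  "n9_bracket x y $ 1 = 0"
  "n9_bracket x y $ 2 = 0"
  "n9_bracket x y $ 3 = - (x $ 1 * y $ 2 - y $ 1 * x $ 2)"
  "n9_bracket x y $ 4 = - (x $ 1 * y $ 3 - y $ 1 * x $ 3)"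
  "n9_bracket x y $ 5 = - (x $ 2 * y $ 3 - y $ 2 * x $ 3)"
  "n9_bracket x y $ 6 = - (x $ 1 * y $ 5 - y $ 1 * x $ 5) - (x $ 2 * y $ 4 - y $ 2 * x $ 4)"
  "n9_bracket x y $ 0 = - (x $ 1 * y $ 6 - y $ 1 * x $ 6)
     - (x $ 3 * y $ 4 - y $ 3 * x $ 4) - (x $ 2 * y $ 5 - y $ 2 * x $ 5)"
  by (simp_all add: n9_bracket_def n9_structure_def coframe_pair vector_def del: coframe.simps)

lemma seven_eq_0: "(7 :: 7) = 0"
  by simp

lemma UNIV_7: "(UNIV :: 7 set) = {0, 1, 2, 3, 4, 5, 6}"
proof -
  have "{0, 1, 2, 3, 4, 5, 6} = (UNIV :: 7 set)"
    by (rule card_seteq) simp_all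
  then show ?thesis ..
qed

lemma vec7_eq_iff: "x = y \<longleftrightarrow> (\<forall>i\<in>{0, 1, 2, 3, 4, 5, 6}. x $ i = y $ i)" for x y :: "real^7"
  by (simp only: vec_eq_iff UNIV_7[symmetric] ball_UNIV)

lemma lie_bracket_n9: "lie_bracket n9_bracket"
  unfolding lie_bracket_def bilinear_def
  by (auto intro!: linearI simp: vec7_eq_iff n9_bracket_nth algebra_simps)

lemma length_nths_Compl: "length (nths xs S) + length (nths xs (- S)) = length xs"
proof -
  have "card {i. i < length xs \<and> i \<in> S} + card {i. i < length xs \<and> i \<notin> S}
      = card ({i. i < length xs \<and> i \<in> S} \<union> {i. i < length xs \<and> i \<notin> S})"
    by (rule card_Un_disjoint[symmetric]) auto
  also have "\<dots> = card {..<length xs}"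
    by (rule arg_cong[of _ _ card]) auto
  finally show ?thesis
    by (simp add: length_nths)
qed

lemma coframe_degree: "length xs \<noteq> length is \<Longrightarrow> coframe is xs = 0"
proof (induction "is" arbitrary: xs)
  case (Cons i "is")
  have "coframe1 i (nths xs S) * coframe is (nths xs (- S)) = 0" for S
    using Cons.IH[of "nths xs (- S)"] Cons.prems length_nths_Compl[of xs S]
    by (auto simp: coframe1_def)
  then show ?case
    by (auto simp: wedge_def mult.assoc intro!: sum.neutral)
qed auto

lemma ce_diff_coframe1_n9:
  assumes "k < 7"
  shows "ce_diff n9_bracket (coframe1 (of_nat (Suc k))) = n9_structure ! k"
proof
  fix xs :: "(real^7) list"
  let ?i = "of_nat (Suc k) :: 7"
  show "ce_diff n9_bracket (coframe1 ?i) xs = (n9_structure ! k) xs"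
  proof (cases "length xs = 2")
    case True
    then obtain x y where xs: "xs = [x, y]"
      by (auto simp: numeral_2_eq_2 length_Suc_conv)
    have ij: "{(i, j). i < j \<and> j < Suc (Suc 0)} = {(0, 1)}"
      by auto
    have "ce_diff n9_bracket (coframe1 ?i) xs = - (n9_bracket x y $ ?i)"
      by (simp add: ce_diff_def xs ij coframe1_def nths_Cons)
    moreover have "k = 0 \<or> k = 1 \<or> k = 2 \<or> k = 3 \<or> k = 4 \<or> k = 5 \<or> k = 6"
      using assms by auto
    ultimately show ?thesis
      by (elim disjE) (simp_all add: xs n9_structure_def coframe_pair n9_bracket_nth seven_eq_0 del: coframe.simps)
  next
    case False
    have "nths xs (- {i, j}) \<noteq> []" if "i < j" "j < length xs" for i j
    proof -
      have "\<not> {0, 1, 2} \<subseteq> {i, j}"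
        by auto
      moreover have "{0, 1, 2} \<subseteq> {..<length xs}"
        using that False by auto
      ultimately obtain m where "m < length xs" "m \<notin> {i, j}"
        by blast
      then have "xs ! m \<in> set (nths xs (- {i, j}))"
        by (auto simp: set_nths)
      then show ?thesis
        by auto
    qed
    then have "ce_diff n9_bracket (coframe1 ?i) xs = 0"
      unfolding ce_diff_def by (intro sum.neutral) (auto simp: coframe1_def)
    moreover have "k = 0 \<or> k = 1 \<or> k = 2 \<or> k = 3 \<or> k = 4 \<or> k = 5 \<or> k = 6"
      using assms by auto
    ultimately show ?thesis
      using False
      by (elim disjE) (simp_all add: n9_structure_def coframe_degree del: coframe.simps)
  qed
qed

end

theory Submission
  imports Defs
begin

text \<open>
  Let \<open>\<phi>\<close> be a closed definite 3-form on n9 with \<open>d\<tau> = \<lambda>\<phi> + D\<^sup>*\<phi>\<close>.  A derivation has the form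
  \<open>D = c diag(1, \<dots>, 7) + N\<close> with \<open>N\<close> strictly lower triangular.  Closedness restricts the coefficients
  of \<open>\<phi>\<close>, and as the contraction of \<open>\<phi>\<close> with the central vector \<open>e\<^sub>7\<close> has rank six, \<open>\<phi>\<^sub>2\<^sub>6\<^sub>7\<close> and
  \<open>\<phi>\<^sub>1\<^sub>4\<^sub>7\<close> are nonzero.  Both \<open>[e\<^sub>2, e\<^sub>6]\<close> and \<open>[e\<^sub>1, e\<^sub>4]\<close> vanish, so evaluating the soliton equation
  at \<open>(e\<^sub>2, e\<^sub>6, e\<^sub>7)\<close> and \<open>(e\<^sub>1, e\<^sub>4, e\<^sub>7)\<close> gives \<open>\<lambda> + 15c = 0 = \<lambda> + 12c\<close>; hence \<open>\<lambda> = c = 0\<close> and \<open>D\<close> is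
  traceless.  By unimodularity \<open>|\<tau>|\<^sup>2 vol = d\<tau> \<and> *\<phi> = D\<^sup>*\<phi> \<and> *\<phi> = 3 tr(D) vol = 0\<close>, so \<open>\<phi>\<close> is coclosed,
  which is excluded by a computation with the cross product.

  The G2 identities are read off from a frame in which \<open>\<phi>\<close> is the standard 3-form.  To find
  it, normalise the metric and maximise \<open>\<phi>\<close> over triples of unit vectors: the first-order conditions
  split \<open>\<phi>\<close> along the maximising 3-plane and its orthogonal complement, and orthonormality then
  forces the remaining coefficients into normal form.
\<close>

subsection \<open>Alternating forms\<close>

text \<open>Definiteness is only a rank condition, so it has to be proved that \<open>b\<close> is a
  definite form at all: rank six makes b(v,v) nonzero for nonzero v, and connectedness of the
  punctured space makes its sign constant. No orientation is given in advance; the odd ninth root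
  absorbs the sign, so an adapted frame may have negative determinant.

  The bracket of n9 is graded with e_i in degree i, which is where diag(1, ..., 7) comes from. The
  two evaluations have the distinct weights 2 + 6 + 7 = 15 and 1 + 4 + 7 = 12, and this separates
  \<lambda> from c. The two coefficients of \<phi> are nonzero because, for closed \<phi>, the
  Pfaffian of the contraction with e_7 on e_1, ..., e_6 equals up to sign the coefficient at 147
  times the square of that at 267.

  The minus sign in the equation that \<tau> wedge \<phi> is -*\<tau> cancels the one from
  integration by parts. Hence the pairing of d\<tau> with \<phi> is a sum of squares, and
  tracelessness of \<open>D\<close> alone kills \<tau>.\<close>

lemma alt_form_degree: "alt_form k \<alpha> \<Longrightarrow> length xs \<noteq> k \<Longrightarrow> \<alpha> xs = 0"
  by (simp add: alt_form_def)

lemma alt_form_linear: "alt_form k \<alpha> \<Longrightarrow> length xs = k \<Longrightarrow> i < k \<Longrightarrow> linear (\<lambda>x. \<alpha> (xs[i := x]))"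
  by (simp add: alt_form_def)

lemma alt_form_not_distinct: "alt_form k \<alpha> \<Longrightarrow> \<not> distinct xs \<Longrightarrow> \<alpha> xs = 0"
  by (cases "length xs = k") (simp_all add: alt_form_def)

lemma alt_form_linear_append:
  assumes "alt_form k \<alpha>" "length us + length vs + 1 = k"
  shows "linear (\<lambda>x. \<alpha> (us @ x # vs))"
  using alt_form_linear[OF assms(1), of "us @ 0 # vs" "length us"] assms(2) by simp

lemma alt_form_linear_hd: "alt_form k \<alpha> \<Longrightarrow> linear (\<lambda>x. \<alpha> (x # vs))"
proof (cases "Suc (length vs) = k")
  case False
  assume "alt_form k \<alpha>"
  then have "(\<lambda>x. \<alpha> (x # vs)) = (\<lambda>x. 0)"
    using False by (auto simp: alt_form_degree)
  then show ?thesis by (simp add: module_hom_zero)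
qed (use alt_form_linear_append[of k \<alpha> "[]" vs] in simp)

text \<open>Polarisation: the value with \<open>x + y\<close> in both slots is 0, and expanding it
  leaves only the two mixed terms.\<close>

lemma alt_form_swap:
  assumes a: "alt_form k \<alpha>"
  shows "\<alpha> (us @ x # vs @ y # ws) = - \<alpha> (us @ y # vs @ x # ws)"
proof (cases "length us + length vs + length ws + 2 = k")
  case True
  have l1: "linear (\<lambda>u. \<alpha> (us @ u # vs @ w # ws))" for w
    by (rule alt_form_linear_append[OF a]) (use True in simp)
  have l2: "linear (\<lambda>u. \<alpha> (us @ w # vs @ u # ws))" for w
    using alt_form_linear_append[OF a, of "us @ w # vs" ws] True by simp
  have z: "\<alpha> (us @ u # vs @ u # ws) = 0" for u
    by (rule alt_form_not_distinct[OF a]) auto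
  have "0 = \<alpha> (us @ (x + y) # vs @ (x + y) # ws)"
    by (simp add: z)
  also have "\<dots> = \<alpha> (us @ x # vs @ y # ws) + \<alpha> (us @ y # vs @ x # ws)"
    unfolding linear_add[OF l1] linear_add[OF l2] by (simp add: z)
  finally show ?thesis by linarith
next
  case False
  then show ?thesis by (simp add: alt_form_degree[OF a])
qed

lemma alt_form_contract:
  assumes "alt_form (Suc k) \<alpha>"
  shows "alt_form k (contract v \<alpha>)"
proof -
  have "linear (\<lambda>x. \<alpha> (v # xs[i := x]))" if "length xs = k" "i < k" for xs i
    using alt_form_linear[OF assms, of "v # xs" "Suc i"] that by simp
  then show ?thesis
    using assms unfolding contract_def alt_form_def by simp
qed

lemma alt_form_contract_list:
  assumes "alt_form (length us + k) \<alpha>"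
  shows "alt_form k (\<lambda>xs. \<alpha> (us @ xs))"
  using assms
proof (induction us arbitrary: \<alpha>)
  case (Cons u us)
  then have "alt_form (length us + k) (contract u \<alpha>)"
    by (intro alt_form_contract) simp
  from Cons.IH[OF this] show ?case
    by (simp add: contract_def)
qed simp

lemma alt_form_zero: "alt_form k (\<lambda>xs. 0)"
  by (simp add: alt_form_def module_hom_zero)

lemma alt_form_add: "alt_form k \<alpha> \<Longrightarrow> alt_form k \<beta> \<Longrightarrow> alt_form k (\<lambda>xs. \<alpha> xs + \<beta> xs)"
  by (auto simp: alt_form_def intro!: linear_compose_add)

lemma alt_form_scale:
  assumes "alt_form k \<alpha>"
  shows "alt_form k (\<lambda>xs. c * \<alpha> xs)"
proof -
  have "linear (\<lambda>x. c * \<alpha> (xs[i := x]))" if "length xs = k" "i < k" for xs i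
    using linear_compose_scale_right[OF alt_form_linear[OF assms that], of c] by simp
  then show ?thesis
    using assms by (simp add: alt_form_def)
qed

lemma alt_form_sum:
  "(\<And>a. a \<in> A \<Longrightarrow> alt_form k (\<alpha> a)) \<Longrightarrow> alt_form k (\<lambda>xs. \<Sum>a\<in>A. \<alpha> a xs)"
proof (induction A rule: infinite_finite_induct)
  case (insert x F)
  then show ?case
    using alt_form_add[of k "\<alpha> x" "\<lambda>xs. \<Sum>a\<in>F. \<alpha> a xs"] by simp
qed (simp_all add: alt_form_zero)

text \<open>
  Alternation needs to be checked on neighbours only: a transposition of neighbours changes the
  sign, and repeated transpositions move two equal entries next to each other.
\<close>

lemma alt_formI:
  assumes deg: "\<And>xs. length xs \<noteq> k \<Longrightarrow> \<alpha> xs = 0"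
    and lin: "\<And>us vs. length us + length vs + 1 = k \<Longrightarrow> linear (\<lambda>x. \<alpha> (us @ x # vs))"
    and adj: "\<And>us x vs. \<alpha> (us @ x # x # vs) = 0"
  shows "alt_form k \<alpha>"
proof -
  have swap: "\<alpha> (us @ x # y # vs) = - \<alpha> (us @ y # x # vs)" for us x y vs
  proof (cases "length us + length vs + 2 = k")
    case True
    have l1: "linear (\<lambda>u. \<alpha> (us @ u # w # vs))" for w
      by (rule lin) (use True in simp)
    have l2: "linear (\<lambda>u. \<alpha> (us @ w # u # vs))" for w
      using lin[of "us @ [w]" vs] True by simp
    have "0 = \<alpha> (us @ (x + y) # (x + y) # vs)"
      by (simp add: adj)
    also have "\<dots> = \<alpha> (us @ x # y # vs) + \<alpha> (us @ y # x # vs)"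
      unfolding linear_add[OF l1] linear_add[OF l2] by (simp add: adj)
    finally show ?thesis by linarith
  qed (simp add: deg)
  have z: "\<alpha> (us @ x # vs @ x # ws) = 0" for us x vs ws
  proof (induction vs arbitrary: us)
    case (Cons v vs)
    then show ?case
      using swap[of us x v "vs @ x # ws"] Cons.IH[of "us @ [v]"] by simp
  qed (simp add: adj)
  have "\<alpha> xs = 0" if nd: "\<not> distinct xs" for xs
  proof -
    obtain us x vs ws where "xs = us @ [x] @ vs @ [x] @ ws"
      using not_distinct_decomp[OF nd] by blast
    then show ?thesis using z by simp
  qed
  moreover have "linear (\<lambda>x. \<alpha> (xs[i := x]))" if "length xs = k" "i < k" for xs i
    using lin[of "take i xs" "drop (Suc i) xs"] that by (simp add: upd_conv_take_nth_drop)
  ultimately show ?thesis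
    using deg by (simp add: alt_form_def)
qed

subsection \<open>The wedge product\<close>

text \<open>The recursion says that contraction with a vector is an antiderivation.\<close>

fun wsum :: "nat \<Rightarrow> form \<Rightarrow> form \<Rightarrow> form" where
  "wsum 0 \<alpha> \<beta> xs = \<alpha> [] * \<beta> xs"
| "wsum (Suc k) \<alpha> \<beta> [] = 0"
| "wsum (Suc k) \<alpha> \<beta> (x # xs) =
     wsum k (contract x \<alpha>) \<beta> xs - (-1) ^ k * wsum (Suc k) \<alpha> (contract x \<beta>) xs"

text \<open>Counts the inversions of a shuffle when one vector is put in front of the list. A
  selected position 0 has no unselected position below it and adds no inversion; all others are
  shifted by \<open>Suc\<close>.\<close>

lemma inversions_insert_0:
  assumes "S \<subseteq> {..<n}"
  shows "card {(i, j). i \<in> insert 0 (Suc ` S) \<and> j \<in> {..<Suc n} - insert 0 (Suc ` S) \<and> j < i}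
    = card {(i, j). i \<in> S \<and> j \<in> {..<n} - S \<and> j < i}" (is "card ?A = card ?B")
proof -
  have "?A = (\<lambda>(i, j). (Suc i, Suc j)) ` ?B"
  proof (intro equalityI subsetI)
    fix p assume "p \<in> ?A"
    then obtain i j where p: "p = (i, j)" and i: "i \<in> insert 0 (Suc ` S)"
      and j: "j < Suc n" "j \<notin> insert 0 (Suc ` S)" "j < i" by auto
    from j obtain j' where j': "j = Suc j'" by (cases j) auto
    with i j obtain i' where "i = Suc i'" "i' \<in> S" by auto
    with p j j' show "p \<in> (\<lambda>(i, j). (Suc i, Suc j)) ` ?B"
      by (intro image_eqI[of _ _ "(i', j')"]) auto
  qed auto
  then show ?thesis
    by (simp add: card_image inj_on_def split_def prod_eq_iff)
qed

text \<open>When position 0 is not selected, each of the \<open>card S\<close> selected positions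
  gains one inversion, namely with 0. This is the source of the sign in the antiderivation
  rule.\<close>

lemma inversions_Suc_image:
  assumes "S \<subseteq> {..<n}"
  shows "card {(i, j). i \<in> Suc ` S \<and> j \<in> {..<Suc n} - Suc ` S \<and> j < i}
    = card S + card {(i, j). i \<in> S \<and> j \<in> {..<n} - S \<and> j < i}" (is "card ?A = _ + card ?B")
proof -
  have fin: "finite S" using assms finite_subset by blast
  have finB: "finite ?B"
    by (rule finite_subset[of _ "S \<times> {..<n}"]) (use fin in auto)
  have "?A = (\<lambda>i. (Suc i, 0)) ` S \<union> (\<lambda>(i, j). (Suc i, Suc j)) ` ?B"
  proof (intro equalityI subsetI)
    fix p assume "p \<in> ?A"
    then obtain i j where p: "p = (Suc i, j)" and i: "i \<in> S"
      and j: "j < Suc n" "j \<notin> Suc ` S" "j < Suc i" by auto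
    show "p \<in> (\<lambda>i. (Suc i, 0)) ` S \<union> (\<lambda>(i, j). (Suc i, Suc j)) ` ?B"
      using p i j by (cases j) (auto simp: image_iff)
  qed auto
  moreover have "card ((\<lambda>i. (Suc i, 0::nat)) ` S) = card S"
    by (simp add: card_image inj_on_def)
  moreover have "card ((\<lambda>(i, j). (Suc i, Suc j)) ` ?B) = card ?B"
    by (simp add: card_image inj_on_def split_def prod_eq_iff)
  ultimately show ?thesis
    using fin finB by (simp add: card_Un_disjoint disjoint_iff image_iff split_def)
qed

text \<open>The shuffles are split by whether position 0 feeds \<open>\<alpha>\<close> or
  \<open>\<beta>\<close>. In the second case the extra sign \<open>(-1) ^ card S\<close> is the
  constant \<open>(-1) ^ k\<close>, because \<open>\<alpha>\<close> vanishes on sublists of any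
  other length.\<close>

lemma wedge_Cons:
  assumes deg: "\<And>xs. length xs \<noteq> k \<Longrightarrow> \<alpha> xs = 0"
  shows "wedge \<alpha> \<beta> (x # xs) = wedge (contract x \<alpha>) \<beta> xs + (-1) ^ k * wedge \<alpha> (contract x \<beta>) xs"
proof -
  let ?n = "length xs"
  let ?inv = "\<lambda>n S. card {(i, j). i \<in> S \<and> j \<in> {..<n} - S \<and> j < i}"
  let ?t = "\<lambda>n zs S. (-1) ^ ?inv n S * \<alpha> (nths zs S) * \<beta> (nths zs (- S))"
  have P: "Pow {..<Suc ?n} = insert 0 ` image Suc ` Pow {..<?n} \<union> image Suc ` Pow {..<?n}"
    unfolding lessThan_Suc_eq_insert_0 Pow_insert by (auto simp: image_Pow_surj Un_commute)
  have d: "insert 0 ` image Suc ` Pow {..<?n} \<inter> image Suc ` Pow {..<?n} = {}"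
    by auto
  have i1: "inj_on (\<lambda>S. insert 0 (Suc ` S)) (Pow {..<?n})"
    by (intro inj_onI) (auto simp: insert_ident inj_image_eq_iff)
  have i2: "inj_on (image Suc) (Pow {..<?n})"
    by (intro inj_onI) (simp add: inj_image_eq_iff)
  have n1: "nths (x # xs) (insert 0 (Suc ` S)) = x # nths xs S"
    "nths (x # xs) (- insert 0 (Suc ` S)) = nths xs (- S)"
    "nths (x # xs) (Suc ` S) = nths xs S"
    "nths (x # xs) (- (Suc ` S)) = x # nths xs (- S)" for S
    by (auto simp: nths_Cons image_iff intro!: arg_cong[of _ _ "nths xs"])
  have "wedge \<alpha> \<beta> (x # xs) = (\<Sum>S\<in>Pow {..<Suc ?n}. ?t (Suc ?n) (x # xs) S)"
    by (simp add: wedge_def)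
  also have "\<dots> = (\<Sum>S\<in>insert 0 ` image Suc ` Pow {..<?n}. ?t (Suc ?n) (x # xs) S)
      + (\<Sum>S\<in>image Suc ` Pow {..<?n}. ?t (Suc ?n) (x # xs) S)"
    unfolding P by (rule sum.union_disjoint[OF _ _ d]) auto
  also have "(\<Sum>S\<in>insert 0 ` image Suc ` Pow {..<?n}. ?t (Suc ?n) (x # xs) S)
      = (\<Sum>S\<in>Pow {..<?n}. ?t (Suc ?n) (x # xs) (insert 0 (Suc ` S)))"
    unfolding image_image by (subst sum.reindex[OF i1]) (simp add: o_def)
  also have "\<dots> = wedge (contract x \<alpha>) \<beta> xs"
    unfolding wedge_def contract_def
    by (intro sum.cong refl) (simp only: inversions_insert_0 PowD n1)
  also have "(\<Sum>S\<in>image Suc ` Pow {..<?n}. ?t (Suc ?n) (x # xs) S)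
      = (\<Sum>S\<in>Pow {..<?n}. ?t (Suc ?n) (x # xs) (Suc ` S))"
    by (subst sum.reindex[OF i2]) (simp add: o_def)
  also have "\<dots> = (-1) ^ k * wedge \<alpha> (contract x \<beta>) xs"
    unfolding wedge_def contract_def sum_distrib_left
  proof (intro sum.cong refl)
    fix S assume S: "S \<in> Pow {..<?n}"
    have "card {i. i < length xs \<and> i \<in> S} = card S"
      using S by (intro arg_cong[of _ _ card]) auto
    then have "length (nths xs S) = card S"
      by (simp add: length_nths)
    then have "card S = k \<or> \<alpha> (nths xs S) = 0"
      using deg by metis
    moreover have "?inv (Suc ?n) (Suc ` S) = card S + ?inv ?n S"
      using S by (intro inversions_Suc_image) simp
    ultimately show "?t (Suc ?n) (x # xs) (Suc ` S)
        = (-1) ^ k * ((-1) ^ ?inv ?n S * \<alpha> (nths xs S) * \<beta> (x # nths xs (- S)))"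
      unfolding n1 by (elim disjE) (simp_all only: power_add mult.assoc mult_zero_left mult_zero_right)
  qed
  finally show ?thesis .
qed

lemma wedge_Nil: "wedge \<alpha> \<beta> [] = \<alpha> [] * \<beta> []"
  by (simp add: wedge_def)

text \<open>Makes wedge products computable: on a list of known length the recursion unfolds into a
  finite sum of products of values, with no subsets left.\<close>

lemma wedge_eq_wsum:
  "(\<And>xs. length xs \<noteq> k \<Longrightarrow> \<alpha> xs = 0) \<Longrightarrow> wedge \<alpha> \<beta> xs = wsum k \<alpha> \<beta> xs"
proof (induction xs arbitrary: k \<alpha> \<beta>)
  case Nil
  then show ?case by (cases k) (simp_all add: wedge_Nil)
next
  case (Cons x xs)
  show ?case
  proof (cases k)
    case 0
    have "contract x \<alpha> = (\<lambda>xs. 0)"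
      using Cons.prems 0 by (auto simp: contract_def)
    then have "wedge (contract x \<alpha>) \<beta> xs = 0"
      by (simp add: wedge_def)
    then show ?thesis
      using Cons.IH[of 0 \<alpha> "contract x \<beta>"] Cons.prems 0 wedge_Cons[of 0 \<alpha> \<beta> x xs]
      by (simp add: contract_def)
  next
    case (Suc m)
    have "wedge (contract x \<alpha>) \<beta> xs = wsum m (contract x \<alpha>) \<beta> xs"
      by (rule Cons.IH) (use Cons.prems Suc in \<open>simp add: contract_def\<close>)
    moreover have "wedge \<alpha> (contract x \<beta>) xs = wsum (Suc m) \<alpha> (contract x \<beta>) xs"
      by (rule Cons.IH) (use Cons.prems Suc in simp)
    ultimately show ?thesis
      using wedge_Cons[of k \<alpha> \<beta> x xs] Cons.prems Suc by simp
  qed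
qed

lemma wedge_eq_wsum_alt: "alt_form k \<alpha> \<Longrightarrow> wedge \<alpha> \<beta> xs = wsum k \<alpha> \<beta> xs"
  by (rule wedge_eq_wsum) (rule alt_form_degree)

lemma wedge_zero: "wedge (\<lambda>xs. 0) \<beta> xs = 0" "wedge \<alpha> (\<lambda>xs. 0) xs = 0"
  by (simp_all add: wedge_def)

lemma wedge_add_left: "wedge (\<lambda>xs. \<alpha> xs + \<alpha>' xs) \<beta> xs = wedge \<alpha> \<beta> xs + wedge \<alpha>' \<beta> xs"
  by (simp add: wedge_def sum.distrib[symmetric] algebra_simps)

lemma wedge_add_right: "wedge \<alpha> (\<lambda>xs. \<beta> xs + \<beta>' xs) xs = wedge \<alpha> \<beta> xs + wedge \<alpha> \<beta>' xs"
  by (simp add: wedge_def sum.distrib[symmetric] algebra_simps)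

lemma wedge_scale_left: "wedge (\<lambda>xs. c * \<alpha> xs) \<beta> xs = c * wedge \<alpha> \<beta> xs"
  by (simp add: wedge_def sum_distrib_left mult_ac)

lemma wedge_scale_right: "wedge \<alpha> (\<lambda>xs. c * \<beta> xs) xs = c * wedge \<alpha> \<beta> xs"
  by (simp add: wedge_def sum_distrib_left mult_ac)

lemma wedge_sum_right: "wedge \<alpha> (\<lambda>xs. \<Sum>a\<in>A. \<beta> a xs) xs = (\<Sum>a\<in>A. wedge \<alpha> (\<beta> a) xs)"
  unfolding wedge_def sum_distrib_left by (rule sum.swap)

lemma contract_add: "alt_form k \<alpha> \<Longrightarrow> contract (x + y) \<alpha> = (\<lambda>xs. contract x \<alpha> xs + contract y \<alpha> xs)"
  by (rule ext) (simp add: contract_def linear_add[OF alt_form_linear_hd])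

lemma contract_scale: "alt_form k \<alpha> \<Longrightarrow> contract (c *\<^sub>R x) \<alpha> = (\<lambda>xs. c * contract x \<alpha> xs)"
  by (rule ext) (simp add: contract_def linear_cmul[OF alt_form_linear_hd])

lemma wedge_degree:
  assumes "alt_form k \<alpha>" "alt_form l \<beta>" "length xs \<noteq> k + l"
  shows "wedge \<alpha> \<beta> xs = 0"
proof -
  have "\<alpha> (nths xs S) * \<beta> (nths xs (- S)) = 0" for S
  proof (cases "length (nths xs S) = k")
    case True
    then have "length (nths xs (- S)) \<noteq> l"
      using length_nths_Compl[of xs S] assms(3) by linarith
    then show ?thesis
      using assms(2) by (simp add: alt_form_degree)
  qed (use assms(1) in \<open>simp add: alt_form_degree\<close>)
  then show ?thesis
    unfolding wedge_def mult.assoc by (intro sum.neutral ballI) simp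
qed

lemma alt_form_0_contract: "alt_form 0 \<alpha> \<Longrightarrow> contract x \<alpha> = (\<lambda>xs. 0)"
  by (auto simp: alt_form_def contract_def)

lemma alt_form_contract_twice: "alt_form k \<alpha> \<Longrightarrow> contract x (contract x \<alpha>) = (\<lambda>xs. 0)"
  by (auto simp: contract_def alt_form_not_distinct)

lemma wedge_Cons_alt:
  "alt_form k \<alpha> \<Longrightarrow>
    wedge \<alpha> \<beta> (x # xs) = wedge (contract x \<alpha>) \<beta> xs + (-1) ^ k * wedge \<alpha> (contract x \<beta>) xs"
  by (rule wedge_Cons) (rule alt_form_degree)

text \<open>Contracting with the vectors of \<open>us\<close> one after the other brings the slot to
  the front, where the antiderivation rule reduces linearity to that of the factors.\<close>

lemma wedge_linear_slot:
  assumes "alt_form k \<alpha>" "alt_form l \<beta>"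
  shows "linear (\<lambda>x. wedge \<alpha> \<beta> (us @ x # vs))"
  using assms
proof (induction us arbitrary: k l \<alpha> \<beta>)
  case Nil
  show ?case
    by (rule linearI)
      (simp_all add: wedge_Cons_alt[OF Nil(1)] contract_add[OF Nil(1)] contract_add[OF Nil(2)]
        contract_scale[OF Nil(1)] contract_scale[OF Nil(2)] wedge_add_left wedge_add_right
        wedge_scale_left wedge_scale_right algebra_simps)
next
  case (Cons u us)
  have 1: "linear (\<lambda>x. wedge (contract u \<alpha>) \<beta> (us @ x # vs))"
  proof (cases k)
    case 0
    then show ?thesis
      using Cons.prems by (simp add: alt_form_0_contract wedge_zero module_hom_zero)
  qed (use Cons.IH[of "k - 1" "contract u \<alpha>" l \<beta>] Cons.prems alt_form_contract in simp)
  have 2: "linear (\<lambda>x. wedge \<alpha> (contract u \<beta>) (us @ x # vs))"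
  proof (cases l)
    case 0
    then show ?thesis
      using Cons.prems by (simp add: alt_form_0_contract wedge_zero module_hom_zero)
  qed (use Cons.IH[of k \<alpha> "l - 1" "contract u \<beta>"] Cons.prems alt_form_contract in simp)
  show ?case
    unfolding append_Cons wedge_Cons_alt[OF Cons.prems(1)]
    using linear_compose_add[OF 1 linear_compose_scale_right[OF 2, of "(-1) ^ k"]] by simp
qed

text \<open>Once the repeated vector is in front, contracting twice leaves the wedge of
  \<open>contract x \<alpha>\<close> and \<open>contract x \<beta>\<close> with the signs
  \<open>(-1) ^ k\<close> and \<open>(-1) ^ (k - 1)\<close>, which cancel.\<close>

lemma wedge_adjacent:
  assumes "alt_form k \<alpha>" "alt_form l \<beta>"
  shows "wedge \<alpha> \<beta> (us @ x # x # vs) = 0"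
  using assms
proof (induction us arbitrary: k l \<alpha> \<beta>)
  case Nil
  show ?case
  proof (cases k)
    case 0
    then show ?thesis
      using Nil by (simp add: wedge_Cons_alt[OF Nil(1)] alt_form_0_contract
        alt_form_contract_twice wedge_zero)
  next
    case (Suc k')
    then have "alt_form k' (contract x \<alpha>)"
      using Nil alt_form_contract by blast
    then show ?thesis
      using Suc by (simp add: wedge_Cons_alt[OF Nil(1)] wedge_Cons_alt[of k']
        alt_form_contract_twice[OF Nil(1)] alt_form_contract_twice[OF Nil(2)] wedge_zero)
  qed
next
  case (Cons u us)
  have 1: "wedge (contract u \<alpha>) \<beta> (us @ x # x # vs) = 0"
  proof (cases k)
    case 0
    then show ?thesis
      using Cons.prems by (simp add: alt_form_0_contract wedge_zero)
  qed (use Cons.IH[of "k - 1" "contract u \<alpha>" l \<beta>] Cons.prems alt_form_contract in simp)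
  have 2: "wedge \<alpha> (contract u \<beta>) (us @ x # x # vs) = 0"
  proof (cases l)
    case 0
    then show ?thesis
      using Cons.prems by (simp add: alt_form_0_contract wedge_zero)
  qed (use Cons.IH[of k \<alpha> "l - 1" "contract u \<beta>"] Cons.prems alt_form_contract in simp)
  show ?case
    unfolding append_Cons wedge_Cons_alt[OF Cons.prems(1)] by (simp add: 1 2)
qed

lemma alt_form_wedge:
  assumes "alt_form k \<alpha>" "alt_form l \<beta>"
  shows "alt_form (k + l) (wedge \<alpha> \<beta>)"
  by (intro alt_formI wedge_degree[OF assms] wedge_linear_slot[OF assms] wedge_adjacent[OF assms])

subsection \<open>Top-degree forms and determinants\<close>

text \<open>The order of the basis used by \<open>g2_coeff\<close> and \<open>g2_volume\<close>. It
  converts a family indexed by the type \<open>7\<close> into a list to which a 7-form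
  applies.\<close>

definition idx7 :: "7 list" where
  "idx7 = [1, 2, 3, 4, 5, 6, 7]"

lemma set_idx7: "set idx7 = UNIV"
  unfolding idx7_def UNIV_7 seven_eq_0 by auto

lemma distinct_idx7: "distinct idx7"
  by (simp add: idx7_def)

lemma length_idx7: "length idx7 = 7"
  by (simp add: idx7_def)

lemma idx7_decomp:
  obtains us vs where "idx7 = us @ m # vs" "m \<notin> set us" "m \<notin> set vs"
proof -
  have "m \<in> set idx7"
    unfolding set_idx7 by simp
  then obtain us vs where d: "idx7 = us @ m # vs"
    using split_list by metis
  then have "distinct (us @ m # vs)"
    using distinct_idx7 by simp
  then have "m \<notin> set us" "m \<notin> set vs"
    by auto
  with d show ?thesis
    by (rule that)
qed

lemma linear_expand:
  fixes f :: "real^'n \<Rightarrow> real"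
  assumes "linear f"
  shows "f x = (\<Sum>i\<in>UNIV. x $ i * f (axis i 1))"
proof -
  have "f x = f (\<Sum>i\<in>UNIV. (x $ i) *\<^sub>R axis i 1)"
    using basis_expansion[of x] by (simp add: scalar_mult_eq_scaleR)
  also have "\<dots> = (\<Sum>i\<in>UNIV. x $ i * f (axis i 1))"
    by (simp add: linear_sum[OF assms] linear_cmul[OF assms])
  finally show ?thesis .
qed

lemma alt_top_linear_update:
  assumes W: "alt_form 7 W"
  shows "linear (\<lambda>y. W (map (f(m := y)) idx7))"
proof -
  obtain us vs where d: "idx7 = us @ m # vs" "m \<notin> set us" "m \<notin> set vs"
    by (rule idx7_decomp)
  have m: "map (f(m := y)) us = map f us" "map (f(m := y)) vs = map f vs" for y
    using d by (auto intro!: map_cong)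
  have "length (us @ m # vs) = 7"
    unfolding d(1)[symmetric] by (rule length_idx7)
  then show ?thesis
    unfolding d(1) map_append list.map m fun_upd_same
    by (intro alt_form_linear_append[OF W]) simp
qed

lemma alt_top_eq:
  assumes W: "alt_form 7 W" and "m \<noteq> n" "f m = f n"
  shows "W (map f idx7) = 0"
proof (rule alt_form_not_distinct[OF W], rule notI)
  assume "distinct (map f idx7)"
  then have "inj_on f UNIV"
    unfolding distinct_map set_idx7 by blast
  with assms show False
    by (auto dest: injD)
qed

lemma alt_top_swap:
  assumes W: "alt_form 7 W" and mn: "m \<noteq> n"
  shows "W (map (f(m := f n, n := f m)) idx7) = - W (map f idx7)"
proof -
  let ?g = "\<lambda>u v. W (map (f(m := u, n := v)) idx7)"
  have l1: "linear (\<lambda>u. ?g u v)" for v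
    using alt_top_linear_update[OF W, of "f(n := v)" m] mn by (simp add: fun_upd_twist)
  have l2: "linear (?g u)" for u
    using alt_top_linear_update[OF W, of "f(m := u)" n] by simp
  have z: "?g u u = 0" for u
    by (rule alt_top_eq[OF W mn]) (use mn in simp)
  let ?s = "f m + f n"
  have "?g ?s ?s = ?g (f m) ?s + ?g (f n) ?s"
    by (rule linear_add[OF l1])
  moreover have "?g (f m) ?s = ?g (f m) (f m) + ?g (f m) (f n)"
    "?g (f n) ?s = ?g (f n) (f m) + ?g (f n) (f n)"
    by (rule linear_add[OF l2])+
  moreover have "?g (f m) (f n) = W (map f idx7)"
    by simp
  ultimately show ?thesis
    using z[of ?s] z[of "f m"] z[of "f n"] by linarith
qed

lemma alt_top_row_add:
  assumes W: "alt_form 7 W" and mn: "m \<noteq> n"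
  shows "W (map (f(m := f m + c *\<^sub>R f n)) idx7) = W (map f idx7)"
proof -
  note l = alt_top_linear_update[OF W, of f m]
  have "W (map (f(m := f n)) idx7) = 0"
    by (rule alt_top_eq[OF W mn]) (use mn in simp)
  then show ?thesis
    unfolding linear_add[OF l] linear_cmul[OF l] by simp
qed

lemma alt_top_diagonal:
  assumes W: "alt_form 7 W"
  shows "W (map (\<lambda>i. c i *\<^sub>R f i) idx7) = (\<Prod>i\<in>UNIV. c i) * W (map f idx7)"
proof -
  have "W (map (\<lambda>i. if i \<in> S then c i *\<^sub>R f i else f i) idx7) = (\<Prod>i\<in>S. c i) * W (map f idx7)"
    if "finite S" for S
    using that
  proof (induction S rule: finite_induct)
    case (insert m S)
    let ?h = "\<lambda>i. if i \<in> S then c i *\<^sub>R f i else f i"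
    have "W (map (\<lambda>i. if i \<in> insert m S then c i *\<^sub>R f i else f i) idx7)
        = W (map (?h(m := c m *\<^sub>R f m)) idx7)"
      by (intro arg_cong[of _ _ W] map_cong refl) auto
    also have "\<dots> = c m * W (map (?h(m := f m)) idx7)"
      using linear_cmul[OF alt_top_linear_update[OF W, of ?h m], of "c m" "f m"]
      unfolding real_scaleR_def .
    also have "?h(m := f m) = ?h"
      using insert by auto
    also have "W (map ?h idx7) = (\<Prod>i\<in>S. c i) * W (map f idx7)"
      by (rule insert.IH)
    finally show ?case
      unfolding prod.insert[OF insert.hyps] mult.assoc .
  qed simp
  from this[of UNIV] show ?thesis
    by simp
qed

lemma matrix_row_eq: "(A ** B) $ i = (\<Sum>k\<in>UNIV. A $ i $ k *\<^sub>R B $ k)"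
  for A B :: "real^'n^'n"
  by (simp add: vec_eq_iff matrix_matrix_mult_def)

text \<open>Left multiplication by an elementary matrix is a row operation, and the preceding lemmas
  give its effect on a top-degree form. The statement is about \<open>A ** B\<close> for all
  \<open>B\<close>, so that the induction passes through products.\<close>

lemma alt_top_det_mult:
  assumes W: "alt_form 7 W"
  shows "W (map (($) (A ** B)) idx7) = det A * W (map (($) B) idx7)"
proof -
  have "\<forall>B. W (map (($) (A ** B)) idx7) = det A * W (map (($) B) idx7)"
  proof (induction A rule: induct_matrix_elementary)
    case (1 A A')
    then show ?case
      by (simp add: matrix_mul_assoc[symmetric] det_mul mult_ac)
  next
    case (2 A i)
    show ?case
    proof
      fix B :: "real^7^7"
      have "A $ i $ k = 0" for k
        using 2 by (simp add: row_def vec_eq_iff)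
      then have "(A ** B) $ i = 0"
        by (simp add: matrix_row_eq)
      then have "W (map (($) (A ** B)) idx7) = W (map ((\<lambda>j. (A ** B) $ j)(i := 0)) idx7)"
        by (intro arg_cong[of _ _ W] map_cong refl) simp
      also have "\<dots> = 0"
        by (rule linear_0[OF alt_top_linear_update[OF W]])
      finally show "W (map (($) (A ** B)) idx7) = det A * W (map (($) B) idx7)"
        using det_zero_row(1)[OF 2] by simp
    qed
  next
    case (3 A)
    have "(A ** B) $ i = A $ i $ i *\<^sub>R B $ i" for B :: "real^7^7" and i
    proof -
      have "A $ i $ k *\<^sub>R B $ k = (if k = i then A $ k $ k *\<^sub>R B $ k else 0)" for k
        using 3[of i k] by auto
      then have "(A ** B) $ i = (\<Sum>k\<in>UNIV. if k = i then A $ k $ k *\<^sub>R B $ k else 0)"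
        unfolding matrix_row_eq by (rule sum.cong[OF refl])
      then show ?thesis
        by simp
    qed
    then have "W (map (($) (A ** B)) idx7) = W (map (\<lambda>i. A $ i $ i *\<^sub>R B $ i) idx7)" for B
      by (simp cong: map_cong)
    then show ?case
      using 3 by (simp add: det_diagonal alt_top_diagonal[OF W])
  next
    case (4 m n)
    let ?S = "\<chi> i j. (mat 1 :: real^7^7) $ i $ Transposition.transpose m n j"
    have d: "det ?S = -1"
      using 4 by (subst det_permute_columns) (simp_all add: permutes_swap_id sign_swap_id)
    have "(?S ** B) $ i = B $ Transposition.transpose m n i" for B :: "real^7^7" and i
    proof -
      have "?S $ i $ k *\<^sub>R B $ k = (if k = Transposition.transpose m n i then B $ k else 0)" for k
        by (cases "k = Transposition.transpose m n i") (auto simp: mat_def)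
      then show ?thesis
        by (simp add: matrix_row_eq)
    qed
    then have "(($) (?S ** B)) = (($) B)(m := B $ n, n := B $ m)" for B :: "real^7^7"
      by (intro ext) (simp add: Transposition.transpose_def)
    then show ?case
      unfolding d by (simp only: alt_top_swap[OF W 4] mult_minus1 simp_thms)
  next
    case (5 m n c)
    let ?S = "(\<chi> i j. if i = m \<and> j = n then c else of_bool (i = j)) :: real^7^7"
    have "?S = (\<chi> k. if k = m then row m (mat 1) + c *s row n (mat 1) else row k (mat 1))"
      using 5 by (auto simp: vec_eq_iff row_def mat_def)
    then have d: "det ?S = 1"
      using det_row_operation[OF 5, of "mat 1" c] by simp
    have "(?S ** B) $ i = (if i = m then B $ m + c *\<^sub>R B $ n else B $ i)" for B :: "real^7^7" and i
    proof -
      have "?S $ i $ k *\<^sub>R B $ k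
          = (if k = i then B $ k else 0) + (if k = n then (if i = m then c *\<^sub>R B $ n else 0) else
              0)" for k
        using 5 by (cases "k = i"; cases "k = n") auto
      then show ?thesis
        by (simp add: matrix_row_eq sum.distrib)
    qed
    then have "(($) (?S ** B)) = (($) B)(m := B $ m + c *\<^sub>R B $ n)" for B :: "real^7^7"
      by (intro ext) simp
    then show ?case
      unfolding d by (simp only: alt_top_row_add[OF W 5] mult_1_left simp_thms)
  qed
  then show ?thesis by blast
qed

lemma alt_top_det:
  assumes W: "alt_form 7 W"
  shows "W (map (($) A) idx7) = det A * W (map E idx7)"
proof -
  have "map (($) (mat 1)) idx7 = map E idx7"
    by (intro map_cong refl) (simp add: mat_def axis_def vec_eq_iff)
  then show ?thesis
    using alt_top_det_mult[OF W, of A "mat 1"] by (simp only: matrix_mul_rid)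
qed

subsection \<open>The Hodge operator in an orthonormal frame\<close>

lemma alt_form_move_front:
  assumes a: "alt_form k \<alpha>"
  shows "\<alpha> (us @ x # vs) = (-1) ^ length us * \<alpha> (x # us @ vs)"
proof (induction us arbitrary: vs rule: rev_induct)
  case (snoc u us)
  have "\<alpha> ((us @ [u]) @ x # vs) = - \<alpha> (us @ x # u # vs)"
    using alt_form_swap[OF a, of us u "[]" x vs] by simp
  then show ?case
    using snoc by simp
qed simp

lemma alt_form_8_basis:
  assumes W: "alt_form 8 W"
  shows "W (x # map E idx7) = 0"
proof -
  have "W (E i # map E idx7) = 0" for i
    by (rule alt_form_not_distinct[OF W]) (simp add: set_idx7)
  then show ?thesis
    by (subst linear_expand[OF alt_form_linear_hd[OF W]]) simp
qed

text \<open>The source of the property that the wedge of a form with a Hodge star is the inner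
  product times the volume. In the induction, \<open>\<beta>\<close> has one degree more than
  \<open>us\<close>, so its wedge with the contracted \<open>V\<close> is an 8-form and vanishes;
  contracting that 8-form with \<open>x\<close> moves \<open>x\<close> from \<open>\<beta>\<close>
  over to \<open>V\<close>.\<close>

lemma wedge_contract_top:
  assumes V: "alt_form 7 V"
  shows "alt_form (length us) \<beta> \<Longrightarrow> length us \<le> 7 \<Longrightarrow>
    wedge \<beta> (\<lambda>ys. V (us @ ys)) (map E idx7) = \<beta> us * V (map E idx7)"
proof (induction us arbitrary: \<beta> rule: rev_induct)
  case Nil
  then show ?case
    by (simp add: wedge_eq_wsum_alt)
next
  case (snoc x us)
  let ?k = "length us"
  have b: "alt_form (Suc ?k) \<beta>"
    using snoc.prems by simp
  have V': "alt_form (7 - ?k) (\<lambda>ys. V (us @ ys))"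
    by (rule alt_form_contract_list) (use V snoc.prems in simp)
  have "alt_form 8 (wedge \<beta> (\<lambda>ys. V (us @ ys)))"
    using alt_form_wedge[OF b V'] snoc.prems by simp
  then have "wedge \<beta> (\<lambda>ys. V (us @ ys)) (x # map E idx7) = 0"
    by (rule alt_form_8_basis)
  then have "wedge (contract x \<beta>) (\<lambda>ys. V (us @ ys)) (map E idx7)
      = (-1) ^ ?k * wedge \<beta> (contract x (\<lambda>ys. V (us @ ys))) (map E idx7)"
    by (simp add: wedge_Cons_alt[OF b])
  moreover have "wedge (contract x \<beta>) (\<lambda>ys. V (us @ ys)) (map E idx7)
      = contract x \<beta> us * V (map E idx7)"
    by (rule snoc.IH) (use alt_form_contract[OF b] snoc.prems in simp_all)
  moreover have "\<beta> (us @ [x]) = (-1) ^ ?k * \<beta> (x # us)"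
    using alt_form_move_front[OF b, of us x "[]"] by simp
  ultimately have "(-1) ^ ?k * (\<beta> (us @ [x]) * V (map E idx7))
      = (-1) ^ ?k * wedge \<beta> (contract x (\<lambda>ys. V (us @ ys))) (map E idx7)"
    by (cases "even ?k") (simp_all add: contract_def)
  then show ?case
    by (simp add: contract_def)
qed

lemma sum_length_Suc:
  fixes h :: "'a::finite list \<Rightarrow> 'b::comm_monoid_add"
  shows "(\<Sum>I\<in>{I. length I = Suc k}. h I) = (\<Sum>i\<in>UNIV. \<Sum>I\<in>{I. length I = k}. h (i # I))"
proof -
  have "{I :: 'a list. length I = Suc k} = (\<lambda>(i, I). i # I) ` (UNIV \<times> {I. length I = k})"
    by (auto simp: length_Suc_conv)
  moreover have "inj_on (\<lambda>(i, I). i # I) (UNIV \<times> {I :: 'a list. length I = k})"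
    by (auto simp: inj_on_def)
  ultimately show ?thesis
    by (simp add: sum.reindex sum.cartesian_product split_def)
qed

lemma sum_length_0: "(\<Sum>I\<in>{I. length I = 0}. h I) = h []"
  by simp

lemma sum_swap4:
  "(\<Sum>i\<in>I. \<Sum>j\<in>J. \<Sum>a\<in>K. \<Sum>b\<in>L. t i j a b) = (\<Sum>a\<in>K. \<Sum>b\<in>L. \<Sum>i\<in>I. \<Sum>j\<in>J. t i j a b)"
proof -
  have "(\<Sum>i\<in>I. \<Sum>j\<in>J. \<Sum>a\<in>K. \<Sum>b\<in>L. t i j a b) = (\<Sum>i\<in>I. \<Sum>a\<in>K. \<Sum>j\<in>J. \<Sum>b\<in>L. t i j a b)"
    by (rule sum.cong[OF refl], rule sum.swap)
  also have "\<dots> = (\<Sum>a\<in>K. \<Sum>i\<in>I. \<Sum>j\<in>J. \<Sum>b\<in>L. t i j a b)"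
    by (rule sum.swap)
  also have "\<dots> = (\<Sum>a\<in>K. \<Sum>i\<in>I. \<Sum>b\<in>L. \<Sum>j\<in>J. t i j a b)"
    by (rule sum.cong[OF refl], rule sum.cong[OF refl], rule sum.swap)
  also have "\<dots> = (\<Sum>a\<in>K. \<Sum>b\<in>L. \<Sum>i\<in>I. \<Sum>j\<in>J. t i j a b)"
    by (rule sum.cong[OF refl], rule sum.swap)
  finally show ?thesis .
qed

text \<open>If \<open>G\<close> is the inverse metric and the \<open>p a\<close> are orthonormal,
  then \<open>G\<close> is the sum of their squares as below. The double sum over indices raised by
  \<open>G\<close> then collapses to a single sum over the frame; the induction does this for one
  index at a time.\<close>

lemma sum_inverse_metric:
  fixes p :: "7 \<Rightarrow> real^7"
  assumes G: "\<And>i j. G $ i $ j = (\<Sum>a\<in>UNIV. p a $ i * p a $ j)"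
    and "alt_form k \<gamma>" "alt_form (k + l) V"
  shows "(\<Sum>I\<in>{I. length I = k}. \<Sum>J\<in>{J. length J = k}.
      (\<Prod>r<k. G $ (I ! r) $ (J ! r)) * \<gamma> (map E I) * V (map E J @ ys))
    = (\<Sum>A\<in>{A. length A = k}. \<gamma> (map p A) * V (map p A @ ys))"
  using assms(2,3)
proof (induction k arbitrary: \<gamma> V)
  case 0
  show ?case by simp
next
  case (Suc k)
  have IH: "(\<Sum>I\<in>{I. length I = k}. \<Sum>J\<in>{J. length J = k}.
      (\<Prod>r<k. G $ (I ! r) $ (J ! r)) * \<gamma> (E i # map E I) * V (E j # map E J @ ys))
    = (\<Sum>A\<in>{A. length A = k}. \<gamma> (E i # map p A) * V (E j # map p A @ ys))" for i j
    using Suc.IH[of "contract (E i) \<gamma>" "contract (E j) V"] Suc.prems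
    by (simp add: contract_def alt_form_contract[unfolded contract_def])
  have p: "\<gamma> (p a # us) = (\<Sum>i\<in>UNIV. p a $ i * \<gamma> (E i # us))"
    "V (p a # us) = (\<Sum>i\<in>UNIV. p a $ i * V (E i # us))" for a us
    by (rule linear_expand[OF alt_form_linear_hd]; fact Suc.prems)+
  have "(\<Sum>I\<in>{I. length I = Suc k}. \<Sum>J\<in>{J. length J = Suc k}.
      (\<Prod>r<Suc k. G $ (I ! r) $ (J ! r)) * \<gamma> (map E I) * V (map E J @ ys))
    = (\<Sum>i\<in>UNIV. \<Sum>I\<in>{I. length I = k}. \<Sum>j\<in>UNIV. \<Sum>J\<in>{J. length J = k}.
        G $ i $ j * ((\<Prod>r<k. G $ (I ! r) $ (J ! r)) * \<gamma> (E i # map E I) * V (E j # map E J @ ys)))"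
    unfolding sum_length_Suc prod.lessThan_Suc_shift by (simp add: mult.assoc)
  also have "\<dots> = (\<Sum>i\<in>UNIV. \<Sum>j\<in>UNIV. \<Sum>I\<in>{I. length I = k}. \<Sum>J\<in>{J. length J = k}.
        G $ i $ j * ((\<Prod>r<k. G $ (I ! r) $ (J ! r)) * \<gamma> (E i # map E I) * V (E j # map E J @ ys)))"
    by (rule sum.cong[OF refl], rule sum.swap)
  also have "\<dots> = (\<Sum>i\<in>UNIV. \<Sum>j\<in>UNIV. G $ i $ j *
      (\<Sum>A\<in>{A. length A = k}. \<gamma> (E i # map p A) * V (E j # map p A @ ys)))"
    by (simp add: sum_distrib_left[symmetric] IH)
  also have "\<dots> = (\<Sum>i\<in>UNIV. \<Sum>j\<in>UNIV. \<Sum>a\<in>UNIV. \<Sum>A\<in>{A. length A = k}.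
      (p a $ i * \<gamma> (E i # map p A)) * (p a $ j * V (E j # map p A @ ys)))"
  proof (intro sum.cong refl)
    fix i j
    show "G $ i $ j * (\<Sum>A\<in>{A. length A = k}. \<gamma> (E i # map p A) * V (E j # map p A @ ys))
        = (\<Sum>a\<in>UNIV. \<Sum>A\<in>{A. length A = k}.
            (p a $ i * \<gamma> (E i # map p A)) * (p a $ j * V (E j # map p A @ ys)))"
      unfolding G sum_product by (simp add: mult_ac)
  qed
  also have "\<dots> = (\<Sum>a\<in>UNIV. \<Sum>A\<in>{A. length A = k}. \<Sum>i\<in>UNIV. \<Sum>j\<in>UNIV.
      (p a $ i * \<gamma> (E i # map p A)) * (p a $ j * V (E j # map p A @ ys)))"
    by (rule sum_swap4)
  also have "\<dots> = (\<Sum>a\<in>UNIV. \<Sum>A\<in>{A. length A = k}. \<gamma> (p a # map p A) * V (p a # map p A @ ys))"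
    unfolding p sum_product ..
  also have "\<dots> = (\<Sum>A\<in>{A. length A = Suc k}. \<gamma> (map p A) * V (map p A @ ys))"
    by (simp add: sum_length_Suc)
  finally show ?case .
qed

subsection \<open>The bilinear form of a 3-form\<close>

lemma sum_7: "(\<Sum>a\<in>(UNIV :: 7 set). h a) = h 1 + h 2 + h 3 + h 4 + h 5 + h 6 + h 7"
  for h :: "7 \<Rightarrow> 'a::comm_monoid_add"
proof -
  have "(\<Sum>a\<in>set idx7. h a) = sum_list (map h idx7)"
    using distinct_idx7 by (rule sum.distinct_set_conv_list)
  then show ?thesis
    unfolding set_idx7 by (simp only: idx7_def list.map sum_list.Cons sum_list.Nil add.assoc add_0_right)
qed

lemma all_7: "(\<forall>i::7. P i) \<longleftrightarrow> P 1 \<and> P 2 \<and> P 3 \<and> P 4 \<and> P 5 \<and> P 6 \<and> P 7"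
proof -
  have "(\<forall>i::7. P i) \<longleftrightarrow> (\<forall>i\<in>set idx7. P i)"
    by (simp add: set_idx7)
  then show ?thesis
    unfolding idx7_def by (simp only: list.set ball_simps simp_thms)
qed

lemma map_idx7: "map f idx7 = [f 1, f 2, f 3, f 4, f 5, f 6, f 7]"
  by (simp add: idx7_def)

text \<open>This is 6 b(v,w) as a 7-form. Kept as a bare wedge product, it commutes with pullbacks
  and with changes of basis of top-degree forms.\<close>

definition cubic_form :: "form \<Rightarrow> real^7 \<Rightarrow> real^7 \<Rightarrow> form" where
  "cubic_form \<phi> v w = wedge (wedge (contract v \<phi>) (contract w \<phi>)) \<phi>"

lemma alt_form_cubic_form: "alt_form 3 \<phi> \<Longrightarrow> alt_form 7 (cubic_form \<phi> v w)"
  using alt_form_wedge[OF alt_form_wedge[OF alt_form_contract alt_form_contract], of 2 \<phi> 2 \<phi> 3 \<phi> v w]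
  by (simp add: cubic_form_def eval_nat_numeral)

lemma g2_coeff_eq: "g2_coeff \<phi> v w = cubic_form \<phi> v w (map E idx7) / 6"
  by (simp add: g2_coeff_def g2_bilinear_def cubic_form_def map_idx7 del: list.map)

text \<open>The recursion in the occurring degrees with its signs already evaluated, so that
  rewriting alone yields the explicit shuffle formulas.\<close>

lemma wsum_numeral:
  "wsum 2 = wsum (Suc (Suc 0))" "wsum 3 = wsum (Suc (Suc (Suc 0)))"
  "wsum 4 = wsum (Suc (Suc (Suc (Suc 0))))"
  "wsum (Suc k) \<alpha> \<beta> [] = 0"
  "wsum (Suc 0) \<alpha> \<beta> (x # xs) = \<alpha> [x] * \<beta> xs - wsum (Suc 0) \<alpha> (contract x \<beta>) xs"
  "wsum (Suc (Suc 0)) \<alpha> \<beta> (x # xs)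
    = wsum (Suc 0) (contract x \<alpha>) \<beta> xs + wsum (Suc (Suc 0)) \<alpha> (contract x \<beta>) xs"
  "wsum (Suc (Suc (Suc 0))) \<alpha> \<beta> (x # xs)
    = wsum (Suc (Suc 0)) (contract x \<alpha>) \<beta> xs - wsum (Suc (Suc (Suc 0))) \<alpha> (contract x \<beta>) xs"
  "wsum (Suc (Suc (Suc (Suc 0)))) \<alpha> \<beta> (x # xs)
    = wsum (Suc (Suc (Suc 0))) (contract x \<alpha>) \<beta> xs
      + wsum (Suc (Suc (Suc (Suc 0)))) \<alpha> (contract x \<beta>) xs"
  by (simp_all add: contract_def numeral_2_eq_2 numeral_3_eq_3 eval_nat_numeral)

lemma wedge_2_2:
  assumes "alt_form 2 \<alpha>"
  shows "wedge \<alpha> \<beta> [x1, x2, x3, x4] =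
    \<alpha> [x1, x2] * \<beta> [x3, x4] - \<alpha> [x1, x3] * \<beta> [x2, x4] + \<alpha> [x1, x4] * \<beta> [x2, x3]
    + \<alpha> [x2, x3] * \<beta> [x1, x4] - \<alpha> [x2, x4] * \<beta> [x1, x3] + \<alpha> [x3, x4] * \<beta> [x1, x2]"
  by (simp only: wedge_eq_wsum_alt[OF assms] wsum_numeral contract_def algebra_simps
      diff_0_right add_0_right)

lemma wedge_4_3:
  assumes "alt_form 4 \<alpha>"
  shows "wedge \<alpha> \<beta> [x1, x2, x3, x4, x5, x6, x7] =
    \<alpha> [x1, x2, x3, x4] * \<beta> [x5, x6, x7] - \<alpha> [x1, x2, x3, x5] * \<beta> [x4, x6, x7] + \<alpha> [x1, x2, x3, x6] *
        \<beta> [x4, x5, x7]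
    - \<alpha> [x1, x2, x3, x7] * \<beta> [x4, x5, x6] + \<alpha> [x1, x2, x4, x5] * \<beta> [x3, x6, x7] - \<alpha> [x1, x2, x4, x6]
        * \<beta> [x3, x5, x7]
    + \<alpha> [x1, x2, x4, x7] * \<beta> [x3, x5, x6] + \<alpha> [x1, x2, x5, x6] * \<beta> [x3, x4, x7] - \<alpha> [x1, x2, x5, x7]
        * \<beta> [x3, x4, x6]
    + \<alpha> [x1, x2, x6, x7] * \<beta> [x3, x4, x5] - \<alpha> [x1, x3, x4, x5] * \<beta> [x2, x6, x7] + \<alpha> [x1, x3, x4, x6]
        * \<beta> [x2, x5, x7]
    - \<alpha> [x1, x3, x4, x7] * \<beta> [x2, x5, x6] - \<alpha> [x1, x3, x5, x6] * \<beta> [x2, x4, x7] + \<alpha> [x1, x3, x5, x7]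
        * \<beta> [x2, x4, x6]
    - \<alpha> [x1, x3, x6, x7] * \<beta> [x2, x4, x5] + \<alpha> [x1, x4, x5, x6] * \<beta> [x2, x3, x7] - \<alpha> [x1, x4, x5, x7]
        * \<beta> [x2, x3, x6]
    + \<alpha> [x1, x4, x6, x7] * \<beta> [x2, x3, x5] - \<alpha> [x1, x5, x6, x7] * \<beta> [x2, x3, x4] + \<alpha> [x2, x3, x4, x5]
        * \<beta> [x1, x6, x7]
    - \<alpha> [x2, x3, x4, x6] * \<beta> [x1, x5, x7] + \<alpha> [x2, x3, x4, x7] * \<beta> [x1, x5, x6] + \<alpha> [x2, x3, x5, x6]
        * \<beta> [x1, x4, x7]
    - \<alpha> [x2, x3, x5, x7] * \<beta> [x1, x4, x6] + \<alpha> [x2, x3, x6, x7] * \<beta> [x1, x4, x5] - \<alpha> [x2, x4, x5, x6]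
        * \<beta> [x1, x3, x7]
    + \<alpha> [x2, x4, x5, x7] * \<beta> [x1, x3, x6] - \<alpha> [x2, x4, x6, x7] * \<beta> [x1, x3, x5] + \<alpha> [x2, x5, x6, x7]
        * \<beta> [x1, x3, x4]
    + \<alpha> [x3, x4, x5, x6] * \<beta> [x1, x2, x7] - \<alpha> [x3, x4, x5, x7] * \<beta> [x1, x2, x6] + \<alpha> [x3, x4, x6, x7]
        * \<beta> [x1, x2, x5]
    - \<alpha> [x3, x5, x6, x7] * \<beta> [x1, x2, x4] + \<alpha> [x4, x5, x6, x7] * \<beta> [x1, x2, x3]"
  by (simp only: wedge_eq_wsum_alt[OF assms] wsum_numeral contract_def algebra_simps
      diff_0_right add_0_right)

lemma wedge_3_4:
  assumes "alt_form 3 \<alpha>"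
  shows "wedge \<alpha> \<beta> [x1, x2, x3, x4, x5, x6, x7] =
    \<alpha> [x1, x2, x3] * \<beta> [x4, x5, x6, x7] - \<alpha> [x1, x2, x4] * \<beta> [x3, x5, x6, x7] + \<alpha> [x1, x2, x5] * \<beta>
        [x3, x4, x6, x7]
    - \<alpha> [x1, x2, x6] * \<beta> [x3, x4, x5, x7] + \<alpha> [x1, x2, x7] * \<beta> [x3, x4, x5, x6] + \<alpha> [x1, x3, x4] * \<beta>
        [x2, x5, x6, x7]
    - \<alpha> [x1, x3, x5] * \<beta> [x2, x4, x6, x7] + \<alpha> [x1, x3, x6] * \<beta> [x2, x4, x5, x7] - \<alpha> [x1, x3, x7] * \<beta>
        [x2, x4, x5, x6]
    + \<alpha> [x1, x4, x5] * \<beta> [x2, x3, x6, x7] - \<alpha> [x1, x4, x6] * \<beta> [x2, x3, x5, x7] + \<alpha> [x1, x4, x7] * \<beta>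
        [x2, x3, x5, x6]
    + \<alpha> [x1, x5, x6] * \<beta> [x2, x3, x4, x7] - \<alpha> [x1, x5, x7] * \<beta> [x2, x3, x4, x6] + \<alpha> [x1, x6, x7] * \<beta>
        [x2, x3, x4, x5]
    - \<alpha> [x2, x3, x4] * \<beta> [x1, x5, x6, x7] + \<alpha> [x2, x3, x5] * \<beta> [x1, x4, x6, x7] - \<alpha> [x2, x3, x6] * \<beta>
        [x1, x4, x5, x7]
    + \<alpha> [x2, x3, x7] * \<beta> [x1, x4, x5, x6] - \<alpha> [x2, x4, x5] * \<beta> [x1, x3, x6, x7] + \<alpha> [x2, x4, x6] * \<beta>
        [x1, x3, x5, x7]
    - \<alpha> [x2, x4, x7] * \<beta> [x1, x3, x5, x6] - \<alpha> [x2, x5, x6] * \<beta> [x1, x3, x4, x7] + \<alpha> [x2, x5, x7] * \<beta>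
        [x1, x3, x4, x6]
    - \<alpha> [x2, x6, x7] * \<beta> [x1, x3, x4, x5] + \<alpha> [x3, x4, x5] * \<beta> [x1, x2, x6, x7] - \<alpha> [x3, x4, x6] * \<beta>
        [x1, x2, x5, x7]
    + \<alpha> [x3, x4, x7] * \<beta> [x1, x2, x5, x6] + \<alpha> [x3, x5, x6] * \<beta> [x1, x2, x4, x7] - \<alpha> [x3, x5, x7] * \<beta>
        [x1, x2, x4, x6]
    + \<alpha> [x3, x6, x7] * \<beta> [x1, x2, x4, x5] - \<alpha> [x4, x5, x6] * \<beta> [x1, x2, x3, x7] + \<alpha> [x4, x5, x7] * \<beta>
        [x1, x2, x3, x6]
    - \<alpha> [x4, x6, x7] * \<beta> [x1, x2, x3, x5] + \<alpha> [x5, x6, x7] * \<beta> [x1, x2, x3, x4]"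
  by (simp only: wedge_eq_wsum_alt[OF assms] wsum_numeral contract_def algebra_simps
      diff_0_right add_0_right)

lemma wedge_2_5:
  assumes "alt_form 2 \<alpha>"
  shows "wedge \<alpha> \<beta> [x1, x2, x3, x4, x5, x6, x7] =
    \<alpha> [x1, x2] * \<beta> [x3, x4, x5, x6, x7] - \<alpha> [x1, x3] * \<beta> [x2, x4, x5, x6, x7] + \<alpha> [x1, x4] * \<beta>
        [x2, x3, x5, x6, x7]
    - \<alpha> [x1, x5] * \<beta> [x2, x3, x4, x6, x7] + \<alpha> [x1, x6] * \<beta> [x2, x3, x4, x5, x7] - \<alpha> [x1, x7] * \<beta>
        [x2, x3, x4, x5, x6]
    + \<alpha> [x2, x3] * \<beta> [x1, x4, x5, x6, x7] - \<alpha> [x2, x4] * \<beta> [x1, x3, x5, x6, x7] + \<alpha> [x2, x5] * \<beta>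
        [x1, x3, x4, x6, x7]
    - \<alpha> [x2, x6] * \<beta> [x1, x3, x4, x5, x7] + \<alpha> [x2, x7] * \<beta> [x1, x3, x4, x5, x6] + \<alpha> [x3, x4] * \<beta>
        [x1, x2, x5, x6, x7]
    - \<alpha> [x3, x5] * \<beta> [x1, x2, x4, x6, x7] + \<alpha> [x3, x6] * \<beta> [x1, x2, x4, x5, x7] - \<alpha> [x3, x7] * \<beta>
        [x1, x2, x4, x5, x6]
    + \<alpha> [x4, x5] * \<beta> [x1, x2, x3, x6, x7] - \<alpha> [x4, x6] * \<beta> [x1, x2, x3, x5, x7] + \<alpha> [x4, x7] * \<beta>
        [x1, x2, x3, x5, x6]
    + \<alpha> [x5, x6] * \<beta> [x1, x2, x3, x4, x7] - \<alpha> [x5, x7] * \<beta> [x1, x2, x3, x4, x6] + \<alpha> [x6, x7] * \<beta>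
        [x1, x2, x3, x4, x5]"
  by (simp only: wedge_eq_wsum_alt[OF assms] wsum_numeral contract_def algebra_simps
      diff_0_right add_0_right)

lemma cubic_form_expand:
  assumes a: "alt_form 3 \<phi>"
  shows "cubic_form \<phi> v w [x1, x2, x3, x4, x5, x6, x7] = (let W = wedge (contract v \<phi>) (contract w \<phi>) in
    W [x1, x2, x3, x4] * \<phi> [x5, x6, x7] - W [x1, x2, x3, x5] * \<phi> [x4, x6, x7] + W [x1, x2, x3, x6] *
        \<phi> [x4, x5, x7]
    - W [x1, x2, x3, x7] * \<phi> [x4, x5, x6] + W [x1, x2, x4, x5] * \<phi> [x3, x6, x7] - W [x1, x2, x4, x6]
        * \<phi> [x3, x5, x7]
    + W [x1, x2, x4, x7] * \<phi> [x3, x5, x6] + W [x1, x2, x5, x6] * \<phi> [x3, x4, x7] - W [x1, x2, x5, x7]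
        * \<phi> [x3, x4, x6]
    + W [x1, x2, x6, x7] * \<phi> [x3, x4, x5] - W [x1, x3, x4, x5] * \<phi> [x2, x6, x7] + W [x1, x3, x4, x6]
        * \<phi> [x2, x5, x7]
    - W [x1, x3, x4, x7] * \<phi> [x2, x5, x6] - W [x1, x3, x5, x6] * \<phi> [x2, x4, x7] + W [x1, x3, x5, x7]
        * \<phi> [x2, x4, x6]
    - W [x1, x3, x6, x7] * \<phi> [x2, x4, x5] + W [x1, x4, x5, x6] * \<phi> [x2, x3, x7] - W [x1, x4, x5, x7]
        * \<phi> [x2, x3, x6]
    + W [x1, x4, x6, x7] * \<phi> [x2, x3, x5] - W [x1, x5, x6, x7] * \<phi> [x2, x3, x4] + W [x2, x3, x4, x5]
        * \<phi> [x1, x6, x7]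
    - W [x2, x3, x4, x6] * \<phi> [x1, x5, x7] + W [x2, x3, x4, x7] * \<phi> [x1, x5, x6] + W [x2, x3, x5, x6]
        * \<phi> [x1, x4, x7]
    - W [x2, x3, x5, x7] * \<phi> [x1, x4, x6] + W [x2, x3, x6, x7] * \<phi> [x1, x4, x5] - W [x2, x4, x5, x6]
        * \<phi> [x1, x3, x7]
    + W [x2, x4, x5, x7] * \<phi> [x1, x3, x6] - W [x2, x4, x6, x7] * \<phi> [x1, x3, x5] + W [x2, x5, x6, x7]
        * \<phi> [x1, x3, x4]
    + W [x3, x4, x5, x6] * \<phi> [x1, x2, x7] - W [x3, x4, x5, x7] * \<phi> [x1, x2, x6] + W [x3, x4, x6, x7]
        * \<phi> [x1, x2, x5]
    - W [x3, x5, x6, x7] * \<phi> [x1, x2, x4] + W [x4, x5, x6, x7] * \<phi> [x1, x2, x3])"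
proof -
  have 2: "alt_form 2 (contract u \<phi>)" for u
    by (rule alt_form_contract) (use a in \<open>simp add: numeral_3_eq_3 numeral_2_eq_2\<close>)
  have "alt_form 4 (wedge (contract v \<phi>) (contract w \<phi>))"
    using alt_form_wedge[OF 2 2] by simp
  from wedge_4_3[OF this] show ?thesis
    unfolding cubic_form_def Let_def .
qed

lemma contract_contract_expand:
  assumes a: "alt_form 3 \<phi>"
  shows "wedge (contract v \<phi>) (contract w \<phi>) [x1, x2, x3, x4] =
    \<phi> [v, x1, x2] * \<phi> [w, x3, x4] - \<phi> [v, x1, x3] * \<phi> [w, x2, x4]
    + \<phi> [v, x1, x4] * \<phi> [w, x2, x3] + \<phi> [v, x2, x3] * \<phi> [w, x1, x4]
    - \<phi> [v, x2, x4] * \<phi> [w, x1, x3] + \<phi> [v, x3, x4] * \<phi> [w, x1, x2]"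
proof -
  have 2: "alt_form 2 (contract u \<phi>)" for u
    by (rule alt_form_contract) (use a in \<open>simp add: numeral_3_eq_3 numeral_2_eq_2\<close>)
  show ?thesis
    using wedge_2_2[OF 2, of v "contract w \<phi>"] by (simp add: contract_def)
qed

section \<open>The standard 3-form on seven-dimensional space\<close>

lemma neq_7:
  "(1::7) \<noteq> 2" "(1::7) \<noteq> 3" "(1::7) \<noteq> 4" "(1::7) \<noteq> 5" "(1::7) \<noteq> 6" "(1::7) \<noteq> 7"
  "(2::7) \<noteq> 1" "(2::7) \<noteq> 3" "(2::7) \<noteq> 4" "(2::7) \<noteq> 5" "(2::7) \<noteq> 6" "(2::7) \<noteq> 7"
  "(3::7) \<noteq> 1" "(3::7) \<noteq> 2" "(3::7) \<noteq> 4" "(3::7) \<noteq> 5" "(3::7) \<noteq> 6" "(3::7) \<noteq> 7"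
  "(4::7) \<noteq> 1" "(4::7) \<noteq> 2" "(4::7) \<noteq> 3" "(4::7) \<noteq> 5" "(4::7) \<noteq> 6" "(4::7) \<noteq> 7"
  "(5::7) \<noteq> 1" "(5::7) \<noteq> 2" "(5::7) \<noteq> 3" "(5::7) \<noteq> 4" "(5::7) \<noteq> 6" "(5::7) \<noteq> 7"
  "(6::7) \<noteq> 1" "(6::7) \<noteq> 2" "(6::7) \<noteq> 3" "(6::7) \<noteq> 4" "(6::7) \<noteq> 5" "(6::7) \<noteq> 7"
  "(7::7) \<noteq> 1" "(7::7) \<noteq> 2" "(7::7) \<noteq> 3" "(7::7) \<noteq> 4" "(7::7) \<noteq> 5" "(7::7) \<noteq> 6"
  by simp_all

lemma E_nth: "E i $ j = of_bool (i = j)"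
  by (simp add: axis_def)

text \<open>The value of e^{ijk} on \<open>u\<close>, \<open>v\<close>, \<open>w\<close>, written as
  a triple product.\<close>

definition minor3 :: "7 \<Rightarrow> 7 \<Rightarrow> 7 \<Rightarrow> real^7 \<Rightarrow> real^7 \<Rightarrow> real^7 \<Rightarrow> real" where
  "minor3 i j k u v w = u $ i * (v $ j * w $ k - v $ k * w $ j)
     + u $ j * (v $ k * w $ i - v $ i * w $ k) + u $ k * (v $ i * w $ j - v $ j * w $ i)"

text \<open>The model G2 form e^123 + e^1(e^45 + e^67) + e^2(e^46 - e^57) - e^3(e^47 + e^56); the
  brackets are self-dual 2-forms in the variables 4, 5, 6, 7.\<close>

definition phi0 :: "real^7 \<Rightarrow> real^7 \<Rightarrow> real^7 \<Rightarrow> real" where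
  "phi0 u v w = minor3 1 2 3 u v w + minor3 1 4 5 u v w + minor3 1 6 7 u v w + minor3 2 4 6 u v w
     - minor3 2 5 7 u v w - minor3 3 4 7 u v w - minor3 3 5 6 u v w"

lemma phi0_E:
  "phi0 u (E 1) (E 2) = u $ 3" "phi0 u (E 1) (E 3) = - u $ 2" "phi0 u (E 1) (E 4) = u $ 5"
  "phi0 u (E 1) (E 5) = - u $ 4" "phi0 u (E 1) (E 6) = u $ 7" "phi0 u (E 1) (E 7) = - u $ 6"
  "phi0 u (E 2) (E 3) = u $ 1" "phi0 u (E 2) (E 4) = u $ 6" "phi0 u (E 2) (E 5) = - u $ 7"
  "phi0 u (E 2) (E 6) = - u $ 4" "phi0 u (E 2) (E 7) = u $ 5" "phi0 u (E 3) (E 4) = - u $ 7"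
  "phi0 u (E 3) (E 5) = - u $ 6" "phi0 u (E 3) (E 6) = u $ 5" "phi0 u (E 3) (E 7) = u $ 4"
  "phi0 u (E 4) (E 5) = u $ 1" "phi0 u (E 4) (E 6) = u $ 2" "phi0 u (E 4) (E 7) = - u $ 3"
  "phi0 u (E 5) (E 6) = - u $ 3" "phi0 u (E 5) (E 7) = - u $ 2" "phi0 u (E 6) (E 7) = u $ 1"
  by (simp_all only: phi0_def minor3_def E_nth neq_7 of_bool_eq simp_thms mult_zero_left mult_zero_right
      mult_1_right mult_1_left diff_0 diff_0_right add_0_left add_0_right mult_minus_right minus_zero
      diff_minus_eq_add)

text \<open>Fixes the normalisation: with the signs of \<open>phi0\<close> and the orientation given
  by \<open>idx7\<close>, the induced metric is the standard one and the factor is +6.\<close>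

lemma cubic_form_phi0:
  assumes a: "alt_form 3 \<phi>" and v: "\<And>u v w. \<phi> [u, v, w] = phi0 u v w"
  shows "cubic_form \<phi> v w (map E idx7) = 6 * (v \<bullet> w)"
  unfolding map_idx7 cubic_form_expand[OF a] Let_def v phi0_E E_nth inner_vec_def sum_7
  by (simp only: contract_contract_expand[OF a] v phi0_E neq_7 of_bool_eq simp_thms inner_real_def
      mult_zero_left mult_zero_right diff_0_right add_0_right diff_0 add_0_left minus_zero mult_1_right)
    (simp add: algebra_simps)

subsection \<open>Pullback to an adapted frame\<close>

definition pullback :: "real^7^7 \<Rightarrow> form \<Rightarrow> form" where
  "pullback P \<alpha> = (\<lambda>xs. \<alpha> (map ((*v) P) xs))"

lemma alt_form_pullback:
  assumes "alt_form k \<alpha>"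
  shows "alt_form k (pullback P \<alpha>)"
proof -
  have "linear (\<lambda>x. \<alpha> (map ((*v) P) (xs[i := x])))" if "length xs = k" "i < k" for xs i
    using linear_compose[OF matrix_vector_mul_linear[of P]
      alt_form_linear[OF assms, of "map ((*v) P) xs" i]] that
    by (simp add: o_def map_update)
  then show ?thesis
    using assms by (auto simp: alt_form_def pullback_def distinct_map)
qed

lemma wedge_pullback: "wedge (pullback P \<alpha>) (pullback P \<beta>) = pullback P (wedge \<alpha> \<beta>)"
  by (rule ext) (simp add: wedge_def pullback_def nths_map)

lemma contract_pullback: "contract v (pullback P \<alpha>) = pullback P (contract (P *v v) \<alpha>)"
  by (simp add: contract_def pullback_def)

lemma cubic_form_pullback:
  "cubic_form (pullback P \<phi>) v w = pullback P (cubic_form \<phi> (P *v v) (P *v w))"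
  by (simp add: cubic_form_def contract_pullback wedge_pullback)

lemma pullback_top:
  assumes "alt_form 7 W"
  shows "pullback P W (map E idx7) = det P * W (map E idx7)"
proof -
  have "map ((*v) P) (map E idx7) = map (($) (transpose P)) idx7"
    by (simp add: matrix_vector_mult_basis column_def transpose_def)
  then show ?thesis
    using alt_top_det[OF assms, of "transpose P"] by (simp only: pullback_def det_transpose)
qed

text \<open>The columns \<open>P *v E a\<close> form the adapted frame. Nothing is required about
  the sign of \<open>det P\<close>.\<close>

definition adapted :: "form \<Rightarrow> real^7^7 \<Rightarrow> bool" where
  "adapted \<phi> P \<longleftrightarrow> alt_form 3 \<phi> \<and> (\<forall>u v w. \<phi> [P *v u, P *v v, P *v w] = phi0 u v w)"

text \<open>Since \<open>g2_coeff\<close> is the coefficient of a 7-form, pulling back to the frame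
  multiplies it by \<open>det P\<close>; in the frame it is the standard inner product.\<close>

lemma adapted_g2_coeff:
  assumes "adapted \<phi> P"
  shows "det P * g2_coeff \<phi> (P *v u) (P *v v) = u \<bullet> v"
proof -
  have a: "alt_form 3 \<phi>"
    using assms by (simp add: adapted_def)
  have "cubic_form (pullback P \<phi>) u v (map E idx7) = 6 * (u \<bullet> v)"
    using assms by (intro cubic_form_phi0 alt_form_pullback) (simp_all add: adapted_def pullback_def)
  then show ?thesis
    unfolding cubic_form_pullback pullback_top[OF alt_form_cubic_form[OF a]] g2_coeff_eq by simp
qed

lemma adapted_det:
  assumes "adapted \<phi> P"
  shows "det P \<noteq> 0"
  using adapted_g2_coeff[OF assms, of "E 1" "E 1"] by (auto simp: inner_axis_axis)

lemma matrix_inv_eq: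
  fixes A B :: "real^'n^'n"
  assumes "A ** B = mat 1"
  shows "matrix_inv A = B"
proof -
  have BA: "B ** A = mat 1"
    using assms by (simp add: matrix_left_right_inverse)
  have "A ** matrix_inv A = mat 1 \<and> matrix_inv A ** A = mat 1"
    unfolding matrix_inv_def by (rule someI[of _ B]) (simp add: assms BA)
  then have "B ** (A ** matrix_inv A) = B"
    by simp
  then show ?thesis
    by (simp add: matrix_mul_assoc BA)
qed

lemma adapted_inverse:
  assumes "adapted \<phi> P"
  shows "matrix_inv P ** P = mat 1" "P ** matrix_inv P = mat 1"
proof -
  obtain Q where "P ** Q = mat 1"
    using adapted_det[OF assms] by (auto simp: invertible_det_nz[symmetric] invertible_def)
  then show "P ** matrix_inv P = mat 1"
    by (simp add: matrix_inv_eq)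
  then show "matrix_inv P ** P = mat 1"
    by (simp add: matrix_left_right_inverse)
qed

lemma adapted_matrix_inv_mult:
  assumes "adapted \<phi> P"
  shows "P *v (matrix_inv P *v x) = x" "matrix_inv P *v (P *v x) = x"
  by (simp_all add: matrix_vector_mul_assoc adapted_inverse[OF assms])

lemma adapted_g2_coeff_inv:
  assumes "adapted \<phi> P"
  shows "g2_coeff \<phi> v w = (matrix_inv P *v v) \<bullet> (matrix_inv P *v w) / det P"
  using adapted_g2_coeff[OF assms, of "matrix_inv P *v v" "matrix_inv P *v w"] adapted_det[OF assms]
  by (simp add: adapted_matrix_inv_mult[OF assms] field_simps)

lemma inner_matrix_E: "(A *v E i) \<bullet> (A *v E j) = (transpose A ** A) $ i $ j" for A :: "real^7^7"
  by (simp add: matrix_vector_mult_basis column_def inner_vec_def matrix_matrix_mult_def transpose_def)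

text \<open>Seven factors \<open>1 / det P\<close> come from the rows and two more from the change
  of basis, which makes a ninth power. As 9 is odd, the root returns \<open>1 / det P\<close> with
  its sign; dividing by it makes the frame orthonormal for the induced metric.\<close>

lemma adapted_root:
  assumes "adapted \<phi> P"
  shows "g2_root \<phi> = 1 / det P"
proof -
  let ?Q = "matrix_inv P"
  have dQ: "det ?Q * det P = 1"
    using arg_cong[OF adapted_inverse(1)[OF assms], of det] by (simp add: det_mul)
  have "(\<chi> i j. g2_coeff \<phi> (E i) (E j)) = (\<chi> i. (1 / det P) *s (transpose ?Q ** ?Q) $ i)"
    by (simp add: adapted_g2_coeff_inv[OF assms] inner_matrix_E vec_eq_iff)
  then have "det (\<chi> i j. g2_coeff \<phi> (E i) (E j)) = (1 / det P) ^ 7 * (det ?Q)\<^sup>2"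
    by (simp add: det_rows_mul det_mul power2_eq_square)
  also have "det ?Q = 1 / det P"
    using dQ adapted_det[OF assms] by (simp add: field_simps)
  also have "(1 / det P) ^ 7 * (1 / det P)\<^sup>2 = (1 / det P) ^ 9"
    by (simp add: power_add[symmetric])
  finally show ?thesis
    by (simp add: g2_root_def odd_real_root_power_cancel)
qed

lemma adapted_inverse_metric:
  assumes "adapted \<phi> P"
  shows "matrix_inv (\<chi> i j. g2_metric \<phi> (E i) (E j)) = P ** transpose P"
proof -
  let ?Q = "matrix_inv P" and ?G = "(\<chi> i j. g2_metric \<phi> (E i) (E j)) :: real^7^7"
  have G: "?G = transpose ?Q ** ?Q"
    using adapted_det[OF assms]
    by (simp add: vec_eq_iff g2_metric_def adapted_g2_coeff_inv[OF assms] adapted_root[OF assms]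
        inner_matrix_E)
  have "?G ** (P ** transpose P) = transpose ?Q ** (?Q ** P) ** transpose P"
    by (simp only: G matrix_mul_assoc)
  also have "\<dots> = mat 1"
    by (simp add: adapted_inverse[OF assms] matrix_transpose_mul[symmetric] transpose_mat)
  finally show ?thesis
    by (rule matrix_inv_eq)
qed

subsection \<open>The Hodge operator\<close>

lemma alt_form_coframe1: "alt_form 1 (coframe1 i)"
proof -
  have "linear (\<lambda>x :: real^7. x $ i)"
    by (rule linearI) simp_all
  then show ?thesis
    by (auto simp: alt_form_def coframe1_def length_Suc_conv)
qed

lemma alt_form_coframe: "alt_form (length is) (coframe is)"
proof (induction "is")
  case Nil
  then show ?case by (simp add: alt_form_def)
next
  case (Cons i "is")
  then show ?case
    using alt_form_wedge[OF alt_form_coframe1 Cons] by simp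
qed

lemma coframe1_single: "coframe1 i [x] = x $ i"
  by (simp add: coframe1_def)

lemma wsum_coframe1_eq_0:
  "(\<And>x. x \<in> set xs \<Longrightarrow> x $ i = 0) \<Longrightarrow> wsum (Suc 0) (coframe1 i) \<beta> xs = 0"
proof (induction xs arbitrary: \<beta>)
  case (Cons x xs)
  have "wsum (Suc 0) (coframe1 i) (contract x \<beta>) xs = 0"
    by (rule Cons.IH) (use Cons.prems in simp)
  then show ?case
    unfolding wsum_numeral(5) using Cons.prems by (simp add: coframe1_single)
qed (simp add: wsum_numeral(4))

lemma coframe_E: "distinct is \<Longrightarrow> coframe is (map E is) = 1"
proof (induction "is")
  case (Cons i "is")
  have "wsum (Suc 0) (coframe1 i) (contract (E i) (coframe is)) (map E is) = 0"
    by (rule wsum_coframe1_eq_0) (use Cons.prems in \<open>auto simp: axis_def\<close>)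
  moreover have "coframe (i # is) (map E (i # is)) = wsum (Suc 0) (coframe1 i) (coframe is) (E i #
      map E is)"
    using wedge_eq_wsum_alt[OF alt_form_coframe1, of i "coframe is" "E i # map E is"] by simp
  ultimately show ?case
    using Cons by (simp add: wsum_numeral(5) coframe1_single del: wsum.simps)
qed simp

lemma g2_volume_idx7: "g2_volume \<phi> = (\<lambda>xs. g2_root \<phi> * coframe idx7 xs)"
  by (simp only: g2_volume_def idx7_def)

lemma alt_form_g2_volume: "alt_form 7 (g2_volume \<phi>)"
  unfolding g2_volume_idx7
  by (rule alt_form_scale) (rule alt_form_coframe[of idx7, unfolded length_idx7])

lemma adapted_volume:
  assumes "adapted \<phi> P"
  shows "g2_volume \<phi> (map E idx7) = 1 / det P"
  by (simp only: g2_volume_idx7 coframe_E[OF distinct_idx7] adapted_root[OF assms] mult_1_right)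

text \<open>The inverse metric is \<open>P ** transpose P\<close>, the sum of the squares of the
  frame vectors, so both rows of indices in the definition of the Hodge operator may be replaced by
  one sum over the frame.\<close>

lemma adapted_star:
  assumes "adapted \<phi> P" and \<gamma>: "alt_form k \<gamma>" and k: "k \<le> 7"
  shows "g2_star \<phi> k \<gamma> = (\<lambda>ys. \<Sum>A\<in>{A. length A = k}.
    \<gamma> (map (\<lambda>a. P *v E a) A) / fact k * g2_volume \<phi> (map (\<lambda>a. P *v E a) A @ ys))"
proof
  fix ys
  let ?G = "matrix_inv (\<chi> i j. g2_metric \<phi> (E i) (E j)) :: real^7^7"
  have "?G $ i $ j = (\<Sum>a\<in>UNIV. (P *v E a) $ i * (P *v E a) $ j)" for i j
    unfolding adapted_inverse_metric[OF assms(1)]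
    by (simp add: matrix_matrix_mult_def transpose_def matrix_vector_mult_basis column_def)
  from sum_inverse_metric[OF this \<gamma>, of "7 - k" "g2_volume \<phi>" ys]
  show "g2_star \<phi> k \<gamma> ys = (\<Sum>A\<in>{A. length A = k}.
      \<gamma> (map (\<lambda>a. P *v E a) A) / fact k * g2_volume \<phi> (map (\<lambda>a. P *v E a) A @ ys))"
    using alt_form_g2_volume[of \<phi>] k unfolding g2_star_def Let_def by (simp add: sum_distrib_left)
qed

lemma alt_form_star:
  assumes "adapted \<phi> P" "alt_form k \<gamma>" "k + l = 7"
  shows "alt_form l (g2_star \<phi> k \<gamma>)"
proof -
  have "k \<le> 7"
    using assms(3) by simp
  show ?thesis
    unfolding adapted_star[OF assms(1,2) \<open>k \<le> 7\<close>]
    by (intro alt_form_sum alt_form_scale alt_form_contract_list)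
      (use alt_form_g2_volume assms(3) in simp)
qed

text \<open>The inner product of two k-forms, in the frame. The sum runs over ordered tuples, whence
  \<open>fact k\<close>, and \<open>1 / det P\<close> is the volume of the coordinate basis.\<close>

lemma wedge_star:
  assumes "adapted \<phi> P" "alt_form k \<beta>" "alt_form k \<gamma>" "k \<le> 7"
  shows "wedge \<beta> (g2_star \<phi> k \<gamma>) (map E idx7) = (\<Sum>A\<in>{A. length A = k}.
    \<beta> (map (\<lambda>a. P *v E a) A) * \<gamma> (map (\<lambda>a. P *v E a) A)) / (fact k * det P)"
proof -
  have "wedge \<beta> (\<lambda>ys. g2_volume \<phi> (map (\<lambda>a. P *v E a) A @ ys)) (map E idx7)
      = \<beta> (map (\<lambda>a. P *v E a) A) / det P" if "length A = k" for A
    using wedge_contract_top[OF alt_form_g2_volume, of "map (\<lambda>a. P *v E a) A" \<beta> \<phi>] that assms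
    by (simp add: adapted_volume[OF assms(1)])
  then show ?thesis
    unfolding adapted_star[OF assms(1,3,4)] wedge_sum_right wedge_scale_right
    by (simp add: sum_divide_distrib mult_ac)
qed

subsection \<open>Rigidity of 3-by-3 matrices\<close>

text \<open>The cofactor matrix; its transpose is the adjugate of \<open>p\<close>.\<close>

definition cof3 :: "real^3^3 \<Rightarrow> real^3^3" where
  "cof3 p = vector [cross3 (p $ 2) (p $ 3), cross3 (p $ 3) (p $ 1), cross3 (p $ 1) (p $ 2)]"

lemma cof3_nth:
  "cof3 p $ 1 = cross3 (p $ 2) (p $ 3)" "cof3 p $ 2 = cross3 (p $ 3) (p $ 1)"
  "cof3 p $ 3 = cross3 (p $ 1) (p $ 2)"
  by (simp_all add: cof3_def vector_3)

lemma cross3_nth: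
  "cross3 x y $ 1 = x $ 2 * y $ 3 - x $ 3 * y $ 2" "cross3 x y $ 2 = x $ 3 * y $ 1 - x $ 1 * y $ 3"
  "cross3 x y $ 3 = x $ 1 * y $ 2 - x $ 2 * y $ 1"
  by (simp_all add: cross3_def)

lemma cof3_mult:
  "p ** transpose (cof3 p) = det p *\<^sub>R mat 1" "transpose (cof3 p) ** p = det p *\<^sub>R mat 1"
  unfolding vec_eq_iff forall_3
  by (simp_all add: matrix_matrix_mult_def transpose_def sum_3 cof3_nth cross3_nth det_3 mat_def
      algebra_simps)

lemma cof3_cof3: "cof3 (cof3 p) = det p *\<^sub>R p"
  unfolding vec_eq_iff forall_3
  by (simp add: cof3_nth cross3_nth det_3 algebra_simps)

lemma cof3_scale: "cof3 (s *\<^sub>R p) = s\<^sup>2 *\<^sub>R cof3 p"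
  unfolding vec_eq_iff forall_3
  by (simp add: cof3_nth cross3_nth power2_eq_square algebra_simps)

lemma det3_scale: "det (s *\<^sub>R p) = s ^ 3 * det p" for p :: "real^3^3"
  by (simp add: det_3 power3_eq_cube algebra_simps)

lemma matrix_add_distrib_right: "(A + B) ** C = A ** C + B ** C" for A B :: "real^'n^'m"
  by (simp add: matrix_matrix_mult_def vec_eq_iff sum.distrib distrib_right)

text \<open>The equations say that n = -c cof(n). If n were nonzero, taking cofactors again would
  give det n = -1/c^3, so that n and p would both be multiples of orthogonal matrices with p p^T =
  (c + 1/c^2) I and det p = 1 + 1/c^3. Comparing determinants yields c^3 det p = 1, although c^3 det
  p = c^3 + 1. With n = 0 the determinants give c^3 = 1.\<close>

lemma matrix_rigidity:
  fixes p n :: "real^3^3"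
  assumes c: "c > 0"
    and A: "p ** transpose p - n ** transpose n = c *\<^sub>R mat 1"
    and D: "det p + det n = 1"
    and X: "transpose n ** cof3 p + transpose (cof3 n) ** p = 0"
  shows "n = 0" "c = 1"
proof -
  have A': "p ** transpose p = c *\<^sub>R mat 1 + n ** transpose n"
    using A by (simp add: algebra_simps)
  \<comment> \<open>Multiplying by \<open>transpose p\<close> turns \<open>cof3 p\<close> into the
    scalar \<open>det p\<close>, and \<open>A'\<close> replaces the remaining
    \<open>p ** transpose p\<close> by terms in \<open>n\<close>. What is left is linear in
    \<open>n\<close> and \<open>cof3 n\<close>.\<close>
  have "0 = (transpose n ** cof3 p + transpose (cof3 n) ** p) ** transpose p"
    by (simp add: X)
  also have "\<dots> = transpose n ** (cof3 p ** transpose p) + transpose (cof3 n) ** (p ** transpose p)"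
    by (simp add: matrix_add_distrib_right matrix_mul_assoc)
  also have "cof3 p ** transpose p = det p *\<^sub>R mat 1"
    using arg_cong[OF cof3_mult(1)[of p], of transpose]
    by (simp add: matrix_transpose_mul transpose_scalar transpose_mat)
  also have "transpose (cof3 n) ** (p ** transpose p)
      = c *\<^sub>R transpose (cof3 n) + (transpose (cof3 n) ** n) ** transpose n"
    by (simp add: A' matrix_add_ldistrib matrix_mul_assoc matrix_scalar_ac)
  also have "transpose n ** (det p *\<^sub>R mat 1)
        + (c *\<^sub>R transpose (cof3 n) + (transpose (cof3 n) ** n) ** transpose n)
      = (det p + det n) *\<^sub>R transpose n + c *\<^sub>R transpose (cof3 n)"
    by (simp add: cof3_mult(2) matrix_scalar_ac scalar_matrix_assoc[symmetric] scaleR_add_left)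
  finally have "transpose n = (- c) *\<^sub>R transpose (cof3 n)"
    using D by (simp add: eq_neg_iff_add_eq_0)
  then have n: "n = (- c) *\<^sub>R cof3 n"
    by (metis transpose_scalar transpose_transpose)
  have "cof3 n = (- (1 / c)) *\<^sub>R ((- c) *\<^sub>R cof3 n)"
    using c by simp
  also have "(- c) *\<^sub>R cof3 n = n"
    by (rule n[symmetric])
  finally have cn: "cof3 n = (- (1 / c)) *\<^sub>R n" .
  show n0: "n = 0"
  proof (rule ccontr)
    assume "n \<noteq> 0"
    have "det n *\<^sub>R n = cof3 ((- (1 / c)) *\<^sub>R n)"
      by (simp only: cn[symmetric] cof3_cof3)
    also have "\<dots> = (- (1 / c ^ 3)) *\<^sub>R n"
      unfolding cof3_scale by (simp add: cn power2_eq_square power3_eq_cube)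
    finally have "det n *\<^sub>R n = (- (1 / c ^ 3)) *\<^sub>R n" .
    then have d: "det n = - (1 / c ^ 3)"
      using \<open>n \<noteq> 0\<close> unfolding scaleR_cancel_right by simp
    have "n ** transpose n = n ** transpose ((- c) *\<^sub>R cof3 n)"
      using n by metis
    also have "\<dots> = (- c) *\<^sub>R (det n *\<^sub>R mat 1)"
      by (simp only: transpose_scalar matrix_scalar_ac scalar_matrix_assoc[symmetric] cof3_mult(1))
    also have "\<dots> = (1 / c\<^sup>2) *\<^sub>R mat 1"
      using c by (simp add: d power2_eq_square power3_eq_cube)
    finally have "n ** transpose n = (1 / c\<^sup>2) *\<^sub>R mat 1" .
    then have pp: "p ** transpose p = (c + 1 / c\<^sup>2) *\<^sub>R mat 1"
      unfolding A' by (simp add: scaleR_add_left)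
    have "(det p)\<^sup>2 = (c + 1 / c\<^sup>2) ^ 3"
      using arg_cong[OF pp, of det] by (simp add: det_mul det3_scale power2_eq_square)
    moreover have "c + 1 / c\<^sup>2 = c * det p" "det p = 1 + 1 / c ^ 3"
      using D d c by (simp_all add: field_simps power2_eq_square power3_eq_cube)
    ultimately have "(det p)\<^sup>2 = c ^ 3 * (det p)\<^sup>2 * det p" "det p > 1"
      using c by (simp_all add: power_mult_distrib power2_eq_square power3_eq_cube)
    then have "c ^ 3 * det p = 1"
      by simp
    then show False
      using \<open>det p = 1 + 1 / c ^ 3\<close> c by (simp add: field_simps)
  qed
  have "(det p)\<^sup>2 = c ^ 3"
    using arg_cong[OF A', of det] by (simp add: n0 det_mul det3_scale power2_eq_square)
  then have "c ^ 3 = 1"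
    using D by (simp add: n0 det_3)
  then show "c = 1"
    using c by (metis less_eq_real_def power_eq_1_iff numeral_eq_Suc nat.distinct(1) abs_of_nonneg
        real_norm_def)
qed

subsection \<open>Coefficients of alternating forms\<close>

lemma alt2_rules:
  assumes "alt_form 2 \<alpha>"
  shows "\<alpha> [x, x] = 0" "\<alpha> [y, x] = - \<alpha> [x, y]"
  using alt_form_not_distinct[OF assms, of "[x, x]"] alt_form_swap[OF assms, of "[]" y "[]" x "[]"]
  by simp_all

lemma alt3_repeat:
  assumes "alt_form 3 \<alpha>"
  shows "\<alpha> [x, x, y] = 0" "\<alpha> [x, y, x] = 0" "\<alpha> [y, x, x] = 0"
  by (rule alt_form_not_distinct[OF assms]; simp)+

lemma alt3_perm:
  assumes a: "alt_form 3 \<alpha>" and "\<alpha> [x, y, z] = c"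
  shows "\<alpha> [y, z, x] = c" "\<alpha> [z, x, y] = c"
    "\<alpha> [y, x, z] = - c" "\<alpha> [x, z, y] = - c" "\<alpha> [z, y, x] = - c"
  using assms(2) alt_form_swap[OF a, of "[]" x "[]" y "[z]"] alt_form_swap[OF a, of "[x]" y "[]" z "[]"]
    alt_form_swap[OF a, of "[]" x "[y]" z "[]"] alt_form_swap[OF a, of "[y]" x "[]" z "[]"]
    alt_form_swap[OF a, of "[z]" x "[]" y "[]"]
  by simp_all

lemma alt2_expand:
  assumes a: "alt_form 2 \<alpha>"
  shows "\<alpha> [v, w] =
    \<alpha> [E 1, E 2] * (v $ 1 * w $ 2 - v $ 2 * w $ 1) + \<alpha> [E 1, E 3] * (v $ 1 * w $ 3 - v $ 3 * w $ 1)
    + \<alpha> [E 1, E 4] * (v $ 1 * w $ 4 - v $ 4 * w $ 1) + \<alpha> [E 1, E 5] * (v $ 1 * w $ 5 - v $ 5 * w $ 1)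
    + \<alpha> [E 1, E 6] * (v $ 1 * w $ 6 - v $ 6 * w $ 1) + \<alpha> [E 1, E 7] * (v $ 1 * w $ 7 - v $ 7 * w $ 1)
    + \<alpha> [E 2, E 3] * (v $ 2 * w $ 3 - v $ 3 * w $ 2) + \<alpha> [E 2, E 4] * (v $ 2 * w $ 4 - v $ 4 * w $ 2)
    + \<alpha> [E 2, E 5] * (v $ 2 * w $ 5 - v $ 5 * w $ 2) + \<alpha> [E 2, E 6] * (v $ 2 * w $ 6 - v $ 6 * w $ 2)
    + \<alpha> [E 2, E 7] * (v $ 2 * w $ 7 - v $ 7 * w $ 2) + \<alpha> [E 3, E 4] * (v $ 3 * w $ 4 - v $ 4 * w $ 3)
    + \<alpha> [E 3, E 5] * (v $ 3 * w $ 5 - v $ 5 * w $ 3) + \<alpha> [E 3, E 6] * (v $ 3 * w $ 6 - v $ 6 * w $ 3)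
    + \<alpha> [E 3, E 7] * (v $ 3 * w $ 7 - v $ 7 * w $ 3) + \<alpha> [E 4, E 5] * (v $ 4 * w $ 5 - v $ 5 * w $ 4)
    + \<alpha> [E 4, E 6] * (v $ 4 * w $ 6 - v $ 6 * w $ 4) + \<alpha> [E 4, E 7] * (v $ 4 * w $ 7 - v $ 7 * w $ 4)
    + \<alpha> [E 5, E 6] * (v $ 5 * w $ 6 - v $ 6 * w $ 5) + \<alpha> [E 5, E 7] * (v $ 5 * w $ 7 - v $ 7 * w $ 5)
    + \<alpha> [E 6, E 7] * (v $ 6 * w $ 7 - v $ 7 * w $ 6)"
proof -
  have 1: "\<alpha> [v, w] = (\<Sum>i\<in>UNIV. v $ i * \<alpha> [E i, w])" for v w
    by (rule linear_expand[OF alt_form_linear_hd[OF a]])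
  have 2: "\<alpha> [E j, w] = (\<Sum>i\<in>UNIV. w $ i * \<alpha> [E j, E i])" for j
    unfolding alt2_rules(2)[OF a, of "E j" w] 1[of w "E j"] alt2_rules(2)[OF a, of "E j"]
    by (simp add: sum_negf)
  note r = alt2_rules(1)[OF a] alt2_rules(2)[OF a, of "E 2" "E 1"]
      alt2_rules(2)[OF a, of "E 3" "E 1"] alt2_rules(2)[OF a, of "E 4" "E 1"]
      alt2_rules(2)[OF a, of "E 5" "E 1"] alt2_rules(2)[OF a, of "E 6" "E 1"]
      alt2_rules(2)[OF a, of "E 7" "E 1"] alt2_rules(2)[OF a, of "E 3" "E 2"]
      alt2_rules(2)[OF a, of "E 4" "E 2"] alt2_rules(2)[OF a, of "E 5" "E 2"]
      alt2_rules(2)[OF a, of "E 6" "E 2"] alt2_rules(2)[OF a, of "E 7" "E 2"]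
      alt2_rules(2)[OF a, of "E 4" "E 3"] alt2_rules(2)[OF a, of "E 5" "E 3"]
      alt2_rules(2)[OF a, of "E 6" "E 3"] alt2_rules(2)[OF a, of "E 7" "E 3"]
      alt2_rules(2)[OF a, of "E 5" "E 4"] alt2_rules(2)[OF a, of "E 6" "E 4"]
      alt2_rules(2)[OF a, of "E 7" "E 4"] alt2_rules(2)[OF a, of "E 6" "E 5"]
      alt2_rules(2)[OF a, of "E 7" "E 5"] alt2_rules(2)[OF a, of "E 7" "E 6"]
  show ?thesis
    unfolding 1[of v w] 2 sum_7
    by (simp only: r) (simp only: algebra_simps mult_zero_right add_0_left add_0_right mult_minus_right)
qed

lemma linear_minor3: "linear (\<lambda>u. c * minor3 i j k u v w)"
  by (rule linearI) (simp_all add: minor3_def algebra_simps)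

lemma alt3_expand:
  assumes a: "alt_form 3 \<alpha>"
  shows "\<alpha> [u, v, w] =
    \<alpha> [E 1, E 2, E 3] * minor3 1 2 3 u v w + \<alpha> [E 1, E 2, E 4] * minor3 1 2 4 u v w
    + \<alpha> [E 1, E 2, E 5] * minor3 1 2 5 u v w + \<alpha> [E 1, E 2, E 6] * minor3 1 2 6 u v w
    + \<alpha> [E 1, E 2, E 7] * minor3 1 2 7 u v w + \<alpha> [E 1, E 3, E 4] * minor3 1 3 4 u v w
    + \<alpha> [E 1, E 3, E 5] * minor3 1 3 5 u v w + \<alpha> [E 1, E 3, E 6] * minor3 1 3 6 u v w
    + \<alpha> [E 1, E 3, E 7] * minor3 1 3 7 u v w + \<alpha> [E 1, E 4, E 5] * minor3 1 4 5 u v w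
    + \<alpha> [E 1, E 4, E 6] * minor3 1 4 6 u v w + \<alpha> [E 1, E 4, E 7] * minor3 1 4 7 u v w
    + \<alpha> [E 1, E 5, E 6] * minor3 1 5 6 u v w + \<alpha> [E 1, E 5, E 7] * minor3 1 5 7 u v w
    + \<alpha> [E 1, E 6, E 7] * minor3 1 6 7 u v w + \<alpha> [E 2, E 3, E 4] * minor3 2 3 4 u v w
    + \<alpha> [E 2, E 3, E 5] * minor3 2 3 5 u v w + \<alpha> [E 2, E 3, E 6] * minor3 2 3 6 u v w
    + \<alpha> [E 2, E 3, E 7] * minor3 2 3 7 u v w + \<alpha> [E 2, E 4, E 5] * minor3 2 4 5 u v w
    + \<alpha> [E 2, E 4, E 6] * minor3 2 4 6 u v w + \<alpha> [E 2, E 4, E 7] * minor3 2 4 7 u v w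
    + \<alpha> [E 2, E 5, E 6] * minor3 2 5 6 u v w + \<alpha> [E 2, E 5, E 7] * minor3 2 5 7 u v w
    + \<alpha> [E 2, E 6, E 7] * minor3 2 6 7 u v w + \<alpha> [E 3, E 4, E 5] * minor3 3 4 5 u v w
    + \<alpha> [E 3, E 4, E 6] * minor3 3 4 6 u v w + \<alpha> [E 3, E 4, E 7] * minor3 3 4 7 u v w
    + \<alpha> [E 3, E 5, E 6] * minor3 3 5 6 u v w + \<alpha> [E 3, E 5, E 7] * minor3 3 5 7 u v w
    + \<alpha> [E 3, E 6, E 7] * minor3 3 6 7 u v w + \<alpha> [E 4, E 5, E 6] * minor3 4 5 6 u v w
    + \<alpha> [E 4, E 5, E 7] * minor3 4 5 7 u v w + \<alpha> [E 4, E 6, E 7] * minor3 4 6 7 u v w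
    + \<alpha> [E 5, E 6, E 7] * minor3 5 6 7 u v w" (is "_ = ?R u")
proof -
  have 2: "alt_form 2 (contract (E i) \<alpha>)" for i
    by (rule alt_form_contract) (use a in \<open>simp add: numeral_3_eq_3 numeral_2_eq_2\<close>)
  note r = alt3_repeat[OF a]
    alt3_perm[OF a refl[of "\<alpha> [E 1, E 2, E 3]"]]
    alt3_perm[OF a refl[of "\<alpha> [E 1, E 2, E 4]"]]
    alt3_perm[OF a refl[of "\<alpha> [E 1, E 2, E 5]"]]
    alt3_perm[OF a refl[of "\<alpha> [E 1, E 2, E 6]"]]
    alt3_perm[OF a refl[of "\<alpha> [E 1, E 2, E 7]"]]
    alt3_perm[OF a refl[of "\<alpha> [E 1, E 3, E 4]"]]
    alt3_perm[OF a refl[of "\<alpha> [E 1, E 3, E 5]"]]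
    alt3_perm[OF a refl[of "\<alpha> [E 1, E 3, E 6]"]]
    alt3_perm[OF a refl[of "\<alpha> [E 1, E 3, E 7]"]]
    alt3_perm[OF a refl[of "\<alpha> [E 1, E 4, E 5]"]]
    alt3_perm[OF a refl[of "\<alpha> [E 1, E 4, E 6]"]]
    alt3_perm[OF a refl[of "\<alpha> [E 1, E 4, E 7]"]]
    alt3_perm[OF a refl[of "\<alpha> [E 1, E 5, E 6]"]]
    alt3_perm[OF a refl[of "\<alpha> [E 1, E 5, E 7]"]]
    alt3_perm[OF a refl[of "\<alpha> [E 1, E 6, E 7]"]]
    alt3_perm[OF a refl[of "\<alpha> [E 2, E 3, E 4]"]]
    alt3_perm[OF a refl[of "\<alpha> [E 2, E 3, E 5]"]]
    alt3_perm[OF a refl[of "\<alpha> [E 2, E 3, E 6]"]]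
    alt3_perm[OF a refl[of "\<alpha> [E 2, E 3, E 7]"]]
    alt3_perm[OF a refl[of "\<alpha> [E 2, E 4, E 5]"]]
    alt3_perm[OF a refl[of "\<alpha> [E 2, E 4, E 6]"]]
    alt3_perm[OF a refl[of "\<alpha> [E 2, E 4, E 7]"]]
    alt3_perm[OF a refl[of "\<alpha> [E 2, E 5, E 6]"]]
    alt3_perm[OF a refl[of "\<alpha> [E 2, E 5, E 7]"]]
    alt3_perm[OF a refl[of "\<alpha> [E 2, E 6, E 7]"]]
    alt3_perm[OF a refl[of "\<alpha> [E 3, E 4, E 5]"]]
    alt3_perm[OF a refl[of "\<alpha> [E 3, E 4, E 6]"]]
    alt3_perm[OF a refl[of "\<alpha> [E 3, E 4, E 7]"]]
    alt3_perm[OF a refl[of "\<alpha> [E 3, E 5, E 6]"]]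
    alt3_perm[OF a refl[of "\<alpha> [E 3, E 5, E 7]"]]
    alt3_perm[OF a refl[of "\<alpha> [E 3, E 6, E 7]"]]
    alt3_perm[OF a refl[of "\<alpha> [E 4, E 5, E 6]"]]
    alt3_perm[OF a refl[of "\<alpha> [E 4, E 5, E 7]"]]
    alt3_perm[OF a refl[of "\<alpha> [E 4, E 6, E 7]"]]
    alt3_perm[OF a refl[of "\<alpha> [E 5, E 6, E 7]"]]
  have "\<forall>i. \<alpha> [E i, v, w] = ?R (E i)"
  proof -
    have e: "\<alpha> [E i, v, w] = contract (E i) \<alpha> [v, w]" for i
      by (simp add: contract_def)
    show ?thesis
      unfolding all_7 e alt2_expand[OF 2, where v = v and w = w] unfolding contract_def
      by (simp only: r minor3_def E_nth neq_7 of_bool_eq simp_thms mult_zero_left mult_zero_right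
          mult_1_left add_0_left add_0_right mult_minus_left minus_zero)
        (simp only: diff_conv_add_uminus distrib_left distrib_right minus_add_distrib mult_minus_left
          mult_minus_right minus_minus add_ac mult_ac simp_thms)
  qed
  moreover have "\<alpha> [u, v, w] = (\<Sum>i\<in>UNIV. u $ i * \<alpha> [E i, v, w])"
    by (rule linear_expand[OF alt_form_linear_hd[OF a]])
  moreover have "?R u = (\<Sum>i\<in>UNIV. u $ i * ?R (E i))"
    by (rule linear_expand) (intro linear_compose_add linear_minor3)
  ultimately show ?thesis
    by presburger
qed

section \<open>Normal form of a 3-form that splits along a 3-plane\<close>

lemma vector_7:
  fixes a :: "'a::zero"
  shows "(vector [a, b, c, d, e, f, g] :: 'a^7) $ 1 = a" "(vector [a, b, c, d, e, f, g] :: 'a^7) $ 2 = b"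
    "(vector [a, b, c, d, e, f, g] :: 'a^7) $ 3 = c" "(vector [a, b, c, d, e, f, g] :: 'a^7) $ 4 = d"
    "(vector [a, b, c, d, e, f, g] :: 'a^7) $ 5 = e" "(vector [a, b, c, d, e, f, g] :: 'a^7) $ 6 = f"
    "(vector [a, b, c, d, e, f, g] :: 'a^7) $ 7 = g"
  by (simp_all add: vector_def)

text \<open>Here \<phi> is e^123 plus the sum of p_ij e^i wedge \<omega>_j, with \<omega>_1 = e^45 +
  e^67, \<omega>_2 = e^46 - e^57, \<omega>_3 = -(e^47 + e^56) the 2-forms occurring in
  \<open>phi0\<close>. As \<open>p\<close> is a rotation, applying it to the first three basis
  vectors and fixing the other four brings \<phi> to \<open>phi0\<close>.\<close>

lemma adapted_of_split:
  fixes p :: "real^3^3"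
  assumes a: "alt_form 3 \<phi>" and orth: "p ** transpose p = mat 1" and det: "det p = 1"
    and v: "\<phi> [E 1, E 2, E 3] = 1" "\<phi> [E 1, E 2, E 4] = 0" "\<phi> [E 1, E 2, E 5] = 0"
      "\<phi> [E 1, E 2, E 6] = 0" "\<phi> [E 1, E 2, E 7] = 0" "\<phi> [E 1, E 3, E 4] = 0"
      "\<phi> [E 1, E 3, E 5] = 0" "\<phi> [E 1, E 3, E 6] = 0" "\<phi> [E 1, E 3, E 7] = 0"
      "\<phi> [E 1, E 4, E 5] = p $ 1 $ 1" "\<phi> [E 1, E 4, E 6] = p $ 1 $ 2" "\<phi> [E 1, E 4, E 7] = - p $ 1 $ 3"
      "\<phi> [E 1, E 5, E 6] = - p $ 1 $ 3" "\<phi> [E 1, E 5, E 7] = - p $ 1 $ 2" "\<phi> [E 1, E 6, E 7] = p $ 1 $ 1"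
      "\<phi> [E 2, E 3, E 4] = 0" "\<phi> [E 2, E 3, E 5] = 0" "\<phi> [E 2, E 3, E 6] = 0"
      "\<phi> [E 2, E 3, E 7] = 0" "\<phi> [E 2, E 4, E 5] = p $ 2 $ 1" "\<phi> [E 2, E 4, E 6] = p $ 2 $ 2"
      "\<phi> [E 2, E 4, E 7] = - p $ 2 $ 3" "\<phi> [E 2, E 5, E 6] = - p $ 2 $ 3" "\<phi> [E 2, E 5, E 7] = - p $
          2 $ 2"
      "\<phi> [E 2, E 6, E 7] = p $ 2 $ 1" "\<phi> [E 3, E 4, E 5] = p $ 3 $ 1" "\<phi> [E 3, E 4, E 6] = p $ 3 $ 2"
      "\<phi> [E 3, E 4, E 7] = - p $ 3 $ 3" "\<phi> [E 3, E 5, E 6] = - p $ 3 $ 3" "\<phi> [E 3, E 5, E 7] = - p $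
          3 $ 2"
      "\<phi> [E 3, E 6, E 7] = p $ 3 $ 1" "\<phi> [E 4, E 5, E 6] = 0" "\<phi> [E 4, E 5, E 7] = 0"
      "\<phi> [E 4, E 6, E 7] = 0" "\<phi> [E 5, E 6, E 7] = 0"
  shows "\<exists>R. adapted \<phi> R"
proof -
  let ?R = "vector [vector [p $ 1 $ 1, p $ 1 $ 2, p $ 1 $ 3, 0, 0, 0, 0],
      vector [p $ 2 $ 1, p $ 2 $ 2, p $ 2 $ 3, 0, 0, 0, 0],
      vector [p $ 3 $ 1, p $ 3 $ 2, p $ 3 $ 3, 0, 0, 0, 0],
      E 4, E 5, E 6, E 7] :: real^7^7"
  let ?\<psi> = "pullback ?R \<phi>"
  have "transpose p ** p = mat 1"
    using orth by (simp add: matrix_left_right_inverse)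
  then have o: "p $ 1 $ k * p $ 1 $ l + p $ 2 $ k * p $ 2 $ l + p $ 3 $ k * p $ 3 $ l = of_bool (k =
      l)" for k l
  proof -
    have "(transpose p ** p) $ k $ l = (mat 1 :: real^3^3) $ k $ l"
      by (simp only: \<open>transpose p ** p = mat 1\<close>)
    then show ?thesis
      by (simp add: matrix_matrix_mult_def transpose_def sum_3 mat_def)
  qed
  have e: "(?R *v E k) $ j = ?R $ j $ k" for j k
    by (simp add: matrix_vector_mult_basis column_def)
  have c: "(?R *v E 1) $ 1 = p $ 1 $ 1" "(?R *v E 2) $ 1 = p $ 1 $ 2" "(?R *v E 3) $ 1 = p $ 1 $ 3"
      "(?R *v E 4) $ 1 = 0" "(?R *v E 5) $ 1 = 0" "(?R *v E 6) $ 1 = 0" "(?R *v E 7) $ 1 = 0"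
    "(?R *v E 1) $ 2 = p $ 2 $ 1" "(?R *v E 2) $ 2 = p $ 2 $ 2" "(?R *v E 3) $ 2 = p $ 2 $ 3" "(?R
        *v E 4) $ 2 = 0" "(?R *v E 5) $ 2 = 0" "(?R *v E 6) $ 2 = 0" "(?R *v E 7) $ 2 = 0"
    "(?R *v E 1) $ 3 = p $ 3 $ 1" "(?R *v E 2) $ 3 = p $ 3 $ 2" "(?R *v E 3) $ 3 = p $ 3 $ 3" "(?R
        *v E 4) $ 3 = 0" "(?R *v E 5) $ 3 = 0" "(?R *v E 6) $ 3 = 0" "(?R *v E 7) $ 3 = 0"
    "(?R *v E 1) $ 4 = 0" "(?R *v E 2) $ 4 = 0" "(?R *v E 3) $ 4 = 0" "(?R *v E 4) $ 4 = 1" "(?R *v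
        E 5) $ 4 = 0" "(?R *v E 6) $ 4 = 0" "(?R *v E 7) $ 4 = 0"
    "(?R *v E 1) $ 5 = 0" "(?R *v E 2) $ 5 = 0" "(?R *v E 3) $ 5 = 0" "(?R *v E 4) $ 5 = 0" "(?R *v
        E 5) $ 5 = 1" "(?R *v E 6) $ 5 = 0" "(?R *v E 7) $ 5 = 0"
    "(?R *v E 1) $ 6 = 0" "(?R *v E 2) $ 6 = 0" "(?R *v E 3) $ 6 = 0" "(?R *v E 4) $ 6 = 0" "(?R *v
        E 5) $ 6 = 0" "(?R *v E 6) $ 6 = 1" "(?R *v E 7) $ 6 = 0"
    "(?R *v E 1) $ 7 = 0" "(?R *v E 2) $ 7 = 0" "(?R *v E 3) $ 7 = 0" "(?R *v E 4) $ 7 = 0" "(?R *v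
        E 5) $ 7 = 0" "(?R *v E 6) $ 7 = 0" "(?R *v E 7) $ 7 = 1"
    unfolding e by (simp_all only: vector_7 E_nth neq_7 of_bool_eq simp_thms)
  have a': "alt_form 3 ?\<psi>"
    using a by (rule alt_form_pullback)
  have r: "?\<psi> [E 1, E 2, E 3] = 1" "?\<psi> [E 1, E 2, E 4] = 0" "?\<psi> [E 1, E 2, E 5] = 0" "?\<psi>
      [E 1, E 2, E 6] = 0"
      "?\<psi> [E 1, E 2, E 7] = 0" "?\<psi> [E 1, E 3, E 4] = 0" "?\<psi> [E 1, E 3, E 5] = 0" "?\<psi> [E 1, E 3, E 6] = 0"
      "?\<psi> [E 1, E 3, E 7] = 0" "?\<psi> [E 1, E 4, E 5] = 1" "?\<psi> [E 1, E 4, E 6] = 0" "?\<psi> [E 1, E 4, E 7] = 0"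
      "?\<psi> [E 1, E 5, E 6] = 0" "?\<psi> [E 1, E 5, E 7] = 0" "?\<psi> [E 1, E 6, E 7] = 1" "?\<psi> [E 2, E 3, E 4] = 0"
      "?\<psi> [E 2, E 3, E 5] = 0" "?\<psi> [E 2, E 3, E 6] = 0" "?\<psi> [E 2, E 3, E 7] = 0" "?\<psi> [E 2, E 4, E 5] = 0"
      "?\<psi> [E 2, E 4, E 6] = 1" "?\<psi> [E 2, E 4, E 7] = 0" "?\<psi> [E 2, E 5, E 6] = 0" "?\<psi> [E 2, E 5, E 7]
          = - 1"
      "?\<psi> [E 2, E 6, E 7] = 0" "?\<psi> [E 3, E 4, E 5] = 0" "?\<psi> [E 3, E 4, E 6] = 0" "?\<psi> [E 3, E 4, E 7]
          = - 1"
      "?\<psi> [E 3, E 5, E 6] = - 1" "?\<psi> [E 3, E 5, E 7] = 0" "?\<psi> [E 3, E 6, E 7] = 0" "?\<psi>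
          [E 4, E 5, E 6] = 0"
      "?\<psi> [E 4, E 5, E 7] = 0" "?\<psi> [E 4, E 6, E 7] = 0" "?\<psi> [E 5, E 6, E 7] = 0"
    unfolding pullback_def list.map alt3_expand[OF a, of "?R *v x" "?R *v y" "?R *v z" for x y z]
    by (simp_all only: v minor3_def c mult_zero_left mult_zero_right mult_1_left mult_1_right add_0_left
        add_0_right diff_0_right diff_0 minus_zero mult_minus_left mult_minus_right)
      (use det o[of 1 1] o[of 1 2] o[of 1 3] o[of 2 2] o[of 2 3] o[of 3 3] in
        \<open>simp_all add: det_3 algebra_simps\<close>)
  have "?\<psi> [u, v, w] = phi0 u v w" for u v w
    using alt3_expand[OF a', of u v w] unfolding r phi0_def by simp
  then have "adapted \<phi> ?R"
    using a by (simp add: adapted_def pullback_def)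
  then show ?thesis ..
qed

text \<open>The assumptions remove the coefficients with exactly two indices in {1,2,3}. On {1,2,3}
  the bilinear form is then \<open>f123\<close> times the wedge pairing of the 2-forms
  \<open>\<iota>_i \<phi>\<close> on the 4-plane; on {4,5,6,7} it is trilinear in these three
  2-forms. Of the mixed entries, those with first index 1 suffice to control \<open>f456\<close>,
  ..., \<open>f567\<close>.\<close>

lemma cubic_form_split:
  assumes a: "alt_form 3 \<phi>"
    and v: "\<phi> [E 1, E 2, E 3] = f123" "\<phi> [E 1, E 2, E 4] = 0" "\<phi> [E 1, E 2, E 5] = 0"
      "\<phi> [E 1, E 2, E 6] = 0" "\<phi> [E 1, E 2, E 7] = 0" "\<phi> [E 1, E 3, E 4] = 0"
      "\<phi> [E 1, E 3, E 5] = 0" "\<phi> [E 1, E 3, E 6] = 0" "\<phi> [E 1, E 3, E 7] = 0"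
      "\<phi> [E 1, E 4, E 5] = f145" "\<phi> [E 1, E 4, E 6] = f146" "\<phi> [E 1, E 4, E 7] = f147"
      "\<phi> [E 1, E 5, E 6] = f156" "\<phi> [E 1, E 5, E 7] = f157" "\<phi> [E 1, E 6, E 7] = f167"
      "\<phi> [E 2, E 3, E 4] = 0" "\<phi> [E 2, E 3, E 5] = 0" "\<phi> [E 2, E 3, E 6] = 0"
      "\<phi> [E 2, E 3, E 7] = 0" "\<phi> [E 2, E 4, E 5] = f245" "\<phi> [E 2, E 4, E 6] = f246"
      "\<phi> [E 2, E 4, E 7] = f247" "\<phi> [E 2, E 5, E 6] = f256" "\<phi> [E 2, E 5, E 7] = f257"
      "\<phi> [E 2, E 6, E 7] = f267" "\<phi> [E 3, E 4, E 5] = f345" "\<phi> [E 3, E 4, E 6] = f346"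
      "\<phi> [E 3, E 4, E 7] = f347" "\<phi> [E 3, E 5, E 6] = f356" "\<phi> [E 3, E 5, E 7] = f357"
      "\<phi> [E 3, E 6, E 7] = f367" "\<phi> [E 4, E 5, E 6] = f456" "\<phi> [E 4, E 5, E 7] = f457"
      "\<phi> [E 4, E 6, E 7] = f467" "\<phi> [E 5, E 6, E 7] = f567"
  shows "cubic_form \<phi> (E 1) (E 1) (map E idx7) = 6 * f123 * f145 * f167 - 6 * f123 * f146 * f157 + 6
      * f123 * f147 * f156"
    "cubic_form \<phi> (E 1) (E 2) (map E idx7) = 3 * f123 * f145 * f267 - 3 * f123 * f146 * f257 + 3 *
        f123 * f147 * f256 + 3 * f123 * f156 * f247 - 3 * f123 * f157 * f246
       + 3 * f123 * f167 * f245"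
    "cubic_form \<phi> (E 1) (E 3) (map E idx7) = 3 * f123 * f145 * f367 - 3 * f123 * f146 * f357 + 3 *
        f123 * f147 * f356 + 3 * f123 * f156 * f347 - 3 * f123 * f157 * f346
       + 3 * f123 * f167 * f345"
    "cubic_form \<phi> (E 1) (E 4) (map E idx7) = 3 * f123 * f145 * f467 - 3 * f123 * f146 * f457 + 3 *
        f123 * f147 * f456"
    "cubic_form \<phi> (E 1) (E 5) (map E idx7) = 3 * f123 * f145 * f567 - 3 * f123 * f156 * f457 + 3 *
        f123 * f157 * f456"
    "cubic_form \<phi> (E 1) (E 6) (map E idx7) = 3 * f123 * f146 * f567 - 3 * f123 * f156 * f467 + 3 *
        f123 * f167 * f456"
    "cubic_form \<phi> (E 1) (E 7) (map E idx7) = 3 * f123 * f147 * f567 - 3 * f123 * f157 * f467 + 3 *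
        f123 * f167 * f457"
    "cubic_form \<phi> (E 2) (E 2) (map E idx7) = 6 * f123 * f245 * f267 - 6 * f123 * f246 * f257 + 6 *
        f123 * f247 * f256"
    "cubic_form \<phi> (E 2) (E 3) (map E idx7) = 3 * f123 * f245 * f367 - 3 * f123 * f246 * f357 + 3 *
        f123 * f247 * f356 + 3 * f123 * f256 * f347 - 3 * f123 * f257 * f346
       + 3 * f123 * f267 * f345"
    "cubic_form \<phi> (E 3) (E 3) (map E idx7) = 6 * f123 * f345 * f367 - 6 * f123 * f346 * f357 + 6 *
        f123 * f347 * f356"
    "cubic_form \<phi> (E 4) (E 4) (map E idx7) = - 6 * f145 * f246 * f347 + 6 * f145 * f247 * f346 + 6 *
        f146 * f245 * f347 - 6 * f146 * f247 * f345 - 6 * f147 * f245 * f346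
       + 6 * f147 * f246 * f345"
    "cubic_form \<phi> (E 4) (E 5) (map E idx7) = - 3 * f145 * f246 * f357 + 3 * f145 * f247 * f356 - 3 *
        f145 * f256 * f347 + 3 * f145 * f257 * f346 + 3 * f146 * f245 * f357
       - 3 * f146 * f257 * f345 - 3 * f147 * f245 * f356 + 3 * f147 * f256 * f345 + 3 * f156 * f245
           * f347 - 3 * f156 * f247 * f345
       - 3 * f157 * f245 * f346 + 3 * f157 * f246 * f345"
    "cubic_form \<phi> (E 4) (E 6) (map E idx7) = - 3 * f145 * f246 * f367 + 3 * f145 * f267 * f346 + 3 *
        f146 * f245 * f367 + 3 * f146 * f247 * f356 - 3 * f146 * f256 * f347
       - 3 * f146 * f267 * f345 - 3 * f147 * f246 * f356 + 3 * f147 * f256 * f346 + 3 * f156 * f246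
           * f347 - 3 * f156 * f247 * f346
       - 3 * f167 * f245 * f346 + 3 * f167 * f246 * f345"
    "cubic_form \<phi> (E 4) (E 7) (map E idx7) = - 3 * f145 * f247 * f367 + 3 * f145 * f267 * f347 + 3 *
        f146 * f247 * f357 - 3 * f146 * f257 * f347 + 3 * f147 * f245 * f367
       - 3 * f147 * f246 * f357 + 3 * f147 * f257 * f346 - 3 * f147 * f267 * f345 + 3 * f157 * f246
           * f347 - 3 * f157 * f247 * f346
       - 3 * f167 * f245 * f347 + 3 * f167 * f247 * f345"
    "cubic_form \<phi> (E 5) (E 5) (map E idx7) = - 6 * f145 * f256 * f357 + 6 * f145 * f257 * f356 + 6 *
        f156 * f245 * f357 - 6 * f156 * f257 * f345 - 6 * f157 * f245 * f356
       + 6 * f157 * f256 * f345"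
    "cubic_form \<phi> (E 5) (E 6) (map E idx7) = - 3 * f145 * f256 * f367 + 3 * f145 * f267 * f356 - 3 *
        f146 * f256 * f357 + 3 * f146 * f257 * f356 + 3 * f156 * f245 * f367
       + 3 * f156 * f246 * f357 - 3 * f156 * f257 * f346 - 3 * f156 * f267 * f345 - 3 * f157 * f246
           * f356 + 3 * f157 * f256 * f346
       - 3 * f167 * f245 * f356 + 3 * f167 * f256 * f345"
    "cubic_form \<phi> (E 5) (E 7) (map E idx7) = - 3 * f145 * f257 * f367 + 3 * f145 * f267 * f357 - 3 *
        f147 * f256 * f357 + 3 * f147 * f257 * f356 + 3 * f156 * f247 * f357
       - 3 * f156 * f257 * f347 + 3 * f157 * f245 * f367 - 3 * f157 * f247 * f356 + 3 * f157 * f256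
           * f347 - 3 * f157 * f267 * f345
       - 3 * f167 * f245 * f357 + 3 * f167 * f257 * f345"
    "cubic_form \<phi> (E 6) (E 6) (map E idx7) = - 6 * f146 * f256 * f367 + 6 * f146 * f267 * f356 + 6 *
        f156 * f246 * f367 - 6 * f156 * f267 * f346 - 6 * f167 * f246 * f356
       + 6 * f167 * f256 * f346"
    "cubic_form \<phi> (E 6) (E 7) (map E idx7) = - 3 * f146 * f257 * f367 + 3 * f146 * f267 * f357 - 3 *
        f147 * f256 * f367 + 3 * f147 * f267 * f356 + 3 * f156 * f247 * f367
       - 3 * f156 * f267 * f347 + 3 * f157 * f246 * f367 - 3 * f157 * f267 * f346 - 3 * f167 * f246
           * f357 - 3 * f167 * f247 * f356
       + 3 * f167 * f256 * f347 + 3 * f167 * f257 * f346"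
    "cubic_form \<phi> (E 7) (E 7) (map E idx7) = - 6 * f147 * f257 * f367 + 6 * f147 * f267 * f357 + 6 *
        f157 * f247 * f367 - 6 * f157 * f267 * f347 - 6 * f167 * f247 * f357
       + 6 * f167 * f257 * f347"
  unfolding map_idx7 cubic_form_expand[OF a] Let_def
  by (simp_all only: contract_contract_expand[OF a] alt3_repeat[OF a] v
      alt3_perm[OF a v(1)] alt3_perm[OF a v(2)] alt3_perm[OF a v(3)] alt3_perm[OF a v(4)]
          alt3_perm[OF a v(5)] alt3_perm[OF a v(6)] alt3_perm[OF a v(7)] alt3_perm[OF a v(8)]
          alt3_perm[OF a v(9)] alt3_perm[OF a v(10)] alt3_perm[OF a v(11)] alt3_perm[OF a v(12)]
          alt3_perm[OF a v(13)] alt3_perm[OF a v(14)] alt3_perm[OF a v(15)] alt3_perm[OF a v(16)]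
          alt3_perm[OF a v(17)] alt3_perm[OF a v(18)] alt3_perm[OF a v(19)] alt3_perm[OF a v(20)]
          alt3_perm[OF a v(21)] alt3_perm[OF a v(22)] alt3_perm[OF a v(23)] alt3_perm[OF a v(24)]
          alt3_perm[OF a v(25)] alt3_perm[OF a v(26)] alt3_perm[OF a v(27)] alt3_perm[OF a v(28)]
          alt3_perm[OF a v(29)] alt3_perm[OF a v(30)] alt3_perm[OF a v(31)] alt3_perm[OF a v(32)]
          alt3_perm[OF a v(33)] alt3_perm[OF a v(34)] alt3_perm[OF a v(35)]
      mult_zero_left mult_zero_right minus_zero diff_0 diff_0_right add_0_left add_0_right
      mult_minus_left mult_minus_right)
    (simp_all add: algebra_simps)


text \<open>
  On the orthogonal complement of the calibrated 3-plane, the matrices \<open>p\<close> and \<open>n\<close> collect the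
  self-dual and anti-self-dual parts of the 2-forms \<open>\<iota>\<^sub>1\<phi>, \<iota>\<^sub>2\<phi>, \<iota>\<^sub>3\<phi>\<close>.
\<close>

lemma adapted_of_orthonormal_split:
  assumes a: "alt_form 3 \<phi>"
    and z: "\<phi> [E 1, E 2, E 4] = 0" "\<phi> [E 1, E 2, E 5] = 0" "\<phi> [E 1, E 2, E 6] = 0"
      "\<phi> [E 1, E 2, E 7] = 0" "\<phi> [E 1, E 3, E 4] = 0" "\<phi> [E 1, E 3, E 5] = 0"
      "\<phi> [E 1, E 3, E 6] = 0" "\<phi> [E 1, E 3, E 7] = 0" "\<phi> [E 2, E 3, E 4] = 0"
      "\<phi> [E 2, E 3, E 5] = 0" "\<phi> [E 2, E 3, E 6] = 0" "\<phi> [E 2, E 3, E 7] = 0"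
    and pos: "\<phi> [E 1, E 2, E 3] > 0"
    and cubic: "\<And>i j. cubic_form \<phi> (E i) (E j) (map E idx7) = 6 * of_bool (i = j)"
  shows "\<exists>R. adapted \<phi> R"
proof -
  define f123 where "f123 = \<phi> [E 1, E 2, E 3]"
  define f145 where "f145 = \<phi> [E 1, E 4, E 5]"
  define f146 where "f146 = \<phi> [E 1, E 4, E 6]"
  define f147 where "f147 = \<phi> [E 1, E 4, E 7]"
  define f156 where "f156 = \<phi> [E 1, E 5, E 6]"
  define f157 where "f157 = \<phi> [E 1, E 5, E 7]"
  define f167 where "f167 = \<phi> [E 1, E 6, E 7]"
  define f245 where "f245 = \<phi> [E 2, E 4, E 5]"
  define f246 where "f246 = \<phi> [E 2, E 4, E 6]"
  define f247 where "f247 = \<phi> [E 2, E 4, E 7]"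
  define f256 where "f256 = \<phi> [E 2, E 5, E 6]"
  define f257 where "f257 = \<phi> [E 2, E 5, E 7]"
  define f267 where "f267 = \<phi> [E 2, E 6, E 7]"
  define f345 where "f345 = \<phi> [E 3, E 4, E 5]"
  define f346 where "f346 = \<phi> [E 3, E 4, E 6]"
  define f347 where "f347 = \<phi> [E 3, E 4, E 7]"
  define f356 where "f356 = \<phi> [E 3, E 5, E 6]"
  define f357 where "f357 = \<phi> [E 3, E 5, E 7]"
  define f367 where "f367 = \<phi> [E 3, E 6, E 7]"
  define f456 where "f456 = \<phi> [E 4, E 5, E 6]"
  define f457 where "f457 = \<phi> [E 4, E 5, E 7]"
  define f467 where "f467 = \<phi> [E 4, E 6, E 7]"
  define f567 where "f567 = \<phi> [E 5, E 6, E 7]"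
  note e = cubic_form_split[OF a f123_def[symmetric] z(1) z(2) z(3) z(4) z(5) z(6) z(7) z(8)
      f145_def[symmetric] f146_def[symmetric] f147_def[symmetric] f156_def[symmetric]
      f157_def[symmetric] f167_def[symmetric] z(9) z(10) z(11) z(12) f245_def[symmetric]
      f246_def[symmetric] f247_def[symmetric] f256_def[symmetric] f257_def[symmetric]
      f267_def[symmetric] f345_def[symmetric] f346_def[symmetric] f347_def[symmetric]
      f356_def[symmetric] f357_def[symmetric] f367_def[symmetric] f456_def[symmetric]
      f457_def[symmetric] f467_def[symmetric] f567_def[symmetric], unfolded cubic neq_7 of_bool_eq
      simp_thms]
  have m: "f123 > 0"
    using pos by (simp only: f123_def)
  \<comment> \<open>Coordinates of the three 2-forms on the 4-plane: row i of \<open>p\<close>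
    refers to the self-dual basis e^45 + e^67, e^46 - e^57, -(e^47 + e^56), row i of
    \<open>n\<close> to the anti-self-dual basis e^45 - e^67, e^46 + e^57, e^56 - e^47.\<close>
  define p11 where "p11 = (f145 + f167) / 2"
  define n11 where "n11 = (f145 - f167) / 2"
  define p12 where "p12 = (f146 - f157) / 2"
  define n12 where "n12 = (f146 + f157) / 2"
  define p13 where "p13 = - ((f147 + f156) / 2)"
  define n13 where "n13 = (f156 - f147) / 2"
  define p21 where "p21 = (f245 + f267) / 2"
  define n21 where "n21 = (f245 - f267) / 2"
  define p22 where "p22 = (f246 - f257) / 2"
  define n22 where "n22 = (f246 + f257) / 2"
  define p23 where "p23 = - ((f247 + f256) / 2)"
  define n23 where "n23 = (f256 - f247) / 2"
  define p31 where "p31 = (f345 + f367) / 2"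
  define n31 where "n31 = (f345 - f367) / 2"
  define p32 where "p32 = (f346 - f357) / 2"
  define n32 where "n32 = (f346 + f357) / 2"
  define p33 where "p33 = - ((f347 + f356) / 2)"
  define n33 where "n33 = (f356 - f347) / 2"
  have f: "f145 = p11 + n11" "f167 = p11 - n11"
      "f146 = p12 + n12" "f157 = n12 - p12"
      "f147 = - p13 - n13" "f156 = n13 - p13"
      "f245 = p21 + n21" "f267 = p21 - n21"
      "f246 = p22 + n22" "f257 = n22 - p22"
      "f247 = - p23 - n23" "f256 = n23 - p23"
      "f345 = p31 + n31" "f367 = p31 - n31"
      "f346 = p32 + n32" "f357 = n32 - p32"
      "f347 = - p33 - n33" "f356 = n33 - p33"
    unfolding p11_def p12_def p13_def p21_def p22_def p23_def p31_def p32_def p33_def n11_def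
        n12_def n13_def n21_def n22_def n23_def n31_def n32_def n33_def
    by (simp_all add: field_simps)
  \<comment> \<open>The wedge pairing of 2-forms on a 4-plane has signature (3,3), positive on
    self-dual and negative on anti-self-dual forms. So the block {1,2,3} of the metric becomes the
    hypothesis on \<open>p ** transpose p - n ** transpose n\<close>.\<close>
  have "f123 * (p11 * p11 + p12 * p12 + p13 * p13 - (n11 * n11 + n12 * n12 + n13 * n13)) = 1"
    using e(1) unfolding f by (simp add: algebra_simps)
  then have a11: "p11 * p11 + p12 * p12 + p13 * p13 - (n11 * n11 + n12 * n12 + n13 * n13) = 1 / f123"
    using m by (simp add: eq_divide_eq mult.commute)
  have "f123 * (p11 * p21 + p12 * p22 + p13 * p23 - (n11 * n21 + n12 * n22 + n13 * n23)) = 0"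
    using e(2) unfolding f by (simp add: algebra_simps)
  then have a12: "p11 * p21 + p12 * p22 + p13 * p23 - (n11 * n21 + n12 * n22 + n13 * n23) = 0"
    using m by (simp add: mult_eq_0_iff)
  have "f123 * (p11 * p31 + p12 * p32 + p13 * p33 - (n11 * n31 + n12 * n32 + n13 * n33)) = 0"
    using e(3) unfolding f by (simp add: algebra_simps)
  then have a13: "p11 * p31 + p12 * p32 + p13 * p33 - (n11 * n31 + n12 * n32 + n13 * n33) = 0"
    using m by (simp add: mult_eq_0_iff)
  have "f123 * (p21 * p21 + p22 * p22 + p23 * p23 - (n21 * n21 + n22 * n22 + n23 * n23)) = 1"
    using e(8) unfolding f by (simp add: algebra_simps)
  then have a22: "p21 * p21 + p22 * p22 + p23 * p23 - (n21 * n21 + n22 * n22 + n23 * n23) = 1 / f123"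
    using m by (simp add: eq_divide_eq mult.commute)
  have "f123 * (p21 * p31 + p22 * p32 + p23 * p33 - (n21 * n31 + n22 * n32 + n23 * n33)) = 0"
    using e(9) unfolding f by (simp add: algebra_simps)
  then have a23: "p21 * p31 + p22 * p32 + p23 * p33 - (n21 * n31 + n22 * n32 + n23 * n33) = 0"
    using m by (simp add: mult_eq_0_iff)
  have "f123 * (p31 * p31 + p32 * p32 + p33 * p33 - (n31 * n31 + n32 * n32 + n33 * n33)) = 1"
    using e(10) unfolding f by (simp add: algebra_simps)
  then have a33: "p31 * p31 + p32 * p32 + p33 * p33 - (n31 * n31 + n32 * n32 + n33 * n33) = 1 / f123"
    using m by (simp add: eq_divide_eq mult.commute)
  let ?e44 = "- 6 * f145 * f246 * f347 + 6 * f145 * f247 * f346 + 6 * f146 * f245 * f347 - 6 * f146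
      * f247 * f345 - 6 * f147 * f245 * f346
       + 6 * f147 * f246 * f345" and ?e55 = "- 6 * f145 * f256 * f357 + 6 * f145 * f257 * f356 + 6 *
           f156 * f245 * f357 - 6 * f156 * f257 * f345 - 6 * f157 * f245 * f356
       + 6 * f157 * f256 * f345"
    and ?e66 = "- 6 * f146 * f256 * f367 + 6 * f146 * f267 * f356 + 6 * f156 * f246 * f367 - 6 *
        f156 * f267 * f346 - 6 * f167 * f246 * f356
       + 6 * f167 * f256 * f346" and ?e77 = "- 6 * f147 * f257 * f367 + 6 * f147 * f267 * f357 + 6 *
           f157 * f247 * f367 - 6 * f157 * f267 * f347 - 6 * f167 * f247 * f357
       + 6 * f167 * f257 * f347"
  \<comment> \<open>The trace of the block {4,5,6,7}: four diagonal entries, each equal to 6,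
    account for the 24.\<close>
  have d: "p11 * (p22 * p33 - p23 * p32) + p12 * (p23 * p31 - p21 * p33) + p13 * (p21 * p32 - p22 *
      p31) + (n11 * (n22 * n33 - n23 * n32) + n12 * (n23 * n31 - n21 * n33) + n13 * (n21 * n32 - n22
      * n31)) = 1"
  proof -
    have "24 * (p11 * (p22 * p33 - p23 * p32) + p12 * (p23 * p31 - p21 * p33) + p13 * (p21 * p32 -
        p22 * p31) + (n11 * (n22 * n33 - n23 * n32) + n12 * (n23 * n31 - n21 * n33) + n13 * (n21 *
        n32 - n22 * n31))) =
      ?e44 + ?e55 + ?e66 + ?e77"
      unfolding f by (simp only: diff_conv_add_uminus distrib_left distrib_right minus_add_distrib
          mult_minus_left mult_minus_right minus_minus add_ac mult_ac; simp?)
    then show ?thesis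
      unfolding e(11)[symmetric] e(15)[symmetric] e(18)[symmetric] e(20)[symmetric] by simp
  qed
  \<comment> \<open>The nine trace-free symmetric components of the block {4,5,6,7} correspond to
    the nine entries of a 3-by-3 matrix, by the isomorphism of trace-free symmetric tensors in
    dimension four with self-dual tensor anti-self-dual forms. The diagonal components need sign
    combinations of the four diagonal entries; the others come from pairs of off-diagonal
    entries.\<close>
  have x11: "n11 * (p22 * p33 - p23 * p32) + (n22 * n33 - n23 * n32) * p11
      + n21 * (p32 * p13 - p33 * p12) + (n32 * n13 - n33 * n12) * p21
      + n31 * (p12 * p23 - p13 * p22) + (n12 * n23 - n13 * n22) * p31 = 0"
  proof -
    have "24 * (n11 * (p22 * p33 - p23 * p32) + (n22 * n33 - n23 * n32) * p11
      + n21 * (p32 * p13 - p33 * p12) + (n32 * n13 - n33 * n12) * p21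
      + n31 * (p12 * p23 - p13 * p22) + (n12 * n23 - n13 * n22) * p31) =
      ?e44 + ?e55 - ?e66 - ?e77"
      unfolding f by (simp only: diff_conv_add_uminus distrib_left distrib_right minus_add_distrib
          mult_minus_left mult_minus_right minus_minus add_ac mult_ac; simp?)
    then show ?thesis
      unfolding e(11)[symmetric] e(15)[symmetric] e(18)[symmetric] e(20)[symmetric] by simp
  qed
  have x12: "n11 * (p23 * p31 - p21 * p33) + (n22 * n33 - n23 * n32) * p12
      + n21 * (p33 * p11 - p31 * p13) + (n32 * n13 - n33 * n12) * p22
      + n31 * (p13 * p21 - p11 * p23) + (n12 * n23 - n13 * n22) * p32 = 0"
    using e(14) e(16) unfolding f by (simp add: algebra_simps)
  have x13: "n11 * (p21 * p32 - p22 * p31) + (n22 * n33 - n23 * n32) * p13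
      + n21 * (p31 * p12 - p32 * p11) + (n32 * n13 - n33 * n12) * p23
      + n31 * (p11 * p22 - p12 * p21) + (n12 * n23 - n13 * n22) * p33 = 0"
    using e(13) e(17) unfolding f by (simp add: algebra_simps)
  have x21: "n12 * (p22 * p33 - p23 * p32) + (n23 * n31 - n21 * n33) * p11
      + n22 * (p32 * p13 - p33 * p12) + (n33 * n11 - n31 * n13) * p21
      + n32 * (p12 * p23 - p13 * p22) + (n13 * n21 - n11 * n23) * p31 = 0"
    using e(14) e(16) unfolding f by (simp add: algebra_simps)
  have x22: "n12 * (p23 * p31 - p21 * p33) + (n23 * n31 - n21 * n33) * p12
      + n22 * (p33 * p11 - p31 * p13) + (n33 * n11 - n31 * n13) * p22
      + n32 * (p13 * p21 - p11 * p23) + (n13 * n21 - n11 * n23) * p32 = 0"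
  proof -
    have "24 * (n12 * (p23 * p31 - p21 * p33) + (n23 * n31 - n21 * n33) * p12
      + n22 * (p33 * p11 - p31 * p13) + (n33 * n11 - n31 * n13) * p22
      + n32 * (p13 * p21 - p11 * p23) + (n13 * n21 - n11 * n23) * p32) =
      ?e44 - ?e55 + ?e66 - ?e77"
      unfolding f by (simp only: diff_conv_add_uminus distrib_left distrib_right minus_add_distrib
          mult_minus_left mult_minus_right minus_minus add_ac mult_ac; simp?)
    then show ?thesis
      unfolding e(11)[symmetric] e(15)[symmetric] e(18)[symmetric] e(20)[symmetric] by simp
  qed
  have x23: "n12 * (p21 * p32 - p22 * p31) + (n23 * n31 - n21 * n33) * p13
      + n22 * (p31 * p12 - p32 * p11) + (n33 * n11 - n31 * n13) * p23
      + n32 * (p11 * p22 - p12 * p21) + (n13 * n21 - n11 * n23) * p33 = 0"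
    using e(12) e(19) unfolding f by (simp add: algebra_simps)
  have x31: "n13 * (p22 * p33 - p23 * p32) + (n21 * n32 - n22 * n31) * p11
      + n23 * (p32 * p13 - p33 * p12) + (n31 * n12 - n32 * n11) * p21
      + n33 * (p12 * p23 - p13 * p22) + (n11 * n22 - n12 * n21) * p31 = 0"
    using e(13) e(17) unfolding f by (simp add: algebra_simps)
  have x32: "n13 * (p23 * p31 - p21 * p33) + (n21 * n32 - n22 * n31) * p12
      + n23 * (p33 * p11 - p31 * p13) + (n31 * n12 - n32 * n11) * p22
      + n33 * (p13 * p21 - p11 * p23) + (n11 * n22 - n12 * n21) * p32 = 0"
    using e(12) e(19) unfolding f by (simp add: algebra_simps)
  have x33: "n13 * (p21 * p32 - p22 * p31) + (n21 * n32 - n22 * n31) * p13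
      + n23 * (p31 * p12 - p32 * p11) + (n31 * n12 - n32 * n11) * p23
      + n33 * (p11 * p22 - p12 * p21) + (n11 * n22 - n12 * n21) * p33 = 0"
  proof -
    have "24 * (n13 * (p21 * p32 - p22 * p31) + (n21 * n32 - n22 * n31) * p13
      + n23 * (p31 * p12 - p32 * p11) + (n31 * n12 - n32 * n11) * p23
      + n33 * (p11 * p22 - p12 * p21) + (n11 * n22 - n12 * n21) * p33) =
      ?e44 - ?e55 - ?e66 + ?e77"
      unfolding f by (simp only: diff_conv_add_uminus distrib_left distrib_right minus_add_distrib
          mult_minus_left mult_minus_right minus_minus add_ac mult_ac; simp?)
    then show ?thesis
      unfolding e(11)[symmetric] e(15)[symmetric] e(18)[symmetric] e(20)[symmetric] by simp
  qed
  let ?p = "vector [vector [p11, p12, p13], vector [p21, p22, p23], vector [p31, p32, p33]] :: real^3^3"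
  let ?n = "vector [vector [n11, n12, n13], vector [n21, n22, n23], vector [n31, n32, n33]] :: real^3^3"
  have c: "1 / f123 > 0"
    using m by simp
  have A: "?p ** transpose ?p - ?n ** transpose ?n = (1 / f123) *\<^sub>R mat 1"
    unfolding vec_eq_iff forall_3
    using a11 a12 a13 a22 a23 a33
    by (simp add: matrix_matrix_mult_def transpose_def sum_3 mat_def mult.commute)
  have D: "det ?p + det ?n = 1"
    using d by (simp add: det_3 algebra_simps)
  have X: "transpose ?n ** cof3 ?p + transpose (cof3 ?n) ** ?p = 0"
    unfolding vec_eq_iff forall_3
    using x11 x12 x13 x21 x22 x23 x31 x32 x33
    by (simp add: matrix_matrix_mult_def transpose_def sum_3 cof3_nth cross3_nth algebra_simps)
  note rig = matrix_rigidity[OF c A D X]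
  have m1: "f123 = 1"
    using rig(2) m by simp
  have n0: "n11 = 0" "n12 = 0" "n13 = 0" "n21 = 0" "n22 = 0" "n23 = 0" "n31 = 0" "n32 = 0" "n33 = 0"
    using rig(1) unfolding vec_eq_iff forall_3 by simp_all
  \<comment> \<open>The mixed metric entries form a skew linear system for the four remaining
    coefficients. Its Pfaffian is the (1,1) entry of the metric, which is 1, so the system has only
    the zero solution.\<close>
  have z0: "f145 * f467 - f146 * f457 + f147 * f456 = 0" "f145 * f567 - f156 * f457 + f157 * f456 = 0"
    "f146 * f567 - f156 * f467 + f167 * f456 = 0" "f147 * f567 - f157 * f467 + f167 * f457 = 0"
    using e(4,5,6,7) by (simp_all add: m1)
  have q: "f145 * f167 - f146 * f157 + f147 * f156 = 1"
    using e(1) by (simp add: m1)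
  have "f456 * (f145 * f167 - f146 * f157 + f147 * f156) = 0"
    "f457 * (f145 * f167 - f146 * f157 + f147 * f156) = 0"
    "f467 * (f145 * f167 - f146 * f157 + f147 * f156) = 0"
    "f567 * (f145 * f167 - f146 * f157 + f147 * f156) = 0"
    using z0 by algebra+
  then have f0: "f456 = 0" "f457 = 0" "f467 = 0" "f567 = 0"
    by (simp_all only: q mult_1_right)
  have "?p ** transpose ?p = mat 1"
    using A unfolding rig by simp
  moreover have "det ?p = 1"
    using D unfolding rig by (simp add: det_3)
  ultimately show ?thesis
    by (rule adapted_of_split[OF a])
      (simp_all only: vector_3 f123_def[symmetric] f145_def[symmetric] f146_def[symmetric]
          f147_def[symmetric] f156_def[symmetric] f157_def[symmetric] f167_def[symmetric]
          f245_def[symmetric] f246_def[symmetric] f247_def[symmetric] f256_def[symmetric]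
          f257_def[symmetric] f267_def[symmetric] f345_def[symmetric] f346_def[symmetric]
          f347_def[symmetric] f356_def[symmetric] f357_def[symmetric] f367_def[symmetric]
          f456_def[symmetric] f457_def[symmetric] f467_def[symmetric] f567_def[symmetric]
        z m1 f0 f n0 add_0_right diff_0_right diff_0)
qed

subsection \<open>Inner products given by bilinear forms\<close>

lemma exists_not_in_span:
  fixes S :: "'a::euclidean_space set"
  assumes "finite S" "card S < DIM('a)"
  shows "\<exists>y. y \<notin> span S"
proof (rule ccontr)
  assume "\<not> ?thesis"
  then have "span S = UNIV" by auto
  then have "dim S = DIM('a)"
    using dim_span[of S] by simp
  then show False
    using dim_le_card'[OF assms(1)] assms(2) by simp
qed

locale positive_form =
  fixes B :: "'a::euclidean_space \<Rightarrow> 'a \<Rightarrow> real"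
  assumes bilinear: "bilinear B"
    and sym: "B x y = B y x"
    and pos: "x \<noteq> 0 \<Longrightarrow> B x x > 0"
begin

lemma bounded_bilinear: "bounded_bilinear B"
  using bilinear by (simp add: bilinear_conv_bounded_bilinear)

lemma linear_left: "linear (\<lambda>x. B x y)" and linear_right: "linear (B x)"
  using bilinear by (auto simp: bilinear_def)

lemmas simps = linear_add[OF linear_left] linear_add[OF linear_right] linear_cmul[OF linear_left]
  linear_cmul[OF linear_right] linear_diff[OF linear_left] linear_diff[OF linear_right]
  linear_0[OF linear_left] linear_0[OF linear_right] linear_neg[OF linear_left]
      linear_neg[OF linear_right]

lemma continuous_diag: "continuous_on S (\<lambda>x. B x x)"
  by (intro bounded_bilinear.continuous_on[OF bounded_bilinear] continuous_intros)

lemma normalize: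
  assumes "x \<noteq> 0"
  obtains c where "c > 0" "B (c *\<^sub>R x) (c *\<^sub>R x) = 1"
proof -
  have p: "B x x > 0"
    by (rule pos[OF assms])
  then have "sqrt (B x x) * sqrt (B x x) = B x x"
    by simp
  then have "B ((1 / sqrt (B x x)) *\<^sub>R x) ((1 / sqrt (B x x)) *\<^sub>R x) = 1"
    using p by (simp add: simps field_simps)
  with p show ?thesis
    by (intro that[of "1 / sqrt (B x x)"]) simp_all
qed

text \<open>The minimum of \<open>B x x\<close> on the Euclidean unit sphere is positive, and by
  homogeneity it bounds the Euclidean norm on the unit sphere of \<open>B\<close>.\<close>

lemma compact_unit_sphere: "compact {x. B x x = 1}"
proof -
  let ?S = "sphere (0::'a) 1"
  obtain i :: 'a where "i \<in> Basis"
    using nonempty_Basis by blast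
  then have "?S \<noteq> {}"
    by (metis dist_0_norm empty_iff mem_sphere norm_Basis)
  then obtain a where a: "a \<in> ?S" "\<And>x. x \<in> ?S \<Longrightarrow> B a a \<le> B x x"
    using continuous_attains_inf[OF compact_sphere _ continuous_diag] by metis
  then have "a \<noteq> 0" by auto
  then have c: "B a a > 0" by (rule pos)
  have le: "B a a * (norm x)\<^sup>2 \<le> B x x" for x
  proof (cases "x = 0")
    case False
    then have "B a a \<le> B (x /\<^sub>R norm x) (x /\<^sub>R norm x)"
      by (intro a(2)) simp
    also have "\<dots> = inverse (norm x) * (inverse (norm x) * B x x)"
      by (simp only: simps real_scaleR_def)
    also have "\<dots> = B x x / (norm x)\<^sup>2"
      by (simp add: power2_eq_square divide_inverse)
    finally have "B a a \<le> B x x / (norm x)\<^sup>2" .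
    moreover have "(norm x)\<^sup>2 > 0"
      using False by simp
    ultimately show ?thesis
      using pos_le_divide_eq by blast
  qed (simp add: linear_0[OF linear_left])
  have "bounded {x. B x x = 1}"
  proof (rule boundedI)
    fix x assume "x \<in> {x. B x x = 1}"
    then have "(norm x)\<^sup>2 \<le> 1 / B a a"
      using le[of x] c by (simp add: pos_le_divide_eq mult.commute)
    then show "norm x \<le> sqrt (1 / B a a)"
      by (rule real_le_rsqrt)
  qed
  moreover have "closed {x. B x x = 1}"
    by (intro closed_Collect_eq continuous_diag continuous_on_const)
  ultimately show ?thesis
    by (simp add: compact_eq_bounded_closed)
qed

text \<open>The first-order condition at a maximum on the unit sphere of \<open>B\<close>: rescaling
  bounds \<open>l\<close> on every vector, and a direction orthogonal to \<open>u\<close> with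
  nonzero \<open>l\<close> would violate this bound near \<open>u\<close>.\<close>

lemma maximal_functional:
  assumes l: "linear l" and u: "B u u = 1" and max: "\<And>x. B x x = 1 \<Longrightarrow> l x \<le> l u"
  shows "l x = l u * B x u"
proof -
  have uu: "l (- u) \<le> l u"
    by (intro max) (simp add: u linear_neg[OF linear_left] linear_neg[OF linear_right])
  then have M: "l u \<ge> 0"
    by (simp add: linear_neg[OF l])
  have bound: "(l y)\<^sup>2 \<le> (l u)\<^sup>2 * B y y" for y
  proof (cases "y = 0")
    case False
    then obtain c where c: "c > 0" "B (c *\<^sub>R y) (c *\<^sub>R y) = 1"
      by (rule normalize)
    have "l (c *\<^sub>R y) \<le> l u" "l ((- c) *\<^sub>R y) \<le> l u"
      using c(2) by (auto intro!: max simp: simps)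
    then have "\<bar>c * l y\<bar> \<le> l u"
      by (simp add: linear_cmul[OF l] linear_neg[OF l] abs_le_iff)
    then have "\<bar>c * l y\<bar>\<^sup>2 \<le> (l u)\<^sup>2"
      by (rule power_mono) simp
    moreover have "c\<^sup>2 * B y y = 1"
      using c(2) by (simp add: simps power2_eq_square)
    ultimately have "c\<^sup>2 * (l y)\<^sup>2 \<le> (l u)\<^sup>2 * (c\<^sup>2 * B y y)"
      by (simp add: power_mult_distrib)
    then show ?thesis
      using c(1) by (simp add: mult.left_commute[of "(l u)\<^sup>2"])
  qed (simp add: linear_0[OF l] linear_0[OF linear_left])
  have orth: "l y = 0" if "B y u = 0" for y
  proof (rule ccontr)
    assume n: "l y \<noteq> 0"
    then have "y \<noteq> 0"
      using linear_0[OF l] by auto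
    have "l u \<noteq> 0"
      using bound[of y] n by auto
    have "(l (u + t *\<^sub>R y))\<^sup>2 \<le> (l u)\<^sup>2 * B (u + t *\<^sub>R y) (u + t *\<^sub>R y)" for t
      by (rule bound)
    then have q: "2 * t * l u * l y + t\<^sup>2 * (l y)\<^sup>2 \<le> (l u)\<^sup>2 * t\<^sup>2 * B y y" for t
      using that sym[of u y]
      by (simp add: linear_add[OF l] linear_cmul[OF l] simps u power2_eq_square algebra_simps)
    define K where "K = (l u)\<^sup>2 * B y y + 1"
    have "K > 0"
      using pos[OF \<open>y \<noteq> 0\<close>] by (simp add: K_def add_nonneg_pos)
    have "2 * t * (l u * l y) \<le> K * t\<^sup>2" for t
    proof -
      have "2 * t * (l u * l y) \<le> (l u)\<^sup>2 * t\<^sup>2 * B y y - t\<^sup>2 * (l y)\<^sup>2"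
        using q[of t] by (simp only: mult.assoc le_diff_eq)
      also have "\<dots> \<le> (l u)\<^sup>2 * t\<^sup>2 * B y y + t\<^sup>2"
        using mult_nonneg_nonneg[OF zero_le_power2[of t] zero_le_power2[of "l y"]] zero_le_power2[of t]
        by linarith
      also have "\<dots> = K * t\<^sup>2"
        by (simp add: K_def algebra_simps)
      finally show ?thesis .
    qed
    \<comment> \<open>This \<open>t\<close> is where 2 t m - K t^2, with m =
      \<open>l u * l y\<close>, has its maximum m^2 / K; the inequality then forces m = 0.\<close>
    from this[of "l u * l y / K"] have "2 * (l u * l y)\<^sup>2 / K \<le> (l u * l y)\<^sup>2 / K"
      using \<open>K > 0\<close> by (simp add: power2_eq_square field_simps)
    then have "(l u * l y)\<^sup>2 \<le> 0"
      using \<open>K > 0\<close> by (simp add: field_simps)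
    then show False
      using n \<open>l u \<noteq> 0\<close> by simp
  qed
  have "l (x - B x u *\<^sub>R u) = 0"
    by (rule orth) (simp add: simps u)
  then show ?thesis
    by (simp add: linear_diff[OF l] linear_cmul[OF l] mult.commute)
qed

lemma extend_orthonormal:
  assumes "finite S" "card S < DIM('a)"
    and on: "\<And>x y. x \<in> S \<Longrightarrow> y \<in> S \<Longrightarrow> B x y = of_bool (x = y)"
  shows "\<exists>z. B z z = 1 \<and> (\<forall>x\<in>S. B x z = 0 \<and> B z x = 0)"
proof -
  obtain y where y: "y \<notin> span S"
    using exists_not_in_span[OF assms(1,2)] by blast
  let ?p = "\<Sum>x\<in>S. B y x *\<^sub>R x"
  have "?p \<in> span S"
    by (intro span_sum span_scale span_base)
  then have "y - ?p \<noteq> 0"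
    using y by auto
  then obtain c where c: "c > 0" "B (c *\<^sub>R (y - ?p)) (c *\<^sub>R (y - ?p)) = 1"
    by (rule normalize)
  have "B (c *\<^sub>R (y - ?p)) x = 0" if "x \<in> S" for x
  proof -
    have "B ?p x = (\<Sum>w\<in>S. B y w * of_bool (w = x))"
      using on that by (simp add: linear_sum[OF linear_left] simps)
    also have "\<dots> = B y x"
      using that assms(1) by (simp add: of_bool_def if_distrib cong: if_cong)
    finally show ?thesis
      by (simp add: simps)
  qed
  with c show ?thesis
    using sym by metis
qed

end

subsection \<open>Definite 3-forms\<close>

lemma alt_form_3_contract: "alt_form 3 \<phi> \<Longrightarrow> alt_form 2 (contract v \<phi>)"
  by (rule alt_form_contract) (simp add: numeral_3_eq_3 numeral_2_eq_2)

text \<open>The matrix of the contraction with \<open>w\<close> is skew, so its range is orthogonal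
  to its kernel. The range has dimension 6, and a second independent kernel vector \<open>x\<close>
  besides \<open>w\<close> would not fit into dimension 7.\<close>

lemma definite_kernel:
  assumes d: "definite \<phi>" and w: "w \<noteq> 0" and z: "\<And>y. \<phi> [w, x, y] = 0"
  shows "x \<in> span {w}"
proof (rule ccontr)
  assume x: "x \<notin> span {w}"
  have a: "alt_form 3 \<phi>"
    using d by (simp add: definite_def)
  let ?\<beta> = "contract w \<phi>"
  let ?A = "(\<chi> i j. ?\<beta> [E i, E j]) :: real^7^7"
  have b: "alt_form 2 ?\<beta>"
    using a by (rule alt_form_3_contract)
  have A: "(?A *v y) $ i = ?\<beta> [E i, y]" for y i
  proof -
    have "(?A *v y) $ i = (\<Sum>j\<in>UNIV. y $ j * ?\<beta> [E i, E j])"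
      by (simp add: matrix_vector_mult_def mult.commute)
    also have "\<dots> = (\<Sum>j\<in>UNIV. - (y $ j * ?\<beta> [E j, E i]))"
      by (rule sum.cong[OF refl]) (metis alt2_rules(2)[OF b] mult_minus_right)
    also have "\<dots> = - (\<Sum>j\<in>UNIV. y $ j * ?\<beta> [E j, E i])"
      by (rule sum_negf)
    also have "\<dots> = ?\<beta> [E i, y]"
      unfolding linear_expand[OF alt_form_linear_hd[OF b], of y, symmetric]
      using alt2_rules(2)[OF b, of y "E i"] by simp
    finally show ?thesis .
  qed
  have orth: "u \<bullet> y = 0" if "u \<in> range ((*v) ?A)" "y \<in> {x, w}" for u y
  proof -
    obtain q where "u = ?A *v q"
      using \<open>u \<in> range ((*v) ?A)\<close> by blast
    then have "u \<bullet> y = (\<Sum>i\<in>UNIV. y $ i * ?\<beta> [E i, q])"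
      unfolding inner_vec_def by (simp add: A mult.commute)
    also have "\<dots> = ?\<beta> [y, q]"
      by (rule linear_expand[OF alt_form_linear_hd[OF b], symmetric])
    also have "\<dots> = 0"
      using that(2) z alt3_repeat(1)[OF a] by (auto simp: contract_def)
    finally show ?thesis .
  qed
  have "dim (range ((*v) ?A) \<union> {x, w}) = dim (range ((*v) ?A)) + dim {x, w}"
    by (rule dim_orthogonal_sum) (rule orth)
  moreover have "dim (range ((*v) ?A)) = 6"
    using d w by (simp add: definite_def rank_dim_range[symmetric])
  moreover have "dim {x, w} = 2"
  proof -
    have "x \<noteq> w"
      using x span_base[of w "{w}"] by auto
    moreover have "independent {x, w}"
      using w x by (simp add: independent_insert)
    ultimately show ?thesis
      by (simp add: dim_eq_card_independent)
  qed
  ultimately show False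
    using dim_subset_UNIV[of "range ((*v) ?A) \<union> {x, w}"] by simp
qed

lemma cubic_form_commute:
  assumes "alt_form 3 \<phi>"
  shows "cubic_form \<phi> v w [x1, x2, x3, x4, x5, x6, x7] = cubic_form \<phi> w v [x1, x2, x3, x4, x5, x6, x7]"
proof -
  have c: "wedge (contract v \<phi>) (contract w \<phi>) [y1, y2, y3, y4]
      = wedge (contract w \<phi>) (contract v \<phi>) [y1, y2, y3, y4]" for y1 y2 y3 y4
    unfolding contract_contract_expand[OF assms] by (simp add: algebra_simps)
  show ?thesis
    unfolding cubic_form_expand[OF assms] Let_def by (simp only: c)
qed

lemma bilinear_g2_coeff:
  assumes "alt_form 3 \<phi>"
  shows "bilinear (g2_coeff \<phi>)"
proof -
  have add: "wedge (\<lambda>xs. \<alpha> xs + \<alpha>' xs) \<beta> = (\<lambda>xs. wedge \<alpha> \<beta> xs + wedge \<alpha>' \<beta> xs)"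
    "wedge \<beta> (\<lambda>xs. \<alpha> xs + \<alpha>' xs) = (\<lambda>xs. wedge \<beta> \<alpha> xs + wedge \<beta> \<alpha>' xs)" for \<alpha> \<alpha>' \<beta>
    by (simp_all add: fun_eq_iff wedge_add_left wedge_add_right)
  have scale: "wedge (\<lambda>xs. c * \<alpha> xs) \<beta> = (\<lambda>xs. c * wedge \<alpha> \<beta> xs)"
    "wedge \<beta> (\<lambda>xs. c * \<alpha> xs) = (\<lambda>xs. c * wedge \<beta> \<alpha> xs)" for c \<alpha> \<beta>
    by (simp_all add: fun_eq_iff wedge_scale_left wedge_scale_right)
  show ?thesis
    unfolding bilinear_def g2_coeff_eq cubic_form_def
    by (auto intro!: linearI simp: contract_add[OF assms] contract_scale[OF assms] add scale
        add_divide_distrib)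
qed

text \<open>The 2-form \<omega> = \<iota>_v \<phi> is symplectic modulo \<open>v\<close>. On
  \<open>v\<close> followed by a symplectic basis, \<omega> wedge \<omega> wedge \<phi> takes the
  value of the cube of \<omega>, which is 3! = 6. The determinant of these seven vectors times the
  coefficient is therefore nonzero.\<close>

lemma definite_g2_coeff_nonzero:
  assumes d: "definite \<phi>" and v: "v \<noteq> 0"
  shows "g2_coeff \<phi> v v \<noteq> 0"
proof -
  have a: "alt_form 3 \<phi>"
    using d by (simp add: definite_def)
  define \<omega> where "\<omega> = (\<lambda>x y. \<phi> [v, x, y])"
  have b: "alt_form 2 (contract v \<phi>)"
    using a by (rule alt_form_3_contract)
  have anti: "\<omega> y x = - \<omega> x y" and self: "\<omega> x x = 0" for x y
    using alt2_rules(1)[OF b, of x] alt2_rules(2)[OF b, of y x] by (simp_all add: \<omega>_def contract_def)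
  have lin: "linear (\<lambda>x. \<omega> x y)" for y
    using alt_form_linear_hd[OF b, of "[y]"] by (simp add: \<omega>_def contract_def)
  have lin2: "linear (\<omega> x)" for x
    using alt_form_linear_append[OF b, of "[x]" "[]"] by (simp add: \<omega>_def contract_def)
  note lins = linear_add[OF lin] linear_add[OF lin2] linear_diff[OF lin] linear_diff[OF lin2]
    linear_cmul[OF lin] linear_cmul[OF lin2]
  have v0: "\<omega> v y = 0" for y
    using alt3_repeat[OF a] by (simp add: \<omega>_def)
  have partner: "\<exists>y. \<omega> x y = 1" if x: "x \<notin> span {v}" for x
  proof -
    obtain y where "\<omega> x y \<noteq> 0"
      using definite_kernel[OF d v, of x] x by (auto simp: \<omega>_def)
    then have "\<omega> x ((1 / \<omega> x y) *\<^sub>R y) = 1"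
      by (simp add: lins)
    then show ?thesis ..
  qed
  obtain x2 where "x2 \<notin> span {v}"
    using exists_not_in_span[of "{v}"] by auto
  then obtain x3 where w23: "\<omega> x2 x3 = 1"
    using partner by blast
  \<comment> \<open>Projection onto the \<omega>-complement of the hyperbolic plane spanned by
    \<open>x2\<close> and \<open>x3\<close>; the later \<open>q\<close> also removes the plane of
    \<open>x4\<close> and \<open>x5\<close>. A vector and its projection have the same pairing with
    vectors of the complement, so normalised partners remain normalised.\<close>
  define p where "p y = y - \<omega> y x3 *\<^sub>R x2 + \<omega> y x2 *\<^sub>R x3" for y
  have p: "\<omega> (p y) x2 = 0" "\<omega> (p y) x3 = 0" for y
    using w23 anti[of x3 x2] self by (simp_all add: p_def lins)
  have p': "\<omega> x2 (p y) = 0" "\<omega> x3 (p y) = 0" for y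
    using p[of y] anti[of x2 "p y"] anti[of x3 "p y"] by simp_all
  have ex: "\<exists>y. y \<notin> span (set xs)" if "length xs < 7" for xs :: "(real^7) list"
    using exists_not_in_span[of "set xs"] card_length[of xs] that by simp
  obtain y4 where y4: "y4 \<notin> span {v, x2, x3}"
    using ex[of "[v, x2, x3]"] by auto
  define x4 where "x4 = p y4"
  have "x4 \<notin> span {v}"
  proof
    assume "x4 \<in> span {v}"
    then have "x4 \<in> span {v, x2, x3}"
      using span_mono[of "{v}" "{v, x2, x3}"] by auto
    then have "x4 + \<omega> y4 x3 *\<^sub>R x2 - \<omega> y4 x2 *\<^sub>R x3 \<in> span {v, x2, x3}"
      by (intro span_add span_diff span_scale) (auto intro: span_base)
    then show False
      using y4 by (simp add: x4_def p_def)
  qed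
  then obtain y5 where y5: "\<omega> x4 y5 = 1"
    using partner by blast
  define x5 where "x5 = p y5"
  have w45: "\<omega> x4 x5 = 1"
    using y5 p[of y4] by (simp add: x5_def p_def[of y5] lins x4_def[symmetric])
  define q where "q y = p y - \<omega> (p y) x5 *\<^sub>R x4 + \<omega> (p y) x4 *\<^sub>R x5" for y
  have q: "\<omega> (q y) x4 = 0" "\<omega> (q y) x5 = 0" "\<omega> (q y) x2 = 0" "\<omega> (q y) x3 = 0" for y
    using w45 anti[of x5 x4] self p by (simp_all add: q_def lins x4_def x5_def)
  have q': "\<omega> x4 (q y) = 0" "\<omega> x5 (q y) = 0" "\<omega> x2 (q y) = 0" "\<omega> x3 (q y) = 0" for y
    using q[of y] anti[of x4 "q y"] anti[of x5 "q y"] anti[of x2 "q y"] anti[of x3 "q y"] by simp_all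
  obtain y6 where y6: "y6 \<notin> span {v, x2, x3, x4, x5}"
    using ex[of "[v, x2, x3, x4, x5]"] by auto
  define x6 where "x6 = q y6"
  have "x6 \<notin> span {v}"
  proof
    assume "x6 \<in> span {v}"
    then have "x6 \<in> span {v, x2, x3, x4, x5}"
      using span_mono[of "{v}" "{v, x2, x3, x4, x5}"] by auto
    then have "x6 + \<omega> (p y6) x5 *\<^sub>R x4 - \<omega> (p y6) x4 *\<^sub>R x5 + \<omega> y6 x3 *\<^sub>R x2 - \<omega> y6 x2 *\<^sub>R x3
        \<in> span {v, x2, x3, x4, x5}"
      by (intro span_add span_diff span_scale) (auto intro: span_base)
    then show False
      using y6 by (simp add: x6_def q_def p_def)
  qed
  then obtain y7 where y7: "\<omega> x6 y7 = 1"
    using partner by blast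
  define x7 where "x7 = q y7"
  have w67: "\<omega> x6 x7 = 1"
    using y7 q[of y6] by (simp add: x7_def q_def[of y7] p_def[of y7] lins x6_def[symmetric])
  have z: "\<omega> x2 x4 = 0" "\<omega> x2 x5 = 0" "\<omega> x2 x6 = 0" "\<omega> x2 x7 = 0"
    "\<omega> x3 x4 = 0" "\<omega> x3 x5 = 0" "\<omega> x3 x6 = 0" "\<omega> x3 x7 = 0"
    "\<omega> x4 x6 = 0" "\<omega> x4 x7 = 0" "\<omega> x5 x6 = 0" "\<omega> x5 x7 = 0"
    unfolding x6_def x7_def by (simp_all only: q' p' x4_def x5_def q'[unfolded x4_def x5_def])
  note r = w23 w45 w67 z v0
  have "cubic_form \<phi> v v [v, x2, x3, x4, x5, x6, x7] = 6"
    unfolding cubic_form_expand[OF a] Let_def contract_contract_expand[OF a]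
    by (simp add: r[unfolded \<omega>_def])
  moreover have "[v, x2, x3, x4, x5, x6, x7] = map (($) (vector [v, x2, x3, x4, x5, x6, x7] ::
      real^7^7)) idx7"
    unfolding map_idx7 vector_7 ..
  ultimately have "det (vector [v, x2, x3, x4, x5, x6, x7] :: real^7^7) * cubic_form \<phi> v v (map E
      idx7) = 6"
    by (metis alt_top_det[OF alt_form_cubic_form[OF a]])
  then show ?thesis
    unfolding g2_coeff_eq by auto
qed

section \<open>Metric sign and maximisation of a definite 3-form\<close>

lemma alt3_scale:
  assumes a: "alt_form 3 \<phi>"
  shows "\<phi> [a *\<^sub>R x, b *\<^sub>R y, c *\<^sub>R z] = a * b * c * \<phi> [x, y, z]"
  using linear_cmul[OF alt_form_linear_append[OF a, of "[]" "[b *\<^sub>R y, c *\<^sub>R z]"], of a x]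
    linear_cmul[OF alt_form_linear_append[OF a, of "[x]" "[c *\<^sub>R z]"], of b y]
    linear_cmul[OF alt_form_linear_append[OF a, of "[x, y]" "[]"], of c z]
  by simp

lemma alt3_sum:
  assumes a: "alt_form 3 \<phi>"
  shows "\<phi> [x, y, z]
    = (\<Sum>i\<in>UNIV. x $ i * (\<Sum>j\<in>UNIV. y $ j * (\<Sum>k\<in>UNIV. z $ k * \<phi> [E i, E j, E k])))"
proof -
  have 3: "\<phi> [x, y, z] = (\<Sum>k\<in>UNIV. z $ k * \<phi> [x, y, E k])" for x y
    using linear_expand[OF alt_form_linear_append[OF a, of "[x, y]" "[]"], of z] by simp
  have 2: "\<phi> [x, y, z] = (\<Sum>j\<in>UNIV. y $ j * \<phi> [x, E j, z])" for x
    using linear_expand[OF alt_form_linear_append[OF a, of "[x]" "[z]"], of y] by simp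
  have "\<phi> [x, y, z] = (\<Sum>i\<in>UNIV. x $ i * \<phi> [E i, y, z])"
    by (rule linear_expand[OF alt_form_linear_hd[OF a]])
  then show ?thesis
    by (simp only: 2[of "E _"] 3[of "E _" "E _"])
qed

lemma continuous_on_alt3:
  assumes a: "alt_form 3 \<phi>"
  shows "continuous_on S (\<lambda>q. \<phi> [fst q, fst (snd q), snd (snd q)])"
proof -
  have "continuous_on S (\<lambda>q. \<Sum>i\<in>UNIV. fst q $ i * (\<Sum>j\<in>UNIV. fst (snd q) $ j *
      (\<Sum>k\<in>UNIV. snd (snd q) $ k * \<phi> [E i, E j, E k])))"
    by (intro continuous_intros)
  then show ?thesis
    by (subst alt3_sum[OF a])
qed

context positive_form
begin

definition orthonormal_list :: "'a list \<Rightarrow> bool" where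
  "orthonormal_list xs \<longleftrightarrow> (\<forall>i<length xs. \<forall>j<length xs. B (xs ! i) (xs ! j) = of_bool (i = j))"

lemma orthonormal_list_extend:
  assumes "orthonormal_list xs" "length xs + n = DIM('a)"
  shows "\<exists>ys. length ys = n \<and> orthonormal_list (xs @ ys)"
  using assms
proof (induction n arbitrary: xs)
  case 0
  then show ?case by simp
next
  case (Suc n)
  have on: "B x y = of_bool (x = y)" if "x \<in> set xs" "y \<in> set xs" for x y
  proof -
    obtain i j where "x = xs ! i" "y = xs ! j" "i < length xs" "j < length xs"
      using \<open>x \<in> set xs\<close> \<open>y \<in> set xs\<close> by (metis in_set_conv_nth)
    then show ?thesis
      using Suc.prems(1) unfolding orthonormal_list_def by (metis of_bool_eq_iff zero_neq_one
          of_bool_eq(1) of_bool_eq(2))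
  qed
  obtain z where z: "B z z = 1" "\<And>x. x \<in> set xs \<Longrightarrow> B x z = 0 \<and> B z x = 0"
    using extend_orthonormal[of "set xs", OF _ _ on] card_length[of xs] Suc.prems(2) by auto
  have "orthonormal_list (xs @ [z])"
    using Suc.prems(1) z unfolding orthonormal_list_def
    by (auto simp: nth_append less_Suc_eq)
  from Suc.IH[OF this] obtain ys where "length ys = n" "orthonormal_list ((xs @ [z]) @ ys)"
    using Suc.prems(2) by auto
  then show ?case
    by (intro exI[of _ "z # ys"]) simp
qed

end

text \<open>The function b(x,x) is continuous and zero-free on the punctured space, which is
  connected in dimension 7, so it has constant sign.\<close>

lemma definite_sign:
  assumes d: "definite \<phi>"
  obtains s :: real where "s * s = 1" "positive_form (\<lambda>x y. s * g2_coeff \<phi> x y)"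
proof -
  let ?f = "\<lambda>x. g2_coeff \<phi> x x"
  have a: "alt_form 3 \<phi>"
    using d by (simp add: definite_def)
  have bl: "bilinear (g2_coeff \<phi>)"
    by (rule bilinear_g2_coeff[OF a])
  have nz: "?f x \<noteq> 0" if "x \<noteq> 0" for x
    by (rule definite_g2_coeff_nonzero[OF d that])
  have "continuous_on (- {0}) ?f"
    using bl unfolding bilinear_conv_bounded_bilinear
    by (intro bounded_bilinear.continuous_on[of "g2_coeff \<phi>"] continuous_intros)
  moreover have "connected (- {0 :: real^7})"
    by (intro path_connected_imp_connected path_connected_punctured_universe) simp
  ultimately have c: "connected (?f ` (- {0}))"
    by (rule connected_continuous_image)
  have sg: "(\<forall>x. x \<noteq> 0 \<longrightarrow> ?f x > 0) \<or> (\<forall>x. x \<noteq> 0 \<longrightarrow> ?f x < 0)"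
  proof (rule ccontr)
    assume "\<not> ?thesis"
    then obtain x y where "x \<noteq> 0" "?f x \<le> 0" "y \<noteq> 0" "0 \<le> ?f y"
      by (auto simp: not_less)
    then have "?f x \<in> ?f ` (- {0})" "?f y \<in> ?f ` (- {0})"
      by blast+
    then have "0 \<in> ?f ` (- {0})"
      using \<open>?f x \<le> 0\<close> \<open>0 \<le> ?f y\<close> by (rule connectedD_interval[OF c])
    then show False
      using nz by force
  qed
  define s :: real where "s = (if \<forall>x. x \<noteq> 0 \<longrightarrow> ?f x > 0 then 1 else - 1)"
  have "positive_form (\<lambda>x y. s * g2_coeff \<phi> x y)"
  proof
    have l: "linear (\<lambda>x. s * h x)" if "linear h" for h :: "real^7 \<Rightarrow> real"
      using linear_compose_scale_right[OF that, of s] by simp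
    show "bilinear (\<lambda>x y. s * g2_coeff \<phi> x y)"
      using bl unfolding bilinear_def by (auto intro!: l)
    show "s * g2_coeff \<phi> x y = s * g2_coeff \<phi> y x" for x y
      unfolding g2_coeff_eq map_idx7 cubic_form_commute[OF a, of x y] ..
    show "s * g2_coeff \<phi> x x > 0" if "x \<noteq> 0" for x
      using sg that by (auto simp: s_def)
  qed
  moreover have "s * s = 1"
    by (simp add: s_def)
  ultimately show ?thesis
    by (intro that)
qed

text \<open>The product of three unit spheres is compact. At a maximum each slot, with the other two
  fixed, carries a linear functional maximal at the chosen unit vector, and
  \<open>maximal_functional\<close> determines it.\<close>

lemma definite_maximum:
  assumes d: "definite \<phi>" and "positive_form B"
  obtains x y z M where "B x x = 1" "B y y = 1" "B z z = 1" "M > 0"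
    "\<And>w. \<phi> [w, y, z] = M * B w x" "\<And>w. \<phi> [x, w, z] = M * B w y"
    "\<And>w. \<phi> [x, y, w] = M * B w z"
proof -
  interpret positive_form B by fact
  have a: "alt_form 3 \<phi>"
    using d by (simp add: definite_def)
  let ?K = "{x. B x x = 1}"
  let ?T = "\<lambda>q. \<phi> [fst q, fst (snd q), snd (snd q)]"
  have comp: "compact (?K \<times> ?K \<times> ?K)"
    by (intro compact_Times compact_unit_sphere)
  have "E 1 \<noteq> (0 :: real^7)"
    by (simp add: axis_eq_0_iff)
  moreover obtain x0 where "x0 \<notin> span {E 1}"
    using exists_not_in_span[of "{E 1}"] by auto
  ultimately obtain y0 where nz: "\<phi> [E 1, x0, y0] \<noteq> 0"
    using definite_kernel[OF d, of "E 1" x0] by blast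
  have "x0 \<noteq> 0"
    using \<open>x0 \<notin> span {E 1}\<close> span_zero by metis
  have "y0 \<noteq> 0"
    using nz linear_0[OF alt_form_linear_append[OF a, of "[E 1, x0]" "[]"]] by auto
  obtain c1 where c1: "c1 > 0" "B (c1 *\<^sub>R E 1) (c1 *\<^sub>R E 1) = 1"
    by (rule normalize[OF \<open>E 1 \<noteq> 0\<close>])
  obtain c2 where c2: "c2 > 0" "B (c2 *\<^sub>R x0) (c2 *\<^sub>R x0) = 1"
    by (rule normalize[OF \<open>x0 \<noteq> 0\<close>])
  obtain c3 where c3: "c3 > 0" "B (c3 *\<^sub>R y0) (c3 *\<^sub>R y0) = 1"
    by (rule normalize[OF \<open>y0 \<noteq> 0\<close>])
  \<comment> \<open>Flipping the first vector if necessary exhibits a triple with a positive value,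
    so the maximum is positive.\<close>
  define e where "e = sgn (\<phi> [E 1, x0, y0])"
  have e: "e * e = 1" "e * \<phi> [E 1, x0, y0] > 0"
    using nz by (auto simp: e_def sgn_if)
  let ?q = "((e * c1) *\<^sub>R E 1, c2 *\<^sub>R x0, c3 *\<^sub>R y0)"
  have "B ((e * c1) *\<^sub>R E 1) ((e * c1) *\<^sub>R E 1) = (e * e) * B (c1 *\<^sub>R E 1) (c1 *\<^sub>R E 1)"
    by (simp add: simps)
  then have q: "?q \<in> ?K \<times> ?K \<times> ?K"
    using c1 c2 c3 e by simp
  have "?T ?q = c1 * c2 * c3 * (e * \<phi> [E 1, x0, y0])"
    by (simp add: alt3_scale[OF a])
  then have "?T ?q > 0"
    using c1 c2 c3 e by simp
  moreover obtain m where m: "m \<in> ?K \<times> ?K \<times> ?K" "\<And>q. q \<in> ?K \<times> ?K \<times> ?K \<Longrightarrow> ?T q \<le> ?T m"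
    using continuous_attains_sup[OF comp _ continuous_on_alt3[OF a]] q by blast
  ultimately have pos: "?T m > 0"
    using q by fastforce
  obtain x y z where xyz: "m = (x, y, z)"
    by (cases m) auto
  have u: "B x x = 1" "B y y = 1" "B z z = 1"
    using m(1) xyz by auto
  have max: "\<phi> [x', y', z'] \<le> \<phi> [x, y, z]" if "B x' x' = 1" "B y' y' = 1" "B z' z' = 1" for x' y' z'
    using m(2)[of "(x', y', z')"] xyz that by simp
  have l1: "\<phi> [w, y, z] = \<phi> [x, y, z] * B w x" for w
    using maximal_functional[of "\<lambda>w. \<phi> [w, y, z]" x w] alt_form_linear_append[OF a, of "[]" "[y, z]"]
      u max[OF _ u(2,3)] by simp
  have l2: "\<phi> [x, w, z] = \<phi> [x, y, z] * B w y" for w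
    using maximal_functional[of "\<lambda>w. \<phi> [x, w, z]" y w] alt_form_linear_append[OF a, of "[x]" "[z]"]
      u max[OF u(1) _ u(3)] by simp
  have l3: "\<phi> [x, y, w] = \<phi> [x, y, z] * B w z" for w
    using maximal_functional[of "\<lambda>w. \<phi> [x, y, w]" z w] alt_form_linear_append[OF a, of "[x, y]" "[]"]
      u max[OF u(1,2)] by simp
  have "\<phi> [x, y, z] > 0"
    using pos xyz by simp
  then show ?thesis
    by (rule that[OF u _ l1 l2 l3])
qed

text \<open>The maximising triple is orthonormal and \<phi> pairs two of its vectors only with the
  third, so in an orthonormal basis extending it the mixed coefficients vanish. After rescaling, so
  that \<open>b\<close> itself and not just a multiple is normalised,
  \<open>adapted_of_orthonormal_split\<close> applies.\<close>

lemma adapted_exists: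
  assumes d: "definite \<phi>"
  shows "\<exists>P. adapted \<phi> P"
proof -
  have a: "alt_form 3 \<phi>"
    using d by (simp add: definite_def)
  obtain s :: real where s: "s * s = 1" and pf: "positive_form (\<lambda>x y. s * g2_coeff \<phi> x y)"
    by (rule definite_sign[OF d])
  define B where "B = (\<lambda>x y. s * g2_coeff \<phi> x y)"
  interpret positive_form B
    using pf by (simp add: B_def)
  obtain x y z M where m: "B x x = 1" "B y y = 1" "B z z = 1" "M > 0"
    "\<And>w. \<phi> [w, y, z] = M * B w x" "\<And>w. \<phi> [x, w, z] = M * B w y"
    "\<And>w. \<phi> [x, y, w] = M * B w z"
    using definite_maximum[OF d, of B] positive_form_axioms by metis
  \<comment> \<open>Putting \<open>y\<close> into the first slot repeats it, so the left side of the
    first-order condition is 0.\<close>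
  have yx: "B y x = 0"
    using m(4) m(5)[of y] alt3_repeat(1)[OF a] by simp
  have zx: "B z x = 0"
    using m(4) m(5)[of z] alt3_repeat(2)[OF a] by simp
  have zy: "B z y = 0"
    using m(4) m(6)[of z] alt3_repeat(3)[OF a] by simp
  have "orthonormal_list [x, y, z]"
    unfolding orthonormal_list_def using m(1-3) yx zx zy sym[of x y] sym[of x z] sym[of y z]
    by (simp add: numeral_eq_Suc All_less_Suc)
  then obtain ys where "length ys = 4" "orthonormal_list ([x, y, z] @ ys)"
    using orthonormal_list_extend[of "[x, y, z]" 4] by auto
  then obtain w4 w5 w6 w7 where on: "orthonormal_list [x, y, z, w4, w5, w6, w7]"
    by (auto simp: numeral_eq_Suc length_Suc_conv)
  let ?U = "vector [x, y, z, w4, w5, w6, w7] :: real^7^7"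
  have U: "B (?U $ i) (?U $ j) = of_bool (i = j)" for i j
  proof -
    have "\<forall>i j. B (?U $ i) (?U $ j) = of_bool (i = j)"
      unfolding all_7 vector_7
      using on unfolding orthonormal_list_def
      by (simp add: numeral_eq_Suc All_less_Suc)
    then show ?thesis by blast
  qed
  have dU: "det ?U \<noteq> 0"
  proof -
    have "v = 0" if "transpose ?U *v v = 0" for v
    proof -
      have "(\<Sum>i\<in>UNIV. v $ i *\<^sub>R ?U $ i) = 0"
        using that by (simp add: matrix_vector_mult_def transpose_def vec_eq_iff mult.commute)
      then have "0 = B (\<Sum>i\<in>UNIV. v $ i *\<^sub>R ?U $ i) (?U $ j)" for j
        by (simp add: linear_0[OF linear_left])
      also have "B (\<Sum>i\<in>UNIV. v $ i *\<^sub>R ?U $ i) (?U $ j) = v $ j" for j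
        by (simp add: linear_sum[OF linear_left] linear_cmul[OF linear_left] U of_bool_def if_distrib
            cong: if_cong)
      finally show ?thesis
        by (simp add: vec_eq_iff)
    qed
    then have "invertible (transpose ?U)"
      unfolding invertible_left_inverse matrix_left_invertible_ker by blast
    then show ?thesis
      by (simp add: invertible_det_nz)
  qed
  \<comment> \<open>The orientation is corrected by the sign of the last basis vector, which leaves
    the maximising triple and its positive value in place.\<close>
  define e where "e = sgn (det ?U * s)"
  have "det ?U * s \<noteq> 0"
    using dU s by auto
  then have e: "e * (det ?U * s) = \<bar>det ?U * s\<bar>" "e * e = 1" "det ?U * s \<noteq> 0"
    by (auto simp: e_def sgn_if)
  \<comment> \<open>Scaling all vectors by \<open>t\<close> contributes t^2 through the two
    arguments of \<open>b\<close> and t^7 through the volume element, whence the ninth root.\<close>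
  define t where "t = root 9 (1 / \<bar>det ?U * s\<bar>)"
  have t9: "t ^ 9 * \<bar>det ?U * s\<bar> = 1"
    using e(3) by (simp add: t_def odd_real_root_pow)
  have "t > 0"
    using e(3) by (simp add: t_def)
  let ?c = "vector [t, t, t, t, t, t, t * e] :: real^7"
  let ?Q = "transpose (\<chi> i. ?c $ i *s ?U $ i) :: real^7^7"
  have Q: "?Q *v E i = ?c $ i *\<^sub>R ?U $ i" for i
    by (simp add: matrix_vector_mult_basis column_def transpose_def vec_eq_iff)
  have "(\<Prod>i\<in>UNIV. ?c $ i) = t ^ 7 * e"
  proof -
    have "(\<Prod>i\<in>set idx7. ?c $ i) = prod_list (map (($) ?c) idx7)"
      by (rule prod.distinct_set_conv_list[OF distinct_idx7])
    then show ?thesis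
      unfolding set_idx7 map_idx7 vector_7 by (simp add: power_numeral_reduce)
  qed
  then have detQ: "det ?Q = t ^ 7 * e * det ?U"
    by (simp only: det_transpose det_rows_mul vec_nth_inverse)
  have c2: "?c $ i * ?c $ i = t\<^sup>2" for i
  proof -
    have "\<forall>i. ?c $ i * ?c $ i = t\<^sup>2"
      unfolding all_7 vector_7 using e(2) by (simp add: power2_eq_square)
    then show ?thesis by blast
  qed
  let ?\<psi> = "pullback ?Q \<phi>"
  have a': "alt_form 3 ?\<psi>"
    using a by (rule alt_form_pullback)
  have cubic: "cubic_form ?\<psi> (E i) (E j) (map E idx7) = 6 * of_bool (i = j)" for i j
  proof -
    have "g2_coeff \<phi> v w = s * B v w" for v w
      using s by (simp add: B_def mult.assoc[symmetric])
    then have "cubic_form ?\<psi> (E i) (E j) (map E idx7) = 6 * det ?Q * (s * B (?c $ i *\<^sub>R ?U $ i) (?c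
        $ j *\<^sub>R ?U $ j))"
      unfolding cubic_form_pullback pullback_top[OF alt_form_cubic_form[OF a]] Q
      using g2_coeff_eq[of \<phi> "?c $ i *\<^sub>R ?U $ i" "?c $ j *\<^sub>R ?U $ j"] by simp
    also have "\<dots> = 6 * (t ^ 7 * (e * (det ?U * s))) * (?c $ i * ?c $ j) * of_bool (i = j)"
      unfolding detQ by (simp add: linear_cmul[OF linear_left] linear_cmul[OF linear_right] U)
    also have "\<dots> = 6 * (t ^ 7 * \<bar>det ?U * s\<bar>) * t\<^sup>2 * of_bool (i = j)"
      unfolding e(1) using c2[of i] by (cases "i = j") simp_all
    also have "\<dots> = 6 * (t ^ 9 * \<bar>det ?U * s\<bar>) * of_bool (i = j)"
      by (simp add: power_numeral_reduce)
    finally show ?thesis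
      unfolding t9 by simp
  qed
  have coeff: "?\<psi> [E i, E j, E k] = ?c $ i * ?c $ j * ?c $ k * \<phi> [?U $ i, ?U $ j, ?U $ k]" for i j k
    unfolding pullback_def list.map Q by (rule alt3_scale[OF a])
  have "?\<psi> [E 1, E 2, E 3] = t ^ 3 * M"
    unfolding coeff vector_7 using m(5)[of x] m(1) by (simp add: power3_eq_cube)
  then have pos: "?\<psi> [E 1, E 2, E 3] > 0"
    using \<open>t > 0\<close> m(4) by simp
  have Uz: "B (?U $ i) z = 0" "B (?U $ i) y = 0" "B (?U $ i) x = 0" if "i \<in> {4, 5, 6, 7}" for i
    using U[of i 1] U[of i 2] U[of i 3] that unfolding vector_7
    by (auto simp: neq_7)
  have r: "\<phi> [y, z, w] = M * B w x" "\<phi> [x, z, w] = - (M * B w y)" for w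
    by (rule alt3_perm(1)[OF a m(5)] alt3_perm(4)[OF a m(6)])+
  have zero: "?\<psi> [E 1, E 2, E 4] = 0" "?\<psi> [E 1, E 2, E 5] = 0" "?\<psi> [E 1, E 2, E 6] = 0" "?\<psi>
      [E 1, E 2, E 7] = 0"
        "?\<psi> [E 1, E 3, E 4] = 0" "?\<psi> [E 1, E 3, E 5] = 0" "?\<psi> [E 1, E 3, E 6] = 0" "?\<psi>
            [E 1, E 3, E 7] = 0"
        "?\<psi> [E 2, E 3, E 4] = 0" "?\<psi> [E 2, E 3, E 5] = 0" "?\<psi> [E 2, E 3, E 6] = 0" "?\<psi>
            [E 2, E 3, E 7] = 0"
    unfolding coeff vector_7 m(7) r using Uz[of 4] Uz[of 5] Uz[of 6] Uz[of 7]
    unfolding vector_7 by simp_all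
  obtain R where "adapted ?\<psi> R"
    using adapted_of_orthonormal_split[OF a' zero pos cubic] by blast
  then have "adapted \<phi> (?Q ** R)"
    using a by (simp add: adapted_def pullback_def matrix_vector_mul_assoc)
  then show ?thesis ..
qed

subsection \<open>The differential on low-degree forms\<close>

lemma alt_form_3I:
  assumes deg: "\<And>xs. length xs \<noteq> 3 \<Longrightarrow> \<alpha> xs = 0"
    and lin: "\<And>y z. linear (\<lambda>x. \<alpha> [x, y, z])" "\<And>x z. linear (\<lambda>y. \<alpha> [x, y, z])"
      "\<And>x y. linear (\<lambda>z. \<alpha> [x, y, z])"
    and adj: "\<And>x z. \<alpha> [x, x, z] = 0" "\<And>x y. \<alpha> [x, y, y] = 0"
  shows "alt_form 3 \<alpha>"
proof (rule alt_formI)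
  fix us vs :: "(real^7) list"
  assume "length us + length vs + 1 = 3"
  then consider "length us = 0" "length vs = 2" | "length us = 1" "length vs = 1"
    | "length us = 2" "length vs = 0"
    by linarith
  then show "linear (\<lambda>x. \<alpha> (us @ x # vs))"
    using lin by cases (auto simp: numeral_2_eq_2 length_Suc_conv)
next
  fix us vs :: "(real^7) list" and x
  consider "length us = 0" "length vs = 1" | "length us = 1" "length vs = 0"
    | "length us + length vs + 2 \<noteq> 3"
    by linarith
  then show "\<alpha> (us @ x # x # vs) = 0"
    using adj deg by cases (auto simp: length_Suc_conv)
qed (rule deg)

lemma length_nths_remove2:
  assumes "i < j" "j < length xs"
  shows "length (nths xs (- {i, j})) = length xs - 2"
proof -
  have "{k. k < length xs \<and> k \<in> {i, j}} = {i, j}"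
    using assms by auto
  then have "length (nths xs {i, j}) = 2"
    using assms(1) by (simp add: length_nths)
  then show ?thesis
    using length_nths_Compl[of xs "{i, j}"] by simp
qed

lemma ce_diff_degree:
  assumes "alt_form k \<alpha>" "length xs \<noteq> Suc k"
  shows "ce_diff br \<alpha> xs = 0"
proof -
  have "\<alpha> (br (xs ! i) (xs ! j) # nths xs (- {i, j})) = 0" if "i < j" "j < length xs" for i j
    by (rule alt_form_degree[OF assms(1)])
      (use that assms(2) in \<open>simp add: length_nths_remove2[OF that]\<close>)
  then show ?thesis
    unfolding ce_diff_def by (intro sum.neutral) auto
qed

lemma pairs_below_0: "{(i, j). i < j \<and> j = (0::nat)} = {}"
  by auto

lemma sum_pairs_Suc:
  fixes t :: "nat \<times> nat \<Rightarrow> 'a::comm_monoid_add"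
  shows "(\<Sum>p\<in>{(i, j). i < j \<and> j < Suc n}. t p) = (\<Sum>p\<in>{(i, j). i < j \<and> j < n}. t p) + (\<Sum>i<n. t (i, n))"
proof -
  have "{(i, j). i < j \<and> j < Suc n} = {(i, j). i < j \<and> j < n} \<union> (\<lambda>i. (i, n)) ` {..<n}"
    by auto
  moreover have "finite {(i, j). i < j \<and> j < n}"
    by (rule finite_subset[of _ "{..<n} \<times> {..<n}"]) auto
  moreover have "{(i, j). i < j \<and> j < n} \<inter> (\<lambda>i. (i, n)) ` {..<n} = {}"
    by auto
  ultimately show ?thesis
    by (simp add: sum.union_disjoint sum.reindex inj_on_def)
qed

lemma ce_diff_3:
  "ce_diff br \<alpha> [x, y, z] = - \<alpha> [br x y, z] + \<alpha> [br x z, y] - \<alpha> [br y z, x]"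
  by (simp add: ce_diff_def sum_pairs_Suc pairs_below_0 lessThan_Suc nths_Cons)

lemma ce_diff_4:
  "ce_diff br \<alpha> [x1, x2, x3, x4] = - \<alpha> [br x1 x2, x3, x4] + \<alpha> [br x1 x3, x2, x4]
    - \<alpha> [br x1 x4, x2, x3] - \<alpha> [br x2 x3, x1, x4] + \<alpha> [br x2 x4, x1, x3] - \<alpha> [br x3 x4, x1, x2]"
  by (simp add: ce_diff_def sum_pairs_Suc pairs_below_0 lessThan_Suc nths_Cons)

lemma ce_diff_5:
  "ce_diff br \<alpha> [x1, x2, x3, x4, x5] = - \<alpha> [br x1 x2, x3, x4, x5] + \<alpha> [br x1 x3, x2, x4, x5]
    - \<alpha> [br x1 x4, x2, x3, x5] + \<alpha> [br x1 x5, x2, x3, x4] - \<alpha> [br x2 x3, x1, x4, x5]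
    + \<alpha> [br x2 x4, x1, x3, x5] - \<alpha> [br x2 x5, x1, x3, x4] - \<alpha> [br x3 x4, x1, x2, x5]
    + \<alpha> [br x3 x5, x1, x2, x4] - \<alpha> [br x4 x5, x1, x2, x3]"
  by (simp add: ce_diff_def sum_pairs_Suc pairs_below_0 lessThan_Suc nths_Cons)

lemma alt_form_ce_diff_2:
  assumes a: "alt_form 2 \<alpha>" and br: "bilinear br" "\<And>x. br x x = 0"
  shows "alt_form 3 (ce_diff br \<alpha>)"
proof (rule alt_form_3I)
  have 1: "linear (\<lambda>x. \<alpha> [x, y])" for y
    by (rule alt_form_linear_hd[OF a])
  have 2: "linear (\<lambda>y. \<alpha> [x, y])" for x
    using alt_form_linear_append[OF a, of "[x]" "[]"] by simp
  have b: "linear (\<lambda>x. br x y)" "linear (br x)" for x y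
    using br(1) by (auto simp: bilinear_def)
  note l = linear_add[OF 1] linear_add[OF 2] linear_cmul[OF 1] linear_cmul[OF 2]
    linear_add[OF b(1)] linear_add[OF b(2)] linear_cmul[OF b(1)] linear_cmul[OF b(2)]
  show "linear (\<lambda>x. ce_diff br \<alpha> [x, y, z])" for y z
    by (rule linearI) (simp_all add: ce_diff_3 l algebra_simps)
  show "linear (\<lambda>y. ce_diff br \<alpha> [x, y, z])" for x z
    by (rule linearI) (simp_all add: ce_diff_3 l algebra_simps)
  show "linear (\<lambda>z. ce_diff br \<alpha> [x, y, z])" for x y
    by (rule linearI) (simp_all add: ce_diff_3 l algebra_simps)
  have "\<alpha> [0, y] = 0" for y
    using linear_0[OF 1] .
  then show "ce_diff br \<alpha> [x, x, z] = 0" "ce_diff br \<alpha> [z, x, x] = 0" for x z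
    by (simp_all add: ce_diff_3 br(2))
qed (use ce_diff_degree[OF a] in simp)

subsection \<open>The Lie algebra n9\<close>

lemma n9_bilinear: "bilinear n9_bracket" and n9_alternating: "n9_bracket x x = 0"
  using lie_bracket_n9 by (auto simp: lie_bracket_def)

lemma n9_bracket_E:
    "n9_bracket (E 1) (E 2) = - E 3" "n9_bracket (E 1) (E 3) = - E 4" "n9_bracket (E 1) (E 4) = 0"
        "n9_bracket (E 1) (E 5) = - E 6"
    "n9_bracket (E 1) (E 6) = - E 7" "n9_bracket (E 1) (E 7) = 0" "n9_bracket (E 2) (E 3) = - E 5"
        "n9_bracket (E 2) (E 4) = - E 6"
    "n9_bracket (E 2) (E 5) = - E 7" "n9_bracket (E 2) (E 6) = 0" "n9_bracket (E 2) (E 7) = 0"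
        "n9_bracket (E 3) (E 4) = - E 7"
    "n9_bracket (E 3) (E 5) = 0" "n9_bracket (E 3) (E 6) = 0" "n9_bracket (E 3) (E 7) = 0"
        "n9_bracket (E 4) (E 5) = 0"
    "n9_bracket (E 4) (E 6) = 0" "n9_bracket (E 4) (E 7) = 0" "n9_bracket (E 5) (E 6) = 0"
        "n9_bracket (E 5) (E 7) = 0"
    "n9_bracket (E 6) (E 7) = 0"
  by (simp_all add: vec7_eq_iff n9_bracket_nth axis_def)

lemma alt4_rules:
  assumes a: "alt_form 4 \<alpha>"
  shows "\<alpha> [y, x, z, w] = - \<alpha> [x, y, z, w]" "\<alpha> [u, y, x, w] = - \<alpha> [u, x, y, w]"
    "\<alpha> [u, v, y, x] = - \<alpha> [u, v, x, y]"
    "\<alpha> [x, x, z, w] = 0" "\<alpha> [u, x, x, w] = 0" "\<alpha> [u, v, x, x] = 0"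
    "\<alpha> [0, u, v, w] = 0" "\<alpha> [- x, u, v, w] = - \<alpha> [x, u, v, w]"
  using alt_form_swap[OF a, of "[]" y "[]" x "[z, w]"] alt_form_swap[OF a, of "[u]" y "[]" x "[w]"]
    alt_form_swap[OF a, of "[u, v]" y "[]" x "[]"]
    alt_form_not_distinct[OF a, of "[x, x, z, w]"] alt_form_not_distinct[OF a, of "[u, x, x, w]"]
    alt_form_not_distinct[OF a, of "[u, v, x, x]"]
    linear_0[OF alt_form_linear_hd[OF a]] linear_neg[OF alt_form_linear_hd[OF a]]
  by simp_all

text \<open>
  Stokes' theorem for left-invariant forms: exact forms of top degree vanish because the Lie
  algebra is unimodular.
\<close>

lemma n9_integration_by_parts:
  assumes a: "alt_form 2 \<alpha>" and b: "alt_form 4 \<beta>"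
  shows "wedge (ce_diff n9_bracket \<alpha>) \<beta> (map E idx7) = - wedge \<alpha> (ce_diff n9_bracket \<beta>) (map E idx7)"
proof -
  have d: "alt_form 3 (ce_diff n9_bracket \<alpha>)"
    by (rule alt_form_ce_diff_2[OF a n9_bilinear n9_alternating])
  have z: "\<alpha> [0, y] = 0" "\<alpha> [- x, y] = - \<alpha> [x, y]" for x y
    using linear_0[OF alt_form_linear_hd[OF a]] linear_neg[OF alt_form_linear_hd[OF a]] by simp_all
  note s = alt2_rules(2)[OF a] and s1 = alt4_rules(1)[OF b] and s2 = alt4_rules(2)[OF b]
    and s3 = alt4_rules(3)[OF b]
  note r = z alt2_rules(1)[OF a] alt4_rules(4-8)[OF b]
    s[of "E 2" "E 1"] s[of "E 3" "E 1"] s[of "E 4" "E 1"] s[of "E 5" "E 1"]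
    s[of "E 6" "E 1"] s[of "E 7" "E 1"] s[of "E 3" "E 2"] s[of "E 4" "E 2"]
    s[of "E 5" "E 2"] s[of "E 6" "E 2"] s[of "E 7" "E 2"] s[of "E 4" "E 3"]
    s[of "E 5" "E 3"] s[of "E 6" "E 3"] s[of "E 7" "E 3"] s[of "E 5" "E 4"]
    s[of "E 6" "E 4"] s[of "E 7" "E 4"] s[of "E 6" "E 5"] s[of "E 7" "E 5"]
    s[of "E 7" "E 6"]
    s1[of "E 2" "E 1"] s1[of "E 3" "E 1"] s1[of "E 4" "E 1"] s1[of "E 5" "E 1"]
    s1[of "E 6" "E 1"] s1[of "E 7" "E 1"] s1[of "E 3" "E 2"] s1[of "E 4" "E 2"]
    s1[of "E 5" "E 2"] s1[of "E 6" "E 2"] s1[of "E 7" "E 2"] s1[of "E 4" "E 3"]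
    s1[of "E 5" "E 3"] s1[of "E 6" "E 3"] s1[of "E 7" "E 3"] s1[of "E 5" "E 4"]
    s1[of "E 6" "E 4"] s1[of "E 7" "E 4"] s1[of "E 6" "E 5"] s1[of "E 7" "E 5"]
    s1[of "E 7" "E 6"]
    s2[of _ "E 2" "E 1"] s2[of _ "E 3" "E 1"] s2[of _ "E 4" "E 1"] s2[of _ "E 5" "E 1"]
    s2[of _ "E 6" "E 1"] s2[of _ "E 7" "E 1"] s2[of _ "E 3" "E 2"] s2[of _ "E 4" "E 2"]
    s2[of _ "E 5" "E 2"] s2[of _ "E 6" "E 2"] s2[of _ "E 7" "E 2"] s2[of _ "E 4" "E 3"]
    s2[of _ "E 5" "E 3"] s2[of _ "E 6" "E 3"] s2[of _ "E 7" "E 3"] s2[of _ "E 5" "E 4"]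
    s2[of _ "E 6" "E 4"] s2[of _ "E 7" "E 4"] s2[of _ "E 6" "E 5"] s2[of _ "E 7" "E 5"]
    s2[of _ "E 7" "E 6"]
    s3[of _ _ "E 2" "E 1"] s3[of _ _ "E 3" "E 1"] s3[of _ _ "E 4" "E 1"] s3[of _ _ "E 5" "E 1"]
    s3[of _ _ "E 6" "E 1"] s3[of _ _ "E 7" "E 1"] s3[of _ _ "E 3" "E 2"] s3[of _ _ "E 4" "E 2"]
    s3[of _ _ "E 5" "E 2"] s3[of _ _ "E 6" "E 2"] s3[of _ _ "E 7" "E 2"] s3[of _ _ "E 4" "E 3"]
    s3[of _ _ "E 5" "E 3"] s3[of _ _ "E 6" "E 3"] s3[of _ _ "E 7" "E 3"] s3[of _ _ "E 5" "E 4"]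
    s3[of _ _ "E 6" "E 4"] s3[of _ _ "E 7" "E 4"] s3[of _ _ "E 6" "E 5"] s3[of _ _ "E 7" "E 5"]
    s3[of _ _ "E 7" "E 6"]
  show ?thesis
    unfolding map_idx7 wedge_3_4[OF d] wedge_2_5[OF a] ce_diff_3 ce_diff_5 n9_bracket_E
    by (simp only: r mult_zero_left mult_zero_right minus_zero diff_0 diff_0_right add_0_left add_0_right
        mult_minus_left mult_minus_right minus_minus)
      (simp add: algebra_simps)
qed

subsection \<open>Consequences of torsion-freeness and of closedness\<close>

lemma sum_length_3:
  "(\<Sum>A\<in>{A :: 7 list. length A = 3}. h A) = (\<Sum>a\<in>UNIV. \<Sum>b\<in>UNIV. \<Sum>c\<in>UNIV. h [a, b, c])"
  by (simp add: numeral_3_eq_3 sum_length_Suc sum_length_0[unfolded length_0_conv])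

lemma sum_length_2:
  "(\<Sum>A\<in>{A :: 7 list. length A = 2}. h A) = (\<Sum>a\<in>UNIV. \<Sum>b\<in>UNIV. h [a, b])"
  by (simp add: numeral_2_eq_2 sum_length_Suc sum_length_0[unfolded length_0_conv])

lemma wedge_star_3:
  assumes P: "adapted \<phi> P" and b: "alt_form 3 \<beta>"
  shows "6 * det P * wedge \<beta> (g2_star \<phi> 3 \<phi>) (map E idx7)
    = (\<Sum>a\<in>UNIV. \<Sum>b\<in>UNIV. \<Sum>c\<in>UNIV. \<beta> [P *v E a, P *v E b, P *v E c] * phi0 (E a) (E b) (E c))"
proof -
  have "alt_form 3 \<phi>"
    using P by (simp add: adapted_def)
  then show ?thesis
    using wedge_star[OF P b, of \<phi>] adapted_det[OF P] P
    unfolding sum_length_3 by (simp add: fact_numeral adapted_def)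
qed

lemma wedge_star_2:
  assumes P: "adapted \<phi> P" and t: "alt_form 2 \<tau>"
  shows "2 * det P * wedge \<tau> (g2_star \<phi> 2 \<tau>) (map E idx7)
    = (\<Sum>a\<in>UNIV. \<Sum>b\<in>UNIV. (\<tau> [P *v E a, P *v E b])\<^sup>2)"
  using wedge_star[OF P t t] adapted_det[OF P]
  unfolding sum_length_2 by (simp add: fact_numeral power2_eq_square)

lemma phi0_linear:
  "linear (\<lambda>u. phi0 u v w)" "linear (\<lambda>v. phi0 u v w)" "linear (phi0 u v)"
  by (rule linearI; simp add: phi0_def minor3_def algebra_simps)+

text \<open>The row \<open>P $ i\<close> is e^i written in the adapted frame. Thus the left side
  pairs e^{ijk} with \<phi>, and each of the six terms of the minor gives the same value of
  \<open>phi0\<close> after sorting its arguments.\<close>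

lemma phi0_sum_minor3:
  "(\<Sum>a\<in>UNIV. \<Sum>b\<in>UNIV. \<Sum>c\<in>UNIV. minor3 i j k (P *v E a) (P *v E b) (P *v E c) * phi0 (E a) (E b) (E c))
    = 6 * phi0 (P $ i) (P $ j) (P $ k)"
proof -
  have s: "(\<Sum>a\<in>UNIV. \<Sum>b\<in>UNIV. \<Sum>c\<in>UNIV. P $ i $ a * P $ j $ b * P $ k $ c * phi0 (E a) (E b) (E c))
      = phi0 (P $ i) (P $ j) (P $ k)" for i j k
  proof -
    have 2: "phi0 u (P $ j) w = (\<Sum>b\<in>UNIV. P $ j $ b * phi0 u (E b) w)" for u w
      by (rule linear_expand[OF phi0_linear(2)])
    have 3: "phi0 u v (P $ k) = (\<Sum>c\<in>UNIV. P $ k $ c * phi0 u v (E c))" for u v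
      by (rule linear_expand[OF phi0_linear(3)])
    have "phi0 (P $ i) (P $ j) (P $ k) = (\<Sum>a\<in>UNIV. P $ i $ a * phi0 (E a) (P $ j) (P $ k))"
      by (rule linear_expand[OF phi0_linear(1)])
    also have "\<dots> = (\<Sum>a\<in>UNIV. P $ i $ a * (\<Sum>b\<in>UNIV. P $ j $ b * (\<Sum>c\<in>UNIV. P $ k $ c * phi0 (E a) (E
        b) (E c))))"
      by (simp only: 2[of "E _"] 3[of "E _" "E _"])
    finally show ?thesis
      by (simp add: sum_distrib_left mult.assoc)
  qed
  have P: "(P *v E a) $ l = P $ l $ a" for a l
    by (simp add: matrix_vector_mult_basis column_def)
  have alt: "phi0 v u w = - phi0 u v w" "phi0 u w v = - phi0 u v w" "phi0 w v u = - phi0 u v w"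
    "phi0 v w u = phi0 u v w" "phi0 w u v = phi0 u v w" for u v w
    by (simp_all add: phi0_def minor3_def algebra_simps)
  have "minor3 i j k (P *v E a) (P *v E b) (P *v E c) * phi0 (E a) (E b) (E c) =
      P $ i $ a * P $ j $ b * P $ k $ c * phi0 (E a) (E b) (E c)
      - P $ i $ a * P $ k $ b * P $ j $ c * phi0 (E a) (E b) (E c)
      + P $ j $ a * P $ k $ b * P $ i $ c * phi0 (E a) (E b) (E c)
      - P $ j $ a * P $ i $ b * P $ k $ c * phi0 (E a) (E b) (E c)
      + P $ k $ a * P $ i $ b * P $ j $ c * phi0 (E a) (E b) (E c)
      - P $ k $ a * P $ j $ b * P $ i $ c * phi0 (E a) (E b) (E c)" for a b c
    unfolding minor3_def P by (simp add: algebra_simps)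
  then show ?thesis
    using alt[where u = "P $ i" and v = "P $ j" and w = "P $ k"]
    by (simp only: sum.distrib sum_subtractf s)
qed

text \<open>The G2 identity that contracting the 3-form with itself in two indices gives 6 times the
  metric; it turns the pairing of \<open>D\<close>-derivatives of \<phi> with \<phi> into a
  trace.\<close>

lemma phi0_contraction:
  "(\<Sum>b\<in>UNIV. \<Sum>c\<in>UNIV. phi0 u (E b) (E c) * phi0 v (E b) (E c)) = 6 * (u \<bullet> v)"
proof -
  have a: "phi0 u v v = 0" "phi0 u w v = - phi0 u v w" for u v w
    by (simp_all add: phi0_def minor3_def algebra_simps)
  note r = a(1) phi0_E
    a(2)[where v = "E 1" and w = "E 2"] a(2)[where v = "E 1" and w = "E 3"]
        a(2)[where v = "E 1" and w = "E 4"]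
    a(2)[where v = "E 1" and w = "E 5"] a(2)[where v = "E 1" and w = "E 6"]
        a(2)[where v = "E 1" and w = "E 7"]
    a(2)[where v = "E 2" and w = "E 3"] a(2)[where v = "E 2" and w = "E 4"]
        a(2)[where v = "E 2" and w = "E 5"]
    a(2)[where v = "E 2" and w = "E 6"] a(2)[where v = "E 2" and w = "E 7"]
        a(2)[where v = "E 3" and w = "E 4"]
    a(2)[where v = "E 3" and w = "E 5"] a(2)[where v = "E 3" and w = "E 6"]
        a(2)[where v = "E 3" and w = "E 7"]
    a(2)[where v = "E 4" and w = "E 5"] a(2)[where v = "E 4" and w = "E 6"]
        a(2)[where v = "E 4" and w = "E 7"]
    a(2)[where v = "E 5" and w = "E 6"] a(2)[where v = "E 5" and w = "E 7"]
        a(2)[where v = "E 6" and w = "E 7"]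
  show ?thesis
    unfolding sum_7 inner_vec_def by (simp only: r) (simp add: algebra_simps)
qed

section \<open>The seven-dimensional cross product\<close>

definition cross7 :: "real^7 \<Rightarrow> real^7 \<Rightarrow> real^7" where
  "cross7 u v = (\<chi> k. phi0 u v (E k))"

lemma cross7_inner: "cross7 u v \<bullet> w = phi0 u v w"
  by (subst linear_expand[OF phi0_linear(3), of u v w]) (simp add: inner_vec_def cross7_def mult.commute)

text \<open>The polarised form of |a x u|^2 = |a|^2 |u|^2 - (a.u)^2, here a polynomial identity in
  coordinates.\<close>

lemma cross7_identity: "cross7 a u \<bullet> cross7 a x = (a \<bullet> a) * (u \<bullet> x) - (a \<bullet> u) * (a \<bullet> x)"
  unfolding inner_vec_def sum_7 cross7_def
  by (simp only: vec_lambda_beta phi0_def minor3_def E_nth neq_7 of_bool_eq simp_thms mult_zero_left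
      mult_zero_right mult_1_right diff_0 diff_0_right add_0_left add_0_right minus_zero inner_real_def
      mult_minus_right)
    algebra

subsection \<open>Derivations and closed definite 3-forms on n9\<close>

lemma n9_bracket_nth7: "n9_bracket x y $ 7 = - (x $ 1 * y $ 6 - y $ 1 * x $ 6)
     - (x $ 3 * y $ 4 - y $ 3 * x $ 4) - (x $ 2 * y $ 5 - y $ 2 * x $ 5)"
  unfolding seven_eq_0 by (rule n9_bracket_nth(7))

text \<open>The equation \<open>dijk\<close> is component k of the derivation rule on
  \<open>E i\<close>, \<open>E j\<close>. The bracket is graded with \<open>E i\<close> in degree i,
  which explains the diagonal. The entries that mix \<open>E 1\<close> and \<open>E 2\<close> vanish
  because \<open>E 6\<close> and \<open>E 7\<close> are each produced by several brackets: for
  example \<open>d135\<close> and \<open>d146\<close> contain \<open>D (E 4) $ 5\<close> with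
  opposite signs.\<close>

lemma n9_derivation:
  assumes "derivation n9_bracket D"
  shows "D (E 2) $ 1 = 0" "D (E 1) $ 2 = 0" "D (E 4) $ 1 = 0"
    "D (E 4) $ 2 = 0" "D (E 4) $ 3 = 0" "D (E 4) $ 5 = 0"
    "D (E 6) $ 1 = 0" "D (E 6) $ 2 = 0" "D (E 6) $ 3 = 0"
    "D (E 6) $ 4 = 0" "D (E 6) $ 5 = 0" "D (E 7) $ 1 = 0"
    "D (E 7) $ 2 = 0" "D (E 7) $ 3 = 0" "D (E 7) $ 4 = 0"
    "D (E 7) $ 5 = 0" "D (E 7) $ 6 = 0" "D (E 2) $ 2 = 2 * D (E 1) $ 1"
    "D (E 3) $ 3 = 3 * D (E 1) $ 1" "D (E 4) $ 4 = 4 * D (E 1) $ 1" "D (E 5) $ 5 = 5 * D (E 1) $ 1"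
    "D (E 6) $ 6 = 6 * D (E 1) $ 1" "D (E 7) $ 7 = 7 * D (E 1) $ 1"
proof -
  have "linear D"
    using assms by (simp add: derivation_def)
  note lin = linear_neg[OF this] linear_0[OF this]
  have c: "D (n9_bracket (E i) (E j)) $ k
      = n9_bracket (D (E i)) (E j) $ k + n9_bracket (E i) (D (E j)) $ k" for i j k
    using assms by (simp add: derivation_def)
  note v = n9_bracket_nth n9_bracket_nth7 axis_def
  have d121: "- D (E 3) $ 1 = 0"
    using c[of 1 2 1] unfolding n9_bracket_E lin by (simp add: v)
  have d122: "- D (E 3) $ 2 = 0"
    using c[of 1 2 2] unfolding n9_bracket_E lin by (simp add: v)
  have d123: "D (E 1) $ 1 + D (E 2) $ 2 - D (E 3) $ 3 = 0"
    using c[of 1 2 3] unfolding n9_bracket_E lin by (simp add: v)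
  have d131: "- D (E 4) $ 1 = 0"
    using c[of 1 3 1] unfolding n9_bracket_E lin by (simp add: v)
  have d132: "- D (E 4) $ 2 = 0"
    using c[of 1 3 2] unfolding n9_bracket_E lin by (simp add: v)
  have d133: "D (E 3) $ 2 - D (E 4) $ 3 = 0"
    using c[of 1 3 3] unfolding n9_bracket_E lin by (simp add: v)
  have d134: "D (E 1) $ 1 + D (E 3) $ 3 - D (E 4) $ 4 = 0"
    using c[of 1 3 4] unfolding n9_bracket_E lin by (simp add: v)
  have d135: "D (E 1) $ 2 - D (E 4) $ 5 = 0"
    using c[of 1 3 5] unfolding n9_bracket_E lin by (simp add: v)
  have d146: "D (E 1) $ 2 + D (E 4) $ 5 = 0"
    using c[of 1 4 6] unfolding n9_bracket_E lin by (simp add: v)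
  have d151: "- D (E 6) $ 1 = 0"
    using c[of 1 5 1] unfolding n9_bracket_E lin by (simp add: v)
  have d152: "- D (E 6) $ 2 = 0"
    using c[of 1 5 2] unfolding n9_bracket_E lin by (simp add: v)
  have d153: "D (E 5) $ 2 - D (E 6) $ 3 = 0"
    using c[of 1 5 3] unfolding n9_bracket_E lin by (simp add: v)
  have d154: "D (E 5) $ 3 - D (E 6) $ 4 = 0"
    using c[of 1 5 4] unfolding n9_bracket_E lin by (simp add: v)
  have d155: "- D (E 6) $ 5 = 0"
    using c[of 1 5 5] unfolding n9_bracket_E lin by (simp add: v)
  have d156: "D (E 1) $ 1 + D (E 5) $ 5 - D (E 6) $ 6 = 0"
    using c[of 1 5 6] unfolding n9_bracket_E lin by (simp add: v)
  have d161: "- D (E 7) $ 1 = 0"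
    using c[of 1 6 1] unfolding n9_bracket_E lin by (simp add: v)
  have d162: "- D (E 7) $ 2 = 0"
    using c[of 1 6 2] unfolding n9_bracket_E lin by (simp add: v)
  have d163: "D (E 6) $ 2 - D (E 7) $ 3 = 0"
    using c[of 1 6 3] unfolding n9_bracket_E lin by (simp add: v)
  have d164: "D (E 6) $ 3 - D (E 7) $ 4 = 0"
    using c[of 1 6 4] unfolding n9_bracket_E lin by (simp add: v)
  have d165: "- D (E 7) $ 5 = 0"
    using c[of 1 6 5] unfolding n9_bracket_E lin by (simp add: v)
  have d166: "D (E 6) $ 5 - D (E 7) $ 6 = 0"
    using c[of 1 6 6] unfolding n9_bracket_E lin by (simp add: v)
  have d167: "D (E 1) $ 1 + D (E 6) $ 6 - D (E 7) $ 7 = 0"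
    using c[of 1 6 7] unfolding n9_bracket_E lin by (simp add: v)
  have d232: "- D (E 5) $ 2 = 0"
    using c[of 2 3 2] unfolding n9_bracket_E lin by (simp add: v)
  have d233: "- D (E 3) $ 1 - D (E 5) $ 3 = 0"
    using c[of 2 3 3] unfolding n9_bracket_E lin by (simp add: v)
  have d234: "D (E 2) $ 1 - D (E 5) $ 4 = 0"
    using c[of 2 3 4] unfolding n9_bracket_E lin by (simp add: v)
  have d235: "D (E 2) $ 2 + D (E 3) $ 3 - D (E 5) $ 5 = 0"
    using c[of 2 3 5] unfolding n9_bracket_E lin by (simp add: v)
  have d256: "D (E 2) $ 1 + D (E 5) $ 4 - D (E 7) $ 6 = 0"
    using c[of 2 5 6] unfolding n9_bracket_E lin by (simp add: v)
  have d257: "D (E 2) $ 2 + D (E 5) $ 5 - D (E 7) $ 7 = 0"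
    using c[of 2 5 7] unfolding n9_bracket_E lin by (simp add: v)
  show "D (E 2) $ 1 = 0"
    using d155 d166 d234 d256 by linarith
  show "D (E 1) $ 2 = 0"
    using d135 d146 by linarith
  show "D (E 4) $ 1 = 0"
    using d131 by linarith
  show "D (E 4) $ 2 = 0"
    using d132 by linarith
  show "D (E 4) $ 3 = 0"
    using d122 d133 by linarith
  show "D (E 4) $ 5 = 0"
    using d135 d146 by linarith
  show "D (E 6) $ 1 = 0"
    using d151 by linarith
  show "D (E 6) $ 2 = 0"
    using d152 by linarith
  show "D (E 6) $ 3 = 0"
    using d153 d232 by linarith
  show "D (E 6) $ 4 = 0"
    using d121 d154 d233 by linarith
  show "D (E 6) $ 5 = 0"
    using d155 by linarith
  show "D (E 7) $ 1 = 0"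
    using d161 by linarith
  show "D (E 7) $ 2 = 0"
    using d162 by linarith
  show "D (E 7) $ 3 = 0"
    using d152 d163 by linarith
  show "D (E 7) $ 4 = 0"
    using d153 d164 d232 by linarith
  show "D (E 7) $ 5 = 0"
    using d165 by linarith
  show "D (E 7) $ 6 = 0"
    using d155 d166 by linarith
  show "D (E 2) $ 2 = 2 * D (E 1) $ 1"
    using d156 d167 d257 by linarith
  show "D (E 3) $ 3 = 3 * D (E 1) $ 1"
    using d123 d156 d167 d257 by linarith
  show "D (E 4) $ 4 = 4 * D (E 1) $ 1"
    using d123 d134 d156 d167 d257 by linarith
  show "D (E 5) $ 5 = 5 * D (E 1) $ 1"
    using d123 d156 d167 d235 d257 by linarith
  show "D (E 6) $ 6 = 6 * D (E 1) $ 1"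
    using d123 d156 d167 d235 d257 by linarith
  show "D (E 7) $ 7 = 7 * D (E 1) $ 1"
    using d123 d156 d167 d235 d257 by linarith
qed

text \<open>Here \<open>qijkl\<close> is a component of the closedness equation. The conclusions
  leave six free coefficients in the contraction with the central vector \<open>E 7\<close>. Two of
  the vanishings need a pair of equations: 167 and 347 are equal and opposite, and then so are 257
  and 356.\<close>

lemma n9_closed:
  assumes a: "alt_form 3 \<phi>" and d: "\<And>xs. ce_diff n9_bracket \<phi> xs = 0"
  shows "\<phi> [E 1, E 6, E 7] = 0"
    "\<phi> [E 2, E 5, E 7] = 0"
    "\<phi> [E 3, E 4, E 7] = 0"
    "\<phi> [E 3, E 6, E 7] = 0"
    "\<phi> [E 4, E 5, E 7] = 0"
    "\<phi> [E 4, E 6, E 7] = 0"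
    "\<phi> [E 5, E 6, E 7] = 0"
    "\<phi> [E 3, E 5, E 7] = - \<phi> [E 2, E 6, E 7]"
    "\<phi> [E 1, E 5, E 7] = \<phi> [E 2, E 4, E 7]"
proof -
  have c: "ce_diff n9_bracket \<phi> [x, y, z, w] = 0" for x y z w
    by (rule d)
  have z: "\<phi> [0, y, z] = 0" "\<phi> [- x, y, z] = - \<phi> [x, y, z]" for x y z
    using linear_0[OF alt_form_linear_hd[OF a]] linear_neg[OF alt_form_linear_hd[OF a]] by simp_all
  note r = z alt3_repeat[OF a] minus_minus minus_zero diff_0 diff_0_right add_0_left add_0_right
    diff_minus_eq_add
    alt3_perm[OF a refl[of "\<phi> [E 1, E 5, E 7]"]]
    alt3_perm[OF a refl[of "\<phi> [E 1, E 6, E 7]"]]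
    alt3_perm[OF a refl[of "\<phi> [E 2, E 4, E 7]"]]
    alt3_perm[OF a refl[of "\<phi> [E 2, E 5, E 7]"]]
    alt3_perm[OF a refl[of "\<phi> [E 2, E 6, E 7]"]]
    alt3_perm[OF a refl[of "\<phi> [E 3, E 4, E 7]"]]
    alt3_perm[OF a refl[of "\<phi> [E 3, E 5, E 6]"]]
    alt3_perm[OF a refl[of "\<phi> [E 3, E 5, E 7]"]]
    alt3_perm[OF a refl[of "\<phi> [E 3, E 6, E 7]"]]
    alt3_perm[OF a refl[of "\<phi> [E 4, E 5, E 7]"]]
    alt3_perm[OF a refl[of "\<phi> [E 4, E 6, E 7]"]]
    alt3_perm[OF a refl[of "\<phi> [E 5, E 6, E 7]"]]
  have q1237: "- \<phi> [E 1, E 5, E 7] + \<phi> [E 2, E 4, E 7] = 0"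
    using c[of "E 1" "E 2" "E 3" "E 7"] unfolding ce_diff_4 n9_bracket_E by (simp only: r)
  have q1247: "- \<phi> [E 1, E 6, E 7] + \<phi> [E 3, E 4, E 7] = 0"
    using c[of "E 1" "E 2" "E 4" "E 7"] unfolding ce_diff_4 n9_bracket_E by (simp only: r)
  have q1256: "\<phi> [E 1, E 6, E 7] + \<phi> [E 2, E 5, E 7] + \<phi> [E 3, E 5, E 6] = 0"
    using c[of "E 1" "E 2" "E 5" "E 6"] unfolding ce_diff_4 n9_bracket_E by (simp only: r)
  have q1257: "\<phi> [E 2, E 6, E 7] + \<phi> [E 3, E 5, E 7] = 0"
    using c[of "E 1" "E 2" "E 5" "E 7"] unfolding ce_diff_4 n9_bracket_E by (simp only: r)
  have q1267: "\<phi> [E 3, E 6, E 7] = 0"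
    using c[of "E 1" "E 2" "E 6" "E 7"] unfolding ce_diff_4 n9_bracket_E by (simp only: r)
  have q1346: "\<phi> [E 1, E 6, E 7] + \<phi> [E 3, E 4, E 7] = 0"
    using c[of "E 1" "E 3" "E 4" "E 6"] unfolding ce_diff_4 n9_bracket_E by (simp only: r)
  have q1357: "\<phi> [E 3, E 6, E 7] + \<phi> [E 4, E 5, E 7] = 0"
    using c[of "E 1" "E 3" "E 5" "E 7"] unfolding ce_diff_4 n9_bracket_E by (simp only: r)
  have q1367: "\<phi> [E 4, E 6, E 7] = 0"
    using c[of "E 1" "E 3" "E 6" "E 7"] unfolding ce_diff_4 n9_bracket_E by (simp only: r)
  have q2345: "\<phi> [E 2, E 5, E 7] + \<phi> [E 3, E 4, E 7] - \<phi> [E 3, E 5, E 6] = 0"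
    using c[of "E 2" "E 3" "E 4" "E 5"] unfolding ce_diff_4 n9_bracket_E by (simp only: r)
  have q2367: "\<phi> [E 5, E 6, E 7] = 0"
    using c[of "E 2" "E 3" "E 6" "E 7"] unfolding ce_diff_4 n9_bracket_E by (simp only: r)
  show "\<phi> [E 1, E 6, E 7] = 0"
    using q1247 q1346 by linarith
  show "\<phi> [E 2, E 5, E 7] = 0"
    using q1256 q1346 q2345 by linarith
  show "\<phi> [E 3, E 4, E 7] = 0"
    using q1247 q1346 by linarith
  show "\<phi> [E 3, E 6, E 7] = 0"
    using q1267 by linarith
  show "\<phi> [E 4, E 5, E 7] = 0"
    using q1267 q1357 by linarith
  show "\<phi> [E 4, E 6, E 7] = 0"
    using q1367 by linarith
  show "\<phi> [E 5, E 6, E 7] = 0"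
    using q2367 by linarith
  show "\<phi> [E 3, E 5, E 7] = - \<phi> [E 2, E 6, E 7]"
    using q1257 by linarith
  show "\<phi> [E 1, E 5, E 7] = \<phi> [E 2, E 4, E 7]"
    using q1237 by linarith
qed

section \<open>Definiteness and the soliton equation on n9\<close>

lemma endo_pull_3: "endo_pull D \<alpha> [x, y, z] = \<alpha> [D x, y, z] + \<alpha> [x, D y, z] + \<alpha> [x, y, D z]"
  by (simp add: endo_pull_def numeral_3_eq_3 lessThan_Suc)

text \<open>Rank six says that the contraction with \<open>E 7\<close> has kernel spanned by
  \<open>E 7\<close>. In it \<open>E 6\<close> pairs only with \<open>E 2\<close>, and after
  removing this pair the Pfaffian on the indices 1, 3, 4, 5 reduces to the product of the entries at
  14 and 35; so both coefficients occur as factors.\<close>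

lemma n9_definite_nonzero:
  assumes d: "definite \<phi>" and cl: "\<And>xs. ce_diff n9_bracket \<phi> xs = 0"
  shows "\<phi> [E 2, E 6, E 7] \<noteq> 0" "\<phi> [E 1, E 4, E 7] \<noteq> 0"
proof -
  have a: "alt_form 3 \<phi>"
    using d by (simp add: definite_def)
  note c = n9_closed[OF a cl]
  let ?\<beta> = "contract (E 7) \<phi>"
  have b: "alt_form 2 ?\<beta>"
    using a by (rule alt_form_3_contract)
  have e: "?\<beta> [E i, E j] = \<phi> [E i, E j, E 7]" for i j
    using alt3_perm(2)[OF a refl[of "\<phi> [E i, E j, E 7]"]] by (simp only: contract_def)
  have e7: "?\<beta> [E i, E 7] = 0" for i
    unfolding contract_def by (rule alt3_repeat(2)[OF a])
  have ker: "x \<in> span {E 7}" if "\<And>y. ?\<beta> [x, y] = 0" for x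
    by (rule definite_kernel[OF d]) (use that in \<open>simp_all add: contract_def axis_eq_0_iff\<close>)
  have sp: "x $ i = 0" if "x \<in> span {E 7}" "i \<noteq> 7" for x i
    using that by (auto simp: span_singleton E_nth)
  have exp: "?\<beta> [x, y] =
      \<phi> [E 1, E 2, E 7] * (x $ 1 * y $ 2 - x $ 2 * y $ 1)
      + \<phi> [E 1, E 3, E 7] * (x $ 1 * y $ 3 - x $ 3 * y $ 1)
      + \<phi> [E 1, E 4, E 7] * (x $ 1 * y $ 4 - x $ 4 * y $ 1)
      + \<phi> [E 2, E 4, E 7] * (x $ 1 * y $ 5 - x $ 5 * y $ 1)
      + \<phi> [E 2, E 3, E 7] * (x $ 2 * y $ 3 - x $ 3 * y $ 2)
      + \<phi> [E 2, E 4, E 7] * (x $ 2 * y $ 4 - x $ 4 * y $ 2)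
      + \<phi> [E 2, E 6, E 7] * (x $ 2 * y $ 6 - x $ 6 * y $ 2)
      - \<phi> [E 2, E 6, E 7] * (x $ 3 * y $ 5 - x $ 5 * y $ 3)" for x y
    unfolding alt2_expand[OF b, of x y] e7
    unfolding e c by (simp add: algebra_simps)
  show nz: "\<phi> [E 2, E 6, E 7] \<noteq> 0"
  proof
    assume "\<phi> [E 2, E 6, E 7] = 0"
    then have "?\<beta> [E 6, y] = 0" for y
      unfolding exp by (simp add: axis_def)
    from sp[OF ker[OF this], of 6] show False
      by (simp add: axis_def)
  qed
  show "\<phi> [E 1, E 4, E 7] \<noteq> 0"
  proof
    assume z: "\<phi> [E 1, E 4, E 7] = 0"
    let ?c = "\<phi> [E 2, E 6, E 7]" and ?s = "\<phi> [E 2, E 4, E 7]" and ?p = "\<phi> [E 1, E 3, E 7]"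
    \<comment> \<open>Solves the kernel equations with first coordinate 1: the coefficients of
      \<open>y $ 6\<close>, \<open>y $ 5\<close>, \<open>y $ 3\<close>, \<open>y $ 2\<close>
      determine coordinates 2, 3, 5, 6 in turn when coordinate 4 is set to 0, and the coefficient of
      \<open>y $ 1\<close> then cancels.\<close>
    let ?x = "vector [1, 0, ?s / ?c, 0, - ?p / ?c,
        (\<phi> [E 1, E 2, E 7] - \<phi> [E 2, E 3, E 7] * (?s / ?c)) / ?c, 0] :: real^7"
    have "?\<beta> [?x, y] = 0" for y
      unfolding exp vector_7 z using nz by (simp add: field_simps)
    from sp[OF ker[OF this], of 1] show False
      unfolding vector_7 by simp
  qed
qed

text \<open>At both triples the off-diagonal part of \<open>D\<close> contributes nothing: each such
  term contains either a vanishing entry of \<open>D\<close>, a coefficient killed by closedness, or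
  a repeated vector. What remains is the weight of the triple, 2 + 6 + 7 or 1 + 4 + 7, times
  \<open>D (E 1) $ 1\<close>.\<close>

lemma n9_soliton_constants:
  assumes d: "definite \<phi>" and cl: "\<And>xs. ce_diff n9_bracket \<phi> xs = 0"
    and t: "alt_form 2 \<tau>" and D: "derivation n9_bracket D"
    and sol: "\<And>xs. ce_diff n9_bracket \<tau> xs = l * \<phi> xs + endo_pull D \<phi> xs"
  shows "l = 0" "D (E 1) $ 1 = 0"
proof -
  have a: "alt_form 3 \<phi>"
    using d by (simp add: definite_def)
  note c = n9_closed[OF a cl] and v = n9_derivation[OF D]
  have z: "\<tau> [0, y] = 0" for y
    using linear_0[OF alt_form_linear_hd[OF t]] .
  have 1: "\<phi> [x, y, z] = (\<Sum>i\<in>UNIV. x $ i * \<phi> [E i, y, z])" for x y z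
    by (rule linear_expand[OF alt_form_linear_hd[OF a]])
  have 2: "\<phi> [x, y, z] = (\<Sum>i\<in>UNIV. y $ i * \<phi> [x, E i, z])" for x y z
    using linear_expand[OF alt_form_linear_append[OF a, of "[x]" "[z]"], of y] by simp
  have 3: "\<phi> [x, y, z] = (\<Sum>i\<in>UNIV. z $ i * \<phi> [x, y, E i])" for x y z
    using linear_expand[OF alt_form_linear_append[OF a, of "[x, y]" "[]"], of z] by simp
  note r = alt3_repeat[OF a] c v mult_zero_left mult_zero_right add_0_left add_0_right minus_zero
  have "0 = l * \<phi> [E 2, E 6, E 7] + endo_pull D \<phi> [E 2, E 6, E 7]"
    using sol[of "[E 2, E 6, E 7]"] unfolding ce_diff_3 n9_bracket_E z by simp
  moreover have "\<phi> [D (E 2), E 6, E 7] = 2 * D (E 1) $ 1 * \<phi> [E 2, E 6, E 7]"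
    unfolding 1[of "D (E 2)"] sum_7 by (simp only: r)
  moreover have "\<phi> [E 2, D (E 6), E 7] = 6 * D (E 1) $ 1 * \<phi> [E 2, E 6, E 7]"
    unfolding 2[of _ "D (E 6)"] sum_7 by (simp only: r)
  moreover have "\<phi> [E 2, E 6, D (E 7)] = 7 * D (E 1) $ 1 * \<phi> [E 2, E 6, E 7]"
    unfolding 3[of _ _ "D (E 7)"] sum_7 by (simp only: r)
  ultimately have "(l + 15 * D (E 1) $ 1) * \<phi> [E 2, E 6, E 7] = 0"
    by (simp add: endo_pull_3 algebra_simps)
  moreover
  have "0 = l * \<phi> [E 1, E 4, E 7] + endo_pull D \<phi> [E 1, E 4, E 7]"
    using sol[of "[E 1, E 4, E 7]"] unfolding ce_diff_3 n9_bracket_E z by simp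
  moreover have "\<phi> [D (E 1), E 4, E 7] = D (E 1) $ 1 * \<phi> [E 1, E 4, E 7]"
    unfolding 1[of "D (E 1)"] sum_7
    by (simp only: r alt3_perm(3)[OF a c(5)] alt3_perm(3)[OF a c(6)])
  moreover have "\<phi> [E 1, D (E 4), E 7] = 4 * D (E 1) $ 1 * \<phi> [E 1, E 4, E 7]"
    unfolding 2[of _ "D (E 4)"] sum_7 by (simp only: r)
  moreover have "\<phi> [E 1, E 4, D (E 7)] = 7 * D (E 1) $ 1 * \<phi> [E 1, E 4, E 7]"
    unfolding 3[of _ _ "D (E 7)"] sum_7 by (simp only: r)
  ultimately have "(l + 15 * D (E 1) $ 1) * \<phi> [E 2, E 6, E 7] = 0"
    "(l + 12 * D (E 1) $ 1) * \<phi> [E 1, E 4, E 7] = 0"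
    by (simp_all add: endo_pull_3 algebra_simps)
  then have "l + 15 * D (E 1) $ 1 = 0" "l + 12 * D (E 1) $ 1 = 0"
    using n9_definite_nonzero[OF d cl] by simp_all
  then show "l = 0" "D (E 1) $ 1 = 0"
    by simp_all
qed

lemma n9_derivation_trace:
  assumes D: "derivation n9_bracket D" and z: "D (E 1) $ 1 = 0"
  shows "trace (matrix D) = 0"
proof -
  have "matrix D $ i $ i = D (E i) $ i" for i
    by (simp add: matrix_def)
  then show ?thesis
    unfolding trace_def sum_7 by (simp only: n9_derivation[OF D] z mult_zero_right add_0_right)
qed

text \<open>In the adapted frame \<open>D\<close> becomes its conjugate \<open>M\<close>, which has
  the same trace. Each of the three slots contributes \<open>6 * trace M\<close> by
  \<open>phi0_contraction\<close>, the last two after a cyclic or transposed relabelling of the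
  summation indices.\<close>

lemma wedge_endo_pull_star:
  assumes P: "adapted \<phi> P" and D: "linear D" and t: "trace (matrix D) = 0"
    and a: "alt_form 3 (endo_pull D \<phi>)"
  shows "wedge (endo_pull D \<phi>) (g2_star \<phi> 3 \<phi>) (map E idx7) = 0"
proof -
  let ?Q = "matrix_inv P"
  define M where "M = ?Q ** matrix D ** P"
  have M: "P *v (M *v x) = D (P *v x)" for x
  proof -
    have "P ** M = matrix D ** P"
      by (simp add: M_def matrix_mul_assoc adapted_inverse[OF P])
    then have "P *v (M *v x) = matrix D *v (P *v x)"
      by (simp add: matrix_vector_mul_assoc)
    also have "\<dots> = D (P *v x)"
      using fun_cong[OF matrix_vector_mul(2)[OF D]] .
    finally show ?thesis .
  qed
  have "trace M = trace (matrix D ** P ** ?Q)"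
    unfolding M_def by (metis trace_mul_sym matrix_mul_assoc)
  also have "\<dots> = 0"
    using t by (simp add: matrix_mul_assoc[symmetric] adapted_inverse[OF P])
  finally have tM: "trace M = 0" .
  let ?S = "\<lambda>h :: 7 \<Rightarrow> 7 \<Rightarrow> 7 \<Rightarrow> real. \<Sum>a\<in>UNIV. \<Sum>b\<in>UNIV. \<Sum>c\<in>UNIV. h a b c"
  let ?h = "\<lambda>a b c. phi0 (M *v E a) (E b) (E c) * phi0 (E a) (E b) (E c)"
  have alt: "phi0 v u w = - phi0 u v w" "phi0 v w u = phi0 u v w" for u v w
    by (simp_all add: phi0_def minor3_def algebra_simps)
  have s1: "?S ?h = 0"
  proof -
    have "?S ?h = (\<Sum>a\<in>UNIV. 6 * ((M *v E a) \<bullet> E a))"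
      by (simp only: phi0_contraction)
    also have "\<dots> = 6 * trace M"
      by (simp add: trace_def sum_distrib_left inner_axis matrix_vector_mult_basis column_def)
    finally show ?thesis
      by (simp add: tM)
  qed
  have "phi0 (E a) (M *v E b) (E c) * phi0 (E a) (E b) (E c) = ?h b a c" for a b c
    using alt(1)[of "E a" "M *v E b" "E c"] alt(1)[of "E a" "E b" "E c"] by simp
  then have s2: "?S (\<lambda>a b c. phi0 (E a) (M *v E b) (E c) * phi0 (E a) (E b) (E c)) = ?S ?h"
    by (simp only:) (rule sum.swap)
  have "phi0 (E a) (E b) (M *v E c) * phi0 (E a) (E b) (E c) = ?h c a b" for a b c
    by (simp only: alt(2)[of "E a" "E b" "M *v E c"] alt(2)[of "E a" "E b" "E c"])
  then have "?S (\<lambda>a b c. phi0 (E a) (E b) (M *v E c) * phi0 (E a) (E b) (E c))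
      = (\<Sum>a\<in>UNIV. \<Sum>c\<in>UNIV. \<Sum>b\<in>UNIV. ?h c a b)"
    by (simp only:) (rule sum.cong[OF refl], rule sum.swap)
  also have "\<dots> = ?S ?h"
    by (rule sum.swap)
  finally have s3: "?S (\<lambda>a b c. phi0 (E a) (E b) (M *v E c) * phi0 (E a) (E b) (E c)) = ?S ?h" .
  have "endo_pull D \<phi> [P *v u, P *v v, P *v w] = phi0 (M *v u) v w + phi0 u (M *v v) w + phi0 u v (M
      *v w)" for u v w
    using P unfolding endo_pull_3 M[symmetric] by (simp add: adapted_def)
  then have "6 * det P * wedge (endo_pull D \<phi>) (g2_star \<phi> 3 \<phi>) (map E idx7) = 0"
    unfolding wedge_star_3[OF P a] by (simp only: distrib_right sum.distrib s1 s2 s3)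
  then show ?thesis
    using adapted_det[OF P] by simp
qed

text \<open>Integration by parts turns the pairing in \<open>z\<close> into -\<tau> wedge d*\<phi>.
  Both torsion equations together say d*\<phi> = -*\<tau>, so the pairing is \<tau> wedge *\<tau>, a
  positive multiple up to orientation of the sum of squares of the frame components of
  \<tau>.\<close>

lemma n9_torsion_vanishes:
  assumes P: "adapted \<phi> P" and t: "torsion_form n9_bracket \<phi> \<tau>"
    and z: "wedge (ce_diff n9_bracket \<tau>) (g2_star \<phi> 3 \<phi>) (map E idx7) = 0"
  shows "\<tau> xs = 0"
proof -
  have a: "alt_form 3 \<phi>"
    using P by (simp add: adapted_def)
  have b: "alt_form 2 \<tau>" and t1: "wedge \<tau> \<phi> = (\<lambda>xs. (-1) * g2_star \<phi> 2 \<tau> xs)"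
    and t2: "ce_diff n9_bracket (g2_star \<phi> 3 \<phi>) = wedge \<tau> \<phi>"
    using t by (auto simp: torsion_form_def fun_eq_iff)
  have s: "alt_form 4 (g2_star \<phi> 3 \<phi>)"
    by (rule alt_form_star[OF P a]) simp
  have "wedge \<tau> (g2_star \<phi> 2 \<tau>) (map E idx7) = 0"
    using n9_integration_by_parts[OF b s] z unfolding t2 t1 wedge_scale_right by simp
  then have "(\<Sum>a\<in>UNIV. \<Sum>b\<in>UNIV. (\<tau> [P *v E a, P *v E b])\<^sup>2) = 0"
    using wedge_star_2[OF P b] by simp
  then have "\<tau> [P *v E a, P *v E b] = 0" for a b
    by (simp add: sum_nonneg_eq_0_iff sum_nonneg)
  then have p: "pullback P \<tau> [E a, E b] = 0" for a b
    by (simp add: pullback_def)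
  have "\<tau> [x, y] = 0" for x y
  proof -
    have "\<tau> [x, y] = pullback P \<tau> [matrix_inv P *v x, matrix_inv P *v y]"
      by (simp add: pullback_def adapted_matrix_inv_mult[OF P])
    also have "\<dots> = 0"
      using alt2_expand[OF alt_form_pullback[OF b], of P "matrix_inv P *v x" "matrix_inv P *v y"]
      unfolding p by simp
    finally show ?thesis .
  qed
  then show ?thesis
    using alt_form_degree[OF b, of xs] by (cases "length xs = 2") (auto simp: numeral_2_eq_2
        length_Suc_conv)
qed

section \<open>Closed and coclosed structures on n9\<close>

lemma n9_exact_pairing:
  assumes P: "adapted \<phi> P" and d: "\<And>xs. ce_diff n9_bracket (g2_star \<phi> 3 \<phi>) xs = 0"
    and s: "alt_form 2 \<sigma>"
  shows "(\<Sum>a\<in>UNIV. \<Sum>b\<in>UNIV. \<Sum>c\<in>UNIV.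
    ce_diff n9_bracket \<sigma> [P *v E a, P *v E b, P *v E c] * phi0 (E a) (E b) (E c)) = 0"
proof -
  have a: "alt_form 3 \<phi>"
    using P by (simp add: adapted_def)
  have "ce_diff n9_bracket (g2_star \<phi> 3 \<phi>) = (\<lambda>xs. 0)"
    using d by auto
  then have "wedge (ce_diff n9_bracket \<sigma>) (g2_star \<phi> 3 \<phi>) (map E idx7) = 0"
    using n9_integration_by_parts[OF s alt_form_star[OF P a, of 4]] by (simp add: wedge_zero)
  then show ?thesis
    using wedge_star_3[OF P alt_form_ce_diff_2[OF s n9_bilinear n9_alternating]] by simp
qed

text \<open>A coclosed \<phi> is orthogonal to every exact 3-form. The differentials of e^15, e^16,
  e^26, e^17, e^27, e^45, e^36 span e^123, e^124, e^125, e^126, e^134, e^135, e^234, and the pairing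
  of e^{ijk} with \<phi> is \<open>phi0\<close> of the corresponding rows.\<close>

lemma n9_coclosed_minors:
  assumes P: "adapted \<phi> P" and d: "\<And>xs. ce_diff n9_bracket (g2_star \<phi> 3 \<phi>) xs = 0"
  shows "phi0 (P $ 1) (P $ 2) (P $ 3) = 0" "phi0 (P $ 1) (P $ 2) (P $ 4) = 0"
    "phi0 (P $ 1) (P $ 2) (P $ 5) = 0" "phi0 (P $ 1) (P $ 2) (P $ 6) = 0"
    "phi0 (P $ 1) (P $ 3) (P $ 4) = 0" "phi0 (P $ 1) (P $ 3) (P $ 5) = 0"
proof -
  have cf: "alt_form 2 (coframe [i, j])" for i j
    using alt_form_coframe[of "[i, j]"] by (simp add: numeral_2_eq_2 del: coframe.simps)
  note s = n9_exact_pairing[OF P d cf]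
  have c: "ce_diff n9_bracket (coframe [1, 5]) [x, y, z] = - minor3 1 2 3 x y z"
    "ce_diff n9_bracket (coframe [1, 6]) [x, y, z] = - minor3 1 2 4 x y z"
    "ce_diff n9_bracket (coframe [2, 6]) [x, y, z] = minor3 1 2 5 x y z"
    "ce_diff n9_bracket (coframe [1, 7]) [x, y, z] = - minor3 1 3 4 x y z - minor3 1 2 5 x y z"
    "ce_diff n9_bracket (coframe [2, 7]) [x, y, z] = minor3 1 2 6 x y z - minor3 2 3 4 x y z"
    "ce_diff n9_bracket (coframe [4, 5]) [x, y, z] = minor3 1 3 5 x y z - minor3 2 3 4 x y z"
    "ce_diff n9_bracket (coframe [3, 6]) [x, y, z]
      = minor3 1 2 6 x y z + minor3 1 3 5 x y z + minor3 2 3 4 x y z" for x y z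
    unfolding ce_diff_3 coframe_pair n9_bracket_nth n9_bracket_nth7 minor3_def
    by (simp_all add: algebra_simps)
  note m = mult_minus_left left_diff_distrib distrib_right sum_negf sum_subtractf sum.distrib
      phi0_sum_minor3
  have "phi0 (P $ 1) (P $ 2) (P $ 3) = 0" "phi0 (P $ 1) (P $ 2) (P $ 4) = 0" "phi0 (P $ 1) (P $ 2)
      (P $ 5) = 0"
    using s[of 1 5] s[of 1 6] s[of 2 6] unfolding c m by simp_all
  moreover have "- (6 * phi0 (P $ 1) (P $ 3) (P $ 4)) - 6 * phi0 (P $ 1) (P $ 2) (P $ 5) = 0"
    using s[of 1 7] unfolding c m .
  \<comment> \<open>The values at 126, 135 and 234 coincide and sum to 0, hence all three
    vanish.\<close>
  moreover have "6 * phi0 (P $ 1) (P $ 2) (P $ 6) - 6 * phi0 (P $ 2) (P $ 3) (P $ 4) = 0"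
    "6 * phi0 (P $ 1) (P $ 3) (P $ 5) - 6 * phi0 (P $ 2) (P $ 3) (P $ 4) = 0"
    "6 * phi0 (P $ 1) (P $ 2) (P $ 6) + 6 * phi0 (P $ 1) (P $ 3) (P $ 5) + 6 * phi0 (P $ 2) (P $ 3)
        (P $ 4) = 0"
    using s[of 2 7] s[of 4 5] s[of 3 6] unfolding c m .
  ultimately show "phi0 (P $ 1) (P $ 2) (P $ 3) = 0" "phi0 (P $ 1) (P $ 2) (P $ 4) = 0"
    "phi0 (P $ 1) (P $ 2) (P $ 5) = 0" "phi0 (P $ 1) (P $ 2) (P $ 6) = 0"
    "phi0 (P $ 1) (P $ 3) (P $ 4) = 0" "phi0 (P $ 1) (P $ 3) (P $ 5) = 0"
    by linarith+
qed

lemma phi0_alternating: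
  "phi0 u u v = 0" "phi0 u v v = 0" "phi0 u v u = 0" "phi0 v u w = - phi0 u v w"
  "phi0 u w v = - phi0 u v w" "phi0 v w u = phi0 u v w"
  by (simp_all add: phi0_def minor3_def algebra_simps)

text \<open>Alternation rewrites the value as an inner product of two cross products with the common
  factor \<open>a\<close>. By \<open>cross7_identity\<close> it is a combination of (u x b).u, which
  is 0, and a.(u x b), which is 0 by assumption.\<close>

lemma phi0_cross7_cross7:
  assumes "phi0 u a b = 0"
  shows "phi0 (cross7 u a) (cross7 u b) a = 0"
proof -
  have s: "cross7 u a = - cross7 a u"
    by (simp add: vec_eq_iff cross7_def phi0_alternating(4)[of u a])
  have "phi0 (cross7 u a) (cross7 u b) a = - (cross7 a (cross7 u b) \<bullet> cross7 u a)"
    unfolding cross7_inner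
    using phi0_alternating(6)[of "cross7 u a" "cross7 u b" a]
        phi0_alternating(5)[of a "cross7 u b" "cross7 u a"]
      phi0_alternating(6)[of a "cross7 u a" "cross7 u b"] by simp
  also have "\<dots> = cross7 a (cross7 u b) \<bullet> cross7 a u"
    unfolding s by simp
  also have "\<dots>
      = (a \<bullet> a) * (cross7 u b \<bullet> u) - (a \<bullet> cross7 u b) * (a \<bullet> u)"
    by (simp add: cross7_identity)
  also have "\<dots> = 0"
    unfolding inner_commute[of a "cross7 u b"] cross7_inner
    using assms phi0_alternating(3)[of u b] phi0_alternating(5)[of u b a] by simp
  finally show ?thesis .
qed

text \<open>The equality case of Cauchy-Schwarz, multiplied by \<open>a \<bullet> a\<close> to avoid
  division.\<close>

lemma cross7_eq_0:
  assumes "cross7 a w = 0"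
  shows "(a \<bullet> a) *\<^sub>R w = (a \<bullet> w) *\<^sub>R a"
proof -
  have "(a \<bullet> a) * (w \<bullet> w) - (a \<bullet> w) * (a \<bullet> w) = 0"
    using cross7_identity[of a w w] assms by simp
  then have "(a \<bullet> a) * ((a \<bullet> a) * (w \<bullet> w) - (a \<bullet> w) * (a \<bullet> w)) = 0"
    by simp
  then have "((a \<bullet> a) *\<^sub>R w - (a \<bullet> w) *\<^sub>R a) \<bullet> ((a \<bullet> a) *\<^sub>R w - (a \<bullet> w) *\<^sub>R a) = 0"
    by (simp add: inner_diff_left inner_diff_right inner_commute[of w a] algebra_simps)
  then show ?thesis
    by simp
qed

lemma cross7_linear: "linear (cross7 u)"
  by (rule linearI) (simp_all add: vec_eq_iff cross7_def linear_add[OF phi0_linear(2)]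
      linear_cmul[OF phi0_linear(2)])

text \<open>
  With \<open>f\<^sub>i\<close> the metric duals of \<open>e\<^sup>i\<close>, being coclosed forces \<open>f\<^sub>1 \<times> f\<^sub>2\<close> and \<open>f\<^sub>1 \<times> f\<^sub>3\<close> into the span
  of \<open>e\<^sub>6, e\<^sub>7\<close>, and being closed makes \<open>e\<^sub>6 \<times> e\<^sub>7\<close> a multiple of \<open>f\<^sub>2\<close>; but
  \<open>(f\<^sub>1 \<times> f\<^sub>2) \<times> (f\<^sub>1 \<times> f\<^sub>3)\<close> is orthogonal to \<open>f\<^sub>2\<close>.
\<close>

lemma n9_not_torsion_free:
  assumes d: "definite \<phi>" and P: "adapted \<phi> P"
    and cl: "\<And>xs. ce_diff n9_bracket \<phi> xs = 0"
    and cocl: "\<And>xs. ce_diff n9_bracket (g2_star \<phi> 3 \<phi>) xs = 0"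
  shows False
proof -
  have a: "alt_form 3 \<phi>"
    using d by (simp add: definite_def)
  note c = n9_closed[OF a cl] and m = n9_coclosed_minors[OF P cocl]
  have indep: "r = 0 \<and> s = 0 \<and> t = 0" if "r *\<^sub>R P $ 1 + s *\<^sub>R P $ 2 + t *\<^sub>R P $ 3 = 0" for r s t :: real
  proof -
    let ?k = "r *\<^sub>R E 1 + s *\<^sub>R E 2 + t *\<^sub>R E 3 :: real^7"
    have e: "transpose P *v E i = P $ i" for i
      by (simp only: matrix_vector_mult_basis) (simp add: column_def transpose_def vec_eq_iff)
    have "transpose P *v ?k = 0"
      using that by (simp only: matrix_vector_right_distrib matrix_vector_mult_scaleR e)
    moreover have "transpose (matrix_inv P) ** transpose P = mat 1"
      by (simp only: matrix_transpose_mul[symmetric] adapted_inverse[OF P] transpose_mat)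
    moreover have "?k = (transpose (matrix_inv P) ** transpose P) *v ?k"
      unfolding calculation(2) by (simp only: matrix_vector_mul_lid)
    ultimately have "?k = 0"
      unfolding matrix_vector_mul_assoc[symmetric] by (simp only: matrix_vector_mult_0_right)
    then have "?k $ 1 = 0" "?k $ 2 = 0" "?k $ 3 = 0"
      by simp_all
    then show ?thesis
      by (simp add: axis_def)
  qed
  \<comment> \<open>In frame coordinates the row \<open>P $ i\<close> is the metric dual of e^i, so
    the components of a cross product of rows are exactly the values of \<open>phi0\<close> on rows
    that coclosedness controls.\<close>
  have comp: "(P *v x) $ i = x \<bullet> P $ i" for x i
    by (simp add: matrix_vector_mult_def inner_vec_def mult.commute)
  have inj: "x = 0" if "P *v x = 0" for x
    using adapted_matrix_inv_mult(2)[OF P, of x] that by simp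
  let ?X = "cross7 (P $ 1) (P $ 2)" and ?Y = "cross7 (P $ 1) (P $ 3)"
  let ?h = "phi0 (P $ 1) (P $ 2) (P $ 7)"
  let ?k = "phi0 (P $ 1) (P $ 3) (P $ 6)" and ?l = "phi0 (P $ 1) (P $ 3) (P $ 7)"
  have X: "P *v ?X = ?h *\<^sub>R E 7"
    unfolding vec_eq_iff all_7 comp cross7_inner vector_scaleR_component
    by (simp only: m phi0_alternating(2,3) E_nth neq_7 of_bool_eq simp_thms real_scaleR_def
        mult_zero_right mult_1_right)
  have "phi0 (P $ 1) (P $ 3) (P $ 2) = 0"
    using m(1) phi0_alternating(5)[of "P $ 1" "P $ 3" "P $ 2"] by simp
  then have Y: "P *v ?Y = ?k *\<^sub>R E 6 + ?l *\<^sub>R E 7"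
    unfolding vec_eq_iff all_7 comp cross7_inner vector_scaleR_component vector_add_component
    by (simp only: m phi0_alternating(2,3) E_nth neq_7 of_bool_eq simp_thms real_scaleR_def
        mult_zero_right
        mult_1_right add_0_left add_0_right)
  \<comment> \<open>Among the coefficients at i67, closedness leaves only i = 2; thus the cross
    product of \<open>E 6\<close> and \<open>E 7\<close> is dual to a multiple of e^2.\<close>
  have e67: "\<phi> [E 6, E 7, w] = w $ 2 * \<phi> [E 2, E 6, E 7]" for w
  proof -
    have "\<phi> [E 6, E 7, w] = (\<Sum>i\<in>UNIV. w $ i * \<phi> [E 6, E 7, E i])"
      using linear_expand[OF alt_form_linear_append[OF a, of "[E 6, E 7]" "[]"], of w] by simp
    also have "\<dots> = (\<Sum>i\<in>UNIV. w $ i * \<phi> [E i, E 6, E 7])"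
      using alt3_perm(1)[OF a refl] by metis
    also have "\<dots> = w $ 2 * \<phi> [E 2, E 6, E 7]"
      unfolding sum_7 by (simp only: c alt3_repeat[OF a] mult_zero_right add_0_left add_0_right)
    finally show ?thesis .
  qed
  have "0 = phi0 ?X ?Y (P $ 2)"
    by (rule phi0_cross7_cross7[symmetric]) (rule m(1))
  also have "\<dots> = \<phi> [P *v ?X, P *v ?Y, P *v (P $ 2)]"
    using P by (simp add: adapted_def)
  also have "\<dots> = ?h * \<phi> [E 7, ?k *\<^sub>R E 6 + ?l *\<^sub>R E 7, P *v (P $ 2)]"
    unfolding X Y linear_cmul[OF alt_form_linear_hd[OF a]] real_scaleR_def ..
  also have "\<dots> = ?h * ?k * \<phi> [E 7, E 6, P *v (P $ 2)]"
  proof -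
    have l: "linear (\<lambda>x. \<phi> [E 7, x, P *v (P $ 2)])"
      using alt_form_linear_append[OF a, of "[E 7]" "[P *v (P $ 2)]"] by simp
    show ?thesis
      unfolding linear_add[OF l] linear_cmul[OF l] alt3_repeat[OF a] real_scaleR_def mult_zero_right
        add_0_right mult.assoc ..
  qed
  also have "\<dots> = - ?h * ?k * (P $ 2 \<bullet> P $ 2) * \<phi> [E 2, E 6, E 7]"
    using alt3_perm(3)[OF a e67[of "P *v (P $ 2)"]] by (simp add: comp)
  finally have "- ?h * ?k * (P $ 2 \<bullet> P $ 2) * \<phi> [E 2, E 6, E 7] = 0"
    by (rule sym)
  then have "?h = 0 \<or> ?k = 0 \<or> P $ 2 = 0"
    using n9_definite_nonzero(1)[OF d cl]
    by (simp only: mult_eq_0_iff neg_equal_0_iff_equal inner_eq_zero_iff) blast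
  moreover have "P $ 2 \<noteq> 0"
  proof
    assume "P $ 2 = 0"
    then show False
      using indep[of 0 1 0] by simp
  qed
  moreover have n1: "P $ 1 \<bullet> P $ 1 \<noteq> 0"
  proof
    assume "P $ 1 \<bullet> P $ 1 = 0"
    then show False
      using indep[of 1 0 0] by simp
  qed
  \<comment> \<open>If \<open>?h\<close> were 0, the cross product of the first two rows would
    vanish and these rows would be dependent.\<close>
  moreover have h: "?h \<noteq> 0"
  proof
    assume "?h = 0"
    then have "P *v ?X = 0"
      unfolding X by (simp only: scaleR_zero_left)
    from cross7_eq_0[OF inj[OF this]]
    have "(- (P $ 1 \<bullet> P $ 2)) *\<^sub>R P $ 1 + (P $ 1 \<bullet> P $ 1) *\<^sub>R P $ 2 + 0 *\<^sub>R P $ 3 = 0"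
      by (simp only: scaleR_minus_left scaleR_zero_left add_0_right left_minus)
    from indep[OF this] show False
      using n1 by blast
  qed
  \<comment> \<open>If \<open>?k\<close> were 0, both cross products would be multiples of
    \<open>E 7\<close>. The combination that cancels them makes
    \<open>?h *\<^sub>R P $ 3 - ?l *\<^sub>R P $ 2\<close> proportional to the first row, a
    dependence with a nonzero coefficient at the third.\<close>
  moreover have "?k \<noteq> 0"
  proof
    assume k: "?k = 0"
    have "P *v (?h *\<^sub>R ?Y - ?l *\<^sub>R ?X) = 0"
      unfolding matrix_vector_mult_diff_distrib matrix_vector_mult_scaleR X Y k by simp
    then have "?h *\<^sub>R ?Y - ?l *\<^sub>R ?X = 0"
      by (rule inj)
    then have "cross7 (P $ 1) (?h *\<^sub>R P $ 3 - ?l *\<^sub>R P $ 2) = 0"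
      by (simp only: linear_diff[OF cross7_linear] linear_cmul[OF cross7_linear])
    note eq = cross7_eq_0[OF this]
    let ?r = "P $ 1 \<bullet> (?h *\<^sub>R P $ 3 - ?l *\<^sub>R P $ 2)"
    have "(P $ 1 \<bullet> P $ 1) *\<^sub>R (?h *\<^sub>R P $ 3 - ?l *\<^sub>R P $ 2)
        = (- (P $ 1 \<bullet> P $ 1 * ?l)) *\<^sub>R P $ 2 + (P $ 1 \<bullet> P $ 1 * ?h) *\<^sub>R P $ 3"
      by (simp only: scaleR_diff_right scaleR_scaleR scaleR_minus_left) simp
    then have "(- ?r) *\<^sub>R P $ 1 + (- (P $ 1 \<bullet> P $ 1 * ?l)) *\<^sub>R P $ 2 + (P $ 1 \<bullet> P $ 1 * ?h) *\<^sub>R P $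
        3 = 0"
      unfolding eq add.assoc by (simp only: scaleR_minus_left left_minus)
    from indep[OF this] show False
      using n1 h by simp
  qed
  ultimately show False
    by blast
qed

theorem proposition5p5:
  shows "\<not> (\<exists>\<phi>. semi_algebraic_soliton n9_bracket \<phi>)"
proof
  assume "\<exists>\<phi>. semi_algebraic_soliton n9_bracket \<phi>"
  then obtain \<phi> \<tau> l D where d: "definite \<phi>" and cl: "\<And>xs. ce_diff n9_bracket \<phi> xs = 0"
    and t: "torsion_form n9_bracket \<phi> \<tau>" and D: "derivation n9_bracket D"
    and sol: "\<And>xs. ce_diff n9_bracket \<tau> xs = l * \<phi> xs + endo_pull D \<phi> xs"
    unfolding semi_algebraic_soliton_def closed_g2_structure_def by blast
  obtain P where P: "adapted \<phi> P"
    using adapted_exists[OF d] by blast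
  have b: "alt_form 2 \<tau>"
    using t by (simp add: torsion_form_def)
  note z = n9_soliton_constants[OF d cl b D sol]
  have e: "ce_diff n9_bracket \<tau> = endo_pull D \<phi>"
    using sol z by auto
  \<comment> \<open>With \<lambda> = 0 the form \<open>endo_pull D \<phi>\<close> equals d\<tau>,
    from which it inherits being alternating.\<close>
  have "alt_form 3 (endo_pull D \<phi>)"
    using alt_form_ce_diff_2[OF b n9_bilinear n9_alternating] unfolding e .
  moreover have "linear D"
    using D by (simp add: derivation_def)
  ultimately have "wedge (ce_diff n9_bracket \<tau>) (g2_star \<phi> 3 \<phi>) (map E idx7) = 0"
    unfolding e using wedge_endo_pull_star[OF P _ n9_derivation_trace[OF D z(2)]] by blast
  then have "\<tau> = (\<lambda>xs. 0)"
    using n9_torsion_vanishes[OF P t] by auto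
  then have "ce_diff n9_bracket (g2_star \<phi> 3 \<phi>) xs = 0" for xs
    using t by (simp add: torsion_form_def wedge_zero)
  then show False
    by (rule n9_not_torsion_free[OF d P cl])
qed

end
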